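(* Let $X$ be a finite alphabet with at least two letters and let $k\ge 2$. The quotient-posets of $(\mathcal{R}_k;\leq_{CA})$, of $(\mathcal{A}_k;\leq_{CA})$, and of $(\mathcal{F}_{\mathcal{T}_k};\leq_h)$ are pairwise isomorphic.
   Context: $X^\omega$ is the set of infinite words over $X$ with the Cantor (product) topology; $\bar k=\{0,\dots,k-1\}$. A $k$-partition of $X^\omega$ is a function $L:X^\omega\to\bar k$; its components are $L^{-1}(i)$, $i<k$. An automaton is $\mathcal{M}=(Q,f,in)$ with finite state set $Q$, transition function $f:Q\times X\to Q$ (extended to words as usual) and initial state $in$. For $\xi\in X^\omega$, $f_{\mathcal M}(\xi)$ is the set of states occurring infinitely often in the run $f(in,\xi\upharpoonright_n)$, $n<\omega$. A Muller acceptor $(\mathcal M,\mathcal F)$ recognises $\{\xi: f_{\mathcal M}(\xi)\in\mathcal F\}$; such sets are the regular $\omega$-languages. $\mathcal M$ is aperiodic if for all states $q$, nonempty words $u$ and $n>0$, $f(q,u^n)=q$ implies $f(q,u)=q$; an $\omega$-language is aperiodic if recognised by a Muller acceptor with aperiodic automaton. $\mathcal{R}_k$ (resp. $\mathcal{A}_k$) is the set of $k$-partitions of $X^\omega$ all of whose components are regular (resp. aperiodic). For $k$-partitions $A,B$, $A\leq_{CA}B$ iff $A=B\circ g$ for some continuous $g:X^\omega\to X^\omega$. For a preorder $Q$, a $Q$-forest is a finite nonempty poset in which every lower cone $\{y:y\le x\}$ is a chain, equipped with a labeling $c$ into $Q$; a $Q$-tree is a $Q$-forest with a least element. For $Q$-forests,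 $(P,c)\leq_h(P',c')$ iff there is a monotone map $\varphi:P\to P'$ with $c(x)\le c'(\varphi(x))$ for all $x\in P$. $\mathcal{T}_k$ is the set of $\bar k$-trees ($\bar k$ ordered as an antichain, i.e. labels must be equal) with $\le_h$; $\mathcal{F}_{\mathcal{T}_k}$ is the set of $\mathcal{T}_k$-forests (forests whose nodes are labeled by elements of $\mathcal{T}_k$, labels compared by $\le_h$), preordered by $\le_h$. *)

theory Defs
  imports "HOL-Analysis.Analysis"
begin

type_synonym 'x oword = "nat \<Rightarrow> 'x"

definition cantor_top :: "'x oword topology" where
  "cantor_top = product_topology (\<lambda>_::nat. discrete_topology (UNIV::'x set)) UNIV"

definition is_automaton :: "nat set \<Rightarrow> (nat \<Rightarrow> 'x \<Rightarrow> nat) \<Rightarrow> nat \<Rightarrow> bool" where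
  "is_automaton Q f q0 \<longleftrightarrow> finite Q \<and> q0 \<in> Q \<and> (\<forall>q\<in>Q. \<forall>a. f q a \<in> Q)"

definition ext_tr :: "(nat \<Rightarrow> 'x \<Rightarrow> nat) \<Rightarrow> nat \<Rightarrow> 'x list \<Rightarrow> nat" where
  "ext_tr f q u = foldl f q u"

definition run :: "(nat \<Rightarrow> 'x \<Rightarrow> nat) \<Rightarrow> nat \<Rightarrow> 'x oword \<Rightarrow> nat \<Rightarrow> nat" where
  "run f q0 \<xi> n = ext_tr f q0 (map \<xi> [0..<n])"

definition inf_states :: "(nat \<Rightarrow> 'x \<Rightarrow> nat) \<Rightarrow> nat \<Rightarrow> 'x oword \<Rightarrow> nat set" where
  "inf_states f q0 \<xi> = {q. \<exists>\<^sub>\<infinity>n. run f q0 \<xi> n = q}"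

definition muller_lang :: "(nat \<Rightarrow> 'x \<Rightarrow> nat) \<Rightarrow> nat \<Rightarrow> nat set set \<Rightarrow> 'x oword set" where
  "muller_lang f q0 F = {\<xi>. inf_states f q0 \<xi> \<in> F}"

definition aperiodic_automaton :: "nat set \<Rightarrow> (nat \<Rightarrow> 'x \<Rightarrow> nat) \<Rightarrow> bool" where
  "aperiodic_automaton Q f \<longleftrightarrow>
     (\<forall>q\<in>Q. \<forall>u::'x list. \<forall>n::nat. u \<noteq> [] \<and> n > 0 \<and> ext_tr f q (concat (replicate n u)) = q
        \<longrightarrow> ext_tr f q u = q)"

definition regular_lang :: "'x oword set \<Rightarrow> bool" where
  "regular_lang L \<longleftrightarrow> (\<exists>Q f q0 F. is_automaton Q f q0 \<and> F \<subseteq> Pow Q \<and> L = muller_lang f q0 F)"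

definition aperiodic_lang :: "'x oword set \<Rightarrow> bool" where
  "aperiodic_lang L \<longleftrightarrow> (\<exists>Q f q0 F. is_automaton Q f q0 \<and> aperiodic_automaton Q f \<and>
                                      F \<subseteq> Pow Q \<and> L = muller_lang f q0 F)"

definition kpartitions :: "nat \<Rightarrow> ('x oword \<Rightarrow> nat) set" where
  "kpartitions k = {L. \<forall>\<xi>. L \<xi> < k}"

definition R_k :: "nat \<Rightarrow> ('x oword \<Rightarrow> nat) set" where
  "R_k k = {L \<in> kpartitions k. \<forall>i<k. regular_lang (L -` {i})}"

definition A_k :: "nat \<Rightarrow> ('x oword \<Rightarrow> nat) set" where
  "A_k k = {L \<in> kpartitions k. \<forall>i<k. aperiodic_lang (L -` {i})}"

definition ca_le :: "('x oword \<Rightarrow> nat) \<Rightarrow> ('x oword \<Rightarrow> nat) \<Rightarrow> bool" where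
  "ca_le A B \<longleftrightarrow> (\<exists>g. continuous_map cantor_top cantor_top g \<and> A = B \<circ> g)"

type_synonym 'l lforest = "nat set \<times> (nat \<times> nat) set \<times> (nat \<Rightarrow> 'l)"

definition is_forest :: "'l set \<Rightarrow> 'l lforest \<Rightarrow> bool" where
  "is_forest Lab F \<longleftrightarrow> (case F of (P, r, c) \<Rightarrow>
     finite P \<and> P \<noteq> {} \<and> partial_order_on P r \<and>
     (\<forall>x\<in>P. \<forall>y z. (y, x) \<in> r \<and> (z, x) \<in> r \<longrightarrow> (y, z) \<in> r \<or> (z, y) \<in> r) \<and>
     (\<forall>x\<in>P. c x \<in> Lab))"

definition is_tree :: "'l set \<Rightarrow> 'l lforest \<Rightarrow> bool" where
  "is_tree Lab F \<longleftrightarrow> is_forest Lab F \<and> (case F of (P, r, c) \<Rightarrow> \<exists>m\<in>P. \<forall>x\<in>P. (m, x) \<in> r)"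

definition h_le :: "('l \<Rightarrow> 'l \<Rightarrow> bool) \<Rightarrow> 'l lforest \<Rightarrow> 'l lforest \<Rightarrow> bool" where
  "h_le leq F G \<longleftrightarrow> (case F of (P, r, c) \<Rightarrow> case G of (P', r', c') \<Rightarrow>
     (\<exists>\<phi>. \<phi> ` P \<subseteq> P' \<and> (\<forall>x\<in>P. \<forall>y\<in>P. (x, y) \<in> r \<longrightarrow> (\<phi> x, \<phi> y) \<in> r') \<and>
          (\<forall>x\<in>P. leq (c x) (c' (\<phi> x)))))"

text \<open>T_k: trees labelled in {0..<k} (an antichain, so labels compare by equality).\<close>
definition T_k :: "nat \<Rightarrow> nat lforest set" where
  "T_k k = {T. is_tree {..<k} T}"

definition le_T :: "nat lforest \<Rightarrow> nat lforest \<Rightarrow> bool" where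
  "le_T = h_le (=)"

definition F_T_k :: "nat \<Rightarrow> nat lforest lforest set" where
  "F_T_k k = {F. is_forest (T_k k) F}"

definition le_F :: "nat lforest lforest \<Rightarrow> nat lforest lforest \<Rightarrow> bool" where
  "le_F = h_le le_T"

definition equiv_class :: "'a set \<Rightarrow> ('a \<Rightarrow> 'a \<Rightarrow> bool) \<Rightarrow> 'a \<Rightarrow> 'a set" where
  "equiv_class S le a = {b \<in> S. le a b \<and> le b a}"

definition quot_classes :: "'a set \<Rightarrow> ('a \<Rightarrow> 'a \<Rightarrow> bool) \<Rightarrow> 'a set set" where
  "quot_classes S le = equiv_class S le ` S"

definition quot_le :: "('a \<Rightarrow> 'a \<Rightarrow> bool) \<Rightarrow> 'a set \<Rightarrow> 'a set \<Rightarrow> bool" where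
  "quot_le le C D \<longleftrightarrow> (\<exists>a\<in>C. \<exists>b\<in>D. le a b)"

definition quot_iso :: "'a set \<Rightarrow> ('a \<Rightarrow> 'a \<Rightarrow> bool) \<Rightarrow> 'b set \<Rightarrow> ('b \<Rightarrow> 'b \<Rightarrow> bool) \<Rightarrow> bool" where
  "quot_iso S le T le' \<longleftrightarrow>
     (\<exists>h. bij_betw h (quot_classes S le) (quot_classes T le') \<and>
          (\<forall>C\<in>quot_classes S le. \<forall>D\<in>quot_classes S le. quot_le le C D \<longleftrightarrow> quot_le le' (h C) (h D)))"

end

(* A partition recognised by an automaton is compared with a forest of trees through an intermediate
   sequence space. A point of it is a sequence of pairs (p, t), where p is a node of the outer forest that
   never descends and hence is eventually constant, and t is a node of the tree labelling p; its colour is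
   the label of the meet of the nodes t that occur infinitely often. The colouring of this space is
   equivalent, under continuous reductions in both directions, to a suitable aperiodic partition (words
   a^m b code commands "go to (p, t)"), and every regular partition is equivalent to the colouring for the
   forest whose nodes are chains of loops of its automaton: one keeps track of the strongly connected
   components passed so far and of a stack of the sets of states visited between two visits of the same
   state. It remains to see that colour-preserving continuous maps between two such sequence spaces exist
   exactly when the forests are comparable. A morphism of forests acts on sequences once consecutive meets
   have been inserted. Conversely, for each node one restricts to a cylinder on which the position of the
   image is maximal, and reads off the colour of the image of a generic sequence. *)

theory Submission
  imports Defs "HOL-Library.Sublist" "HOL-Library.Nat_Bijection"
begin

subsection \<open>Continuity of maps between sequence spaces\<close>

text \<open>The two levels of a forest behave differently under limits, and this shapes both
  directions. An outer position is reached after finitely many steps and can then only rise, so a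
  finite prefix of the input forces a lower bound for it. A limit meet is never decided by a prefix:
  the best one can secure is a lower bound on a whole cone of inputs that no smaller cone improves,
  and the colour is then extracted by a diagonal construction. In the other direction the obstacle
  is that monotone maps of trees need not preserve meets; they do preserve a lower bound that
  recurs, and inserting meets produces one. Aperiodicity comes from the way commands act: they raise
  the outer node, overwrite the inner node or are ignored, so no word permutes states nontrivially.
  For regular partitions the stack of loops plays the part of a latest appearance record. Since
  forests stand on the other side of both representation results, no direct passage from a regular
  partition to an aperiodic one is ever constructed.\<close>

definition seqcont :: "(nat \<Rightarrow> 'a) set \<Rightarrow> ((nat \<Rightarrow> 'a) \<Rightarrow> (nat \<Rightarrow> 'b)) \<Rightarrow> bool" where
  "seqcont D h \<longleftrightarrow> (\<forall>s\<in>D. \<forall>n. \<exists>m. \<forall>s'\<in>D. (\<forall>i<m. s' i = s i) \<longrightarrow> h s' n = h s n)"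

lemma seqcontD:
  assumes "seqcont D h" "s \<in> D"
  shows "\<exists>m. \<forall>s'\<in>D. (\<forall>i<m. s' i = s i) \<longrightarrow> (\<forall>i<n. h s' i = h s i)"
proof (induction n)
  case 0
  then show ?case by simp
next
  case (Suc n)
  then obtain m where m: "\<forall>s'\<in>D. (\<forall>i<m. s' i = s i) \<longrightarrow> (\<forall>i<n. h s' i = h s i)" by blast
  obtain m' where m': "\<forall>s'\<in>D. (\<forall>i<m'. s' i = s i) \<longrightarrow> h s' n = h s n"
    using assms unfolding seqcont_def by blast
  have "\<forall>s'\<in>D. (\<forall>i<max m m'. s' i = s i) \<longrightarrow> (\<forall>i<Suc n. h s' i = h s i)"
    using m m' by (auto simp: less_Suc_eq)
  then show ?case by blast
qed

lemma seqcont_comp: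
  assumes h: "seqcont D h" and g: "seqcont E g" and im: "\<And>s. s \<in> D \<Longrightarrow> h s \<in> E"
  shows "seqcont D (\<lambda>s. g (h s))"
  unfolding seqcont_def
proof (intro ballI allI)
  fix s n assume s: "s \<in> D"
  obtain m where m: "\<forall>s'\<in>E. (\<forall>i<m. s' i = h s i) \<longrightarrow> g s' n = g (h s) n"
    using g im[OF s] unfolding seqcont_def by blast
  obtain l where l: "\<forall>s'\<in>D. (\<forall>i<l. s' i = s i) \<longrightarrow> (\<forall>i<m. h s' i = h s i)"
    using seqcontD[OF h s] by blast
  show "\<exists>m. \<forall>s'\<in>D. (\<forall>i<m. s' i = s i) \<longrightarrow> g (h s') n = g (h s) n"
  proof (intro exI ballI impI)
    fix s' assume s': "s' \<in> D" "\<forall>i<l. s' i = s i"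
    then show "g (h s') n = g (h s) n" using m[rule_format, OF im[OF s'(1)]] l by simp
  qed
qed

text \<open>A basic open set of the product restricts only finitely many coordinates, so a bound on
  their indices yields a cylinder; conversely, cylinders are basic open.\<close>

lemma openin_cantor_top:
  fixes U :: "'x oword set"
  shows "openin cantor_top U \<longleftrightarrow> (\<forall>s\<in>U. \<exists>m. \<forall>s'. (\<forall>i<m. s' i = s i) \<longrightarrow> s' \<in> U)"
proof
  assume U: "openin cantor_top U"
  show "\<forall>s\<in>U. \<exists>m. \<forall>s'. (\<forall>i<m. s' i = s i) \<longrightarrow> s' \<in> U"
  proof
    fix s assume "s \<in> U"
    then obtain V where V: "finite {i. V i \<noteq> (UNIV::'x set)}" "s \<in> Pi\<^sub>E UNIV V" "Pi\<^sub>E UNIV V \<subseteq> U"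
      using U unfolding cantor_top_def openin_product_topology_alt by fastforce
    obtain m where m: "\<forall>i\<in>{i. V i \<noteq> UNIV}. i < m"
      using V(1) finite_nat_set_iff_bounded by auto
    have "s' \<in> U" if "\<forall>i<m. s' i = s i" for s'
    proof -
      have "s' i \<in> V i" for i
        using m that V(2) by (cases "V i = UNIV") (auto simp: PiE_def Pi_def)
      then show ?thesis using V(3) by auto
    qed
    then show "\<exists>m. \<forall>s'. (\<forall>i<m. s' i = s i) \<longrightarrow> s' \<in> U" by blast
  qed
next
  assume R: "\<forall>s\<in>U. \<exists>m. \<forall>s'. (\<forall>i<m. s' i = s i) \<longrightarrow> s' \<in> U"
  have "\<exists>V. finite {i \<in> UNIV. V i \<noteq> topspace (discrete_topology (UNIV::'x set))} \<and>
             (\<forall>i\<in>UNIV. openin (discrete_topology (UNIV::'x set)) (V i)) \<and> s \<in> Pi\<^sub>E UNIV V \<and> Pi\<^sub>E UNIV V \<subseteq> U"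
    if s: "s \<in> U" for s
  proof -
    obtain m where m: "\<forall>s'. (\<forall>i<m. s' i = s i) \<longrightarrow> s' \<in> U" using R s by blast
    let ?V = "\<lambda>i. if i < m then {s i} else UNIV"
    have "{i. ?V i \<noteq> UNIV} \<subseteq> {..<m}" by auto
    then have "finite {i. ?V i \<noteq> UNIV}" using finite_subset by blast
    moreover have "Pi\<^sub>E UNIV ?V \<subseteq> U"
    proof
      fix x assume x: "x \<in> Pi\<^sub>E UNIV ?V"
      have "x i = s i" if "i < m" for i using PiE_mem[OF x, of i] that by simp
      then show "x \<in> U" using m by blast
    qed
    ultimately show ?thesis by (intro exI[of _ ?V]) (auto simp: PiE_def)
  qed
  then show "openin cantor_top U"
    unfolding cantor_top_def openin_product_topology_alt by blast
qed

lemma continuous_map_cantor_top_iff: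
  "continuous_map cantor_top cantor_top g \<longleftrightarrow> seqcont UNIV g"
proof
  assume g: "continuous_map cantor_top cantor_top g"
  show "seqcont UNIV g"
    unfolding seqcont_def
  proof (intro ballI allI)
    fix s :: "nat \<Rightarrow> 'a" and n
    let ?U = "{t. t n = g s n}"
    have "openin cantor_top ?U"
      unfolding openin_cantor_top by (metis lessI mem_Collect_eq)
    moreover have top: "topspace cantor_top = (UNIV :: 'a oword set)"
      by (simp add: cantor_top_def)
    ultimately have "openin cantor_top {x. g x \<in> ?U}"
      using openin_continuous_map_preimage[OF g] by fastforce
    then show "\<exists>m. \<forall>s'\<in>UNIV. (\<forall>i<m. s' i = s i) \<longrightarrow> g s' n = g s n"
      unfolding openin_cantor_top by auto
  qed
next
  assume g: "seqcont UNIV g"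
  show "continuous_map cantor_top cantor_top g"
    unfolding continuous_map_def
  proof (intro conjI allI impI)
    show "g \<in> topspace cantor_top \<rightarrow> topspace cantor_top" by (simp add: cantor_top_def)
    fix U :: "'b oword set" assume U: "openin cantor_top U"
    have "openin cantor_top {x. g x \<in> U}"
      unfolding openin_cantor_top
    proof
      fix s assume "s \<in> {x. g x \<in> U}"
      then obtain m where m: "\<forall>s'. (\<forall>i<m. s' i = g s i) \<longrightarrow> s' \<in> U"
        using U unfolding openin_cantor_top by blast
      obtain l where "\<forall>s'\<in>UNIV. (\<forall>i<l. s' i = s i) \<longrightarrow> (\<forall>i<m. g s' i = g s i)"
        using seqcontD[OF g UNIV_I] by blast
      with m show "\<exists>m. \<forall>s'. (\<forall>i<m. s' i = s i) \<longrightarrow> s' \<in> {x. g x \<in> U}" by blast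
    qed
    then show "openin cantor_top {x \<in> topspace cantor_top. g x \<in> U}" by (simp add: cantor_top_def)
  qed
qed

lemma ca_le_iff: "ca_le A B \<longleftrightarrow> (\<exists>g. seqcont UNIV g \<and> (\<forall>\<xi>. A \<xi> = B (g \<xi>)))"
  unfolding ca_le_def continuous_map_cantor_top_iff by (auto simp: fun_eq_iff)

subsection \<open>Values taken infinitely often\<close>

definition inf_set :: "(nat \<Rightarrow> 'a) \<Rightarrow> 'a set" where
  "inf_set s = {x. \<exists>\<^sub>\<infinity>n. s n = x}"

lemma inf_states_eq: "inf_states f q0 \<xi> = inf_set (run f q0 \<xi>)"
  by (simp add: inf_states_def inf_set_def)

lemma inf_set_shift: "inf_set (\<lambda>n. s (n + k)) = inf_set s"
proof -
  have "(\<exists>\<^sub>\<infinity>n. s (n + k) = x) \<longleftrightarrow> (\<exists>\<^sub>\<infinity>n. s n = x)" for x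
    unfolding INFM_nat_le
    by (metis add.commute add_leE nat_add_left_cancel_le trans_le_add1 le_Suc_ex)
  then show ?thesis by (simp add: inf_set_def)
qed

lemma ev_in_inf_set:
  assumes "finite (range s)"
  shows "\<forall>\<^sub>\<infinity>n. s n \<in> inf_set s"
proof -
  have "\<forall>\<^sub>\<infinity>n. \<forall>x\<in>range s - inf_set s. s n \<noteq> x"
  proof (rule eventually_ball_finite)
    show "finite (range s - inf_set s)" using assms by simp
    show "\<forall>x\<in>range s - inf_set s. \<forall>\<^sub>\<infinity>n. s n \<noteq> x"
      by (auto simp: inf_set_def)
  qed
  then show ?thesis
    by (rule MOST_mono) auto
qed

lemma inf_set_nonempty:
  assumes "finite (range s)"
  shows "inf_set s \<noteq> {}"
proof -
  obtain m where "\<forall>n\<ge>m. s n \<in> inf_set s"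
    using ev_in_inf_set[OF assms] unfolding MOST_nat_le by blast
  then show ?thesis by blast
qed

lemma inf_set_subset:
  assumes "\<forall>\<^sub>\<infinity>n. s n \<in> A"
  shows "inf_set s \<subseteq> A"
proof
  fix x assume "x \<in> inf_set s"
  then have "\<exists>\<^sub>\<infinity>n. s n = x" by (simp add: inf_set_def)
  then have "\<exists>\<^sub>\<infinity>n. s n = x \<and> s n \<in> A" using assms
    by (simp add: INFM_conjI)
  then show "x \<in> A" by (auto dest: frequently_ex)
qed

text \<open>Finiteness of the range matters for one inclusion: otherwise a value of \<open>g\<close>
  could recur through infinitely many arguments none of which recurs.\<close>

lemma inf_set_comp:
  assumes "finite (range s)"
  shows "inf_set (\<lambda>n. g (s n)) = g ` inf_set s"
proof
  show "g ` inf_set s \<subseteq> inf_set (\<lambda>n. g (s n))"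
    by (auto simp: inf_set_def elim!: INFM_mono)
  show "inf_set (\<lambda>n. g (s n)) \<subseteq> g ` inf_set s"
    by (rule inf_set_subset, rule MOST_mono[OF ev_in_inf_set[OF assms]]) auto
qed

subsection \<open>Infinite concatenation\<close>

text \<open>If all blocks are nonempty, the first \<open>Suc i\<close> of them have more than
  \<open>i\<close> letters, so the index is in range. Each letter depends on finitely many blocks,
  which gives continuity for free.\<close>

definition iconcat :: "(nat \<Rightarrow> 'a list) \<Rightarrow> nat \<Rightarrow> 'a" where
  "iconcat b i = concat (map b [0..<Suc i]) ! i"

definition bpos :: "(nat \<Rightarrow> 'a list) \<Rightarrow> nat \<Rightarrow> nat" where
  "bpos b n = length (concat (map b [0..<n]))"

lemma bpos_0 [simp]: "bpos b 0 = 0" and bpos_Suc: "bpos b (Suc n) = bpos b n + length (b n)"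
  by (simp_all add: bpos_def)

lemma bpos_strict_mono:
  assumes "\<And>n. b n \<noteq> []"
  shows "strict_mono (bpos b)"
  by (rule strict_monoI_Suc) (simp add: bpos_Suc assms)

lemma concat_upt_prefix:
  assumes "m \<le> n"
  shows "prefix (concat (map b [0..<m])) (concat (map b [0..<n]))"
proof -
  have "[0..<n] = [0..<m] @ [m..<n]" using assms by (metis le0 upt_add_eq_append le_add_diff_inverse)
  then show ?thesis by simp
qed

lemma prefix_nth: "prefix xs ys \<Longrightarrow> i < length xs \<Longrightarrow> ys ! i = xs ! i"
  by (auto simp: prefix_def nth_append)

lemma iconcat_nth:
  assumes "\<And>n. b n \<noteq> []" "i < bpos b n"
  shows "iconcat b i = concat (map b [0..<n]) ! i"
proof -
  have i: "i < bpos b (Suc i)"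
    using strict_mono_imp_increasing[OF bpos_strict_mono[of b], OF assms(1), of "Suc i"] by simp
  show ?thesis
  proof (cases "n \<le> Suc i")
    case True
    then show ?thesis unfolding iconcat_def
      using prefix_nth[OF concat_upt_prefix[OF True, of b]] assms(2) by (simp add: bpos_def)
  next
    case False
    then have "Suc i \<le> n" by simp
    then show ?thesis unfolding iconcat_def
      using prefix_nth[OF concat_upt_prefix[OF \<open>Suc i \<le> n\<close>, of b]] i unfolding bpos_def by metis
  qed
qed

lemma map_iconcat:
  assumes "\<And>n. b n \<noteq> []"
  shows "map (iconcat b) [0..<bpos b n] = concat (map b [0..<n])"
  by (rule nth_equalityI) (auto simp: iconcat_nth[OF assms] bpos_def)

lemma map_iconcat_mid:
  assumes "\<And>n. b n \<noteq> []" "j \<le> length (b n)"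
  shows "map (iconcat b) [0..<bpos b n + j] = concat (map b [0..<n]) @ take j (b n)"
proof -
  have "map (iconcat b) [0..<bpos b n + j] = take (bpos b n + j) (map (iconcat b) [0..<bpos b (Suc n)])"
    using assms(2) by (simp add: take_map bpos_Suc)
  also have "\<dots> = concat (map b [0..<n]) @ take j (b n)"
    unfolding map_iconcat[OF assms(1)] by (simp add: bpos_def)
  finally show ?thesis .
qed

lemma bpos_locate:
  assumes "\<And>n. b n \<noteq> []"
  shows "\<exists>n j. i = bpos b n + j \<and> j < length (b n)"
proof (induction i)
  case 0
  show ?case using assms by (intro exI[of _ 0]) simp
next
  case (Suc i)
  then obtain n j where nj: "i = bpos b n + j" "j < length (b n)" by blast
  show ?case
  proof (cases "Suc j < length (b n)")
    case True
    then show ?thesis using nj by (metis add_Suc_right)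
  next
    case False
    then have "Suc i = bpos b (Suc n) + 0" using nj by (simp add: bpos_Suc)
    then show ?thesis using assms by (metis length_greater_0_conv)
  qed
qed

lemma seqcont_iconcat:
  assumes "seqcont D (\<lambda>s n. bl s n)"
  shows "seqcont D (\<lambda>s. iconcat (bl s))"
  unfolding seqcont_def
proof (intro ballI allI)
  fix s n assume "s \<in> D"
  then obtain m where m: "\<forall>s'\<in>D. (\<forall>i<m. s' i = s i) \<longrightarrow> (\<forall>i<Suc n. bl s' i = bl s i)"
    using seqcontD[OF assms] by blast
  have "iconcat (bl s') n = iconcat (bl s) n" if "s' \<in> D" "\<forall>i<m. s' i = s i" for s'
  proof -
    have "map (bl s') [0..<Suc n] = map (bl s) [0..<Suc n]"
      using m that by (intro map_cong) auto
    then show ?thesis by (simp only: iconcat_def)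
  qed
  then show "\<exists>m. \<forall>s'\<in>D. (\<forall>i<m. s' i = s i) \<longrightarrow> iconcat (bl s') n = iconcat (bl s) n" by blast
qed

subsection \<open>Forests and meets in trees\<close>

abbreviation nd :: "'l lforest \<Rightarrow> nat set" where "nd F \<equiv> fst F"
abbreviation od :: "'l lforest \<Rightarrow> (nat \<times> nat) set" where "od F \<equiv> fst (snd F)"
abbreviation lb :: "'l lforest \<Rightarrow> nat \<Rightarrow> 'l" where "lb F \<equiv> snd (snd F)"

lemma is_forest_alt:
  "is_forest Lab F \<longleftrightarrow> finite (nd F) \<and> nd F \<noteq> {} \<and> partial_order_on (nd F) (od F) \<and>
     (\<forall>x\<in>nd F. \<forall>y z. (y, x) \<in> od F \<and> (z, x) \<in> od F \<longrightarrow> (y, z) \<in> od F \<or> (z, y) \<in> od F) \<and>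
     (\<forall>x\<in>nd F. lb F x \<in> Lab)"
  unfolding is_forest_def by (cases F) auto

lemma is_tree_alt:
  "is_tree Lab F \<longleftrightarrow> is_forest Lab F \<and> (\<exists>m\<in>nd F. \<forall>x\<in>nd F. (m, x) \<in> od F)"
  unfolding is_tree_def by (cases F) auto

lemma h_le_alt:
  "h_le leq F G \<longleftrightarrow> (\<exists>\<phi>. \<phi> ` nd F \<subseteq> nd G \<and>
     (\<forall>x\<in>nd F. \<forall>y\<in>nd F. (x, y) \<in> od F \<longrightarrow> (\<phi> x, \<phi> y) \<in> od G) \<and> (\<forall>x\<in>nd F. leq (lb F x) (lb G (\<phi> x))))"
  unfolding h_le_def by (cases F; cases G) auto

lemma forestD:
  assumes "is_forest Lab F"
  shows forest_finite: "finite (nd F)"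
    and forest_ne: "nd F \<noteq> {}"
    and forest_sub: "(x, y) \<in> od F \<Longrightarrow> x \<in> nd F \<and> y \<in> nd F"
    and forest_refl: "x \<in> nd F \<Longrightarrow> (x, x) \<in> od F"
    and forest_trans: "(x, y) \<in> od F \<Longrightarrow> (y, z) \<in> od F \<Longrightarrow> (x, z) \<in> od F"
    and forest_antisym: "(x, y) \<in> od F \<Longrightarrow> (y, x) \<in> od F \<Longrightarrow> x = y"
    and forest_chain: "(y, x) \<in> od F \<Longrightarrow> (z, x) \<in> od F \<Longrightarrow> (y, z) \<in> od F \<or> (z, y) \<in> od F"
    and forest_lab: "x \<in> nd F \<Longrightarrow> lb F x \<in> Lab"
proof -
  have po: "partial_order_on (nd F) (od F)" using assms by (simp add: is_forest_alt)
  then have r: "refl_on (nd F) (od F)" and t: "trans (od F)" and a: "antisym (od F)" and s: "od F \<subseteq> nd F \<times> nd F"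
    by (auto simp: partial_order_on_def preorder_on_def)
  show "finite (nd F)" "nd F \<noteq> {}" using assms by (auto simp: is_forest_alt)
  show "(x, y) \<in> od F \<Longrightarrow> x \<in> nd F \<and> y \<in> nd F" using s by auto
  show "x \<in> nd F \<Longrightarrow> (x, x) \<in> od F" using r by (simp add: refl_on_def)
  show "(x, y) \<in> od F \<Longrightarrow> (y, z) \<in> od F \<Longrightarrow> (x, z) \<in> od F" using t by (rule transD)
  show "(x, y) \<in> od F \<Longrightarrow> (y, x) \<in> od F \<Longrightarrow> x = y" using a by (rule antisymD)
  show "x \<in> nd F \<Longrightarrow> lb F x \<in> Lab" using assms by (simp add: is_forest_alt)
  assume yz: "(y, x) \<in> od F" "(z, x) \<in> od F"
  then have "x \<in> nd F" using s by auto
  then show "(y, z) \<in> od F \<or> (z, y) \<in> od F" using assms yz unfolding is_forest_alt by blast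
qed

lemma tree_forest: "is_tree Lab T \<Longrightarrow> is_forest Lab T"
  by (simp add: is_tree_alt)

lemma finite_maximal_rel:
  assumes "finite B" "B \<noteq> {}" "trans r" "antisym r"
  shows "\<exists>m\<in>B. \<forall>b\<in>B. (m, b) \<in> r \<longrightarrow> b = m"
  using assms(1,2)
proof (induction rule: finite_ne_induct)
  case (singleton x)
  then show ?case by simp
next
  case (insert x B)
  then obtain m where m: "m \<in> B" "\<forall>b\<in>B. (m, b) \<in> r \<longrightarrow> b = m" by blast
  show ?case
  proof (cases "(m, x) \<in> r")
    case True
    have "b = x" if "b \<in> B" "(x, b) \<in> r" for b
    proof -
      have "(m, b) \<in> r" using True that assms(3) by (meson transD)
      then have "b = m" using m that by blast
      then show ?thesis using True that assms(4) by (meson antisymD)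
    qed
    then show ?thesis by auto
  next
    case False
    then show ?thesis using m by auto
  qed
qed

lemma forest_maximal:
  assumes "is_forest Lab F" "B \<subseteq> nd F" "B \<noteq> {}"
  shows "\<exists>m\<in>B. \<forall>b\<in>B. (m, b) \<in> od F \<longrightarrow> b = m"
proof (rule finite_maximal_rel)
  show "finite B" using assms forest_finite[OF assms(1)] finite_subset by blast
  show "trans (od F)" using forest_trans[OF assms(1)] by (meson transI)
  show "antisym (od F)" using forest_antisym[OF assms(1)] by (meson antisymI)
qed (use assms in auto)

lemma forest_minimal:
  assumes "is_forest Lab F" "B \<subseteq> nd F" "B \<noteq> {}"
  shows "\<exists>m\<in>B. \<forall>b\<in>B. (b, m) \<in> od F \<longrightarrow> b = m"
proof -
  have "\<exists>m\<in>B. \<forall>b\<in>B. (m, b) \<in> (od F)\<inverse> \<longrightarrow> b = m"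
  proof (rule finite_maximal_rel)
    show "finite B" using assms forest_finite[OF assms(1)] finite_subset by blast
    show "trans ((od F)\<inverse>)" using forest_trans[OF assms(1)] by (auto intro!: transI)
    show "antisym ((od F)\<inverse>)" using forest_antisym[OF assms(1)] by (auto intro!: antisymI)
  qed (use assms in auto)
  then show ?thesis by simp
qed

definition glb :: "'l lforest \<Rightarrow> nat set \<Rightarrow> nat" where
  "glb T V = (THE m. m \<in> nd T \<and> (\<forall>v\<in>V. (m, v) \<in> od T) \<and>
                    (\<forall>m'\<in>nd T. (\<forall>v\<in>V. (m', v) \<in> od T) \<longrightarrow> (m', m) \<in> od T))"

lemma glb_eqI:
  assumes T: "is_forest Lab T" and "m \<in> nd T" "\<And>v. v \<in> V \<Longrightarrow> (m, v) \<in> od T"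
    and "\<And>m'. m' \<in> nd T \<Longrightarrow> (\<And>v. v \<in> V \<Longrightarrow> (m', v) \<in> od T) \<Longrightarrow> (m', m) \<in> od T"
  shows "glb T V = m"
  unfolding glb_def
proof (rule the_equality)
  show "m \<in> nd T \<and> (\<forall>v\<in>V. (m, v) \<in> od T) \<and> (\<forall>m'\<in>nd T. (\<forall>v\<in>V. (m', v) \<in> od T) \<longrightarrow> (m', m) \<in> od T)"
    using assms by blast
  fix x assume x: "x \<in> nd T \<and> (\<forall>v\<in>V. (x, v) \<in> od T) \<and> (\<forall>m'\<in>nd T. (\<forall>v\<in>V. (m', v) \<in> od T) \<longrightarrow> (m', x) \<in> od T)"
  then have "(x, m) \<in> od T" using assms(4) by blast
  moreover have "(m, x) \<in> od T" using x assms by blast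
  ultimately show "x = m" using forest_antisym[OF T] by blast
qed

text \<open>The common lower bounds of a nonempty set include the root and lie in the lower cone of
  any one of its elements, which is a chain; so a maximal common lower bound is the greatest
  one.\<close>

lemma tree_glb:
  assumes T: "is_tree Lab T" and V: "V \<subseteq> nd T" "V \<noteq> {}"
  shows glb_nd: "glb T V \<in> nd T"
    and glb_le: "v \<in> V \<Longrightarrow> (glb T V, v) \<in> od T"
    and glb_greatest: "\<And>m'. (\<And>v. v \<in> V \<Longrightarrow> (m', v) \<in> od T) \<Longrightarrow> (m', glb T V) \<in> od T"
proof -
  note F = tree_forest[OF T]
  let ?B = "{m \<in> nd T. \<forall>v\<in>V. (m, v) \<in> od T}"
  obtain v0 where v0: "v0 \<in> V" using V by blast
  have "?B \<noteq> {}" using T V unfolding is_tree_alt by blast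
  then obtain m where m: "m \<in> ?B" "\<And>b. b \<in> ?B \<Longrightarrow> (m, b) \<in> od T \<Longrightarrow> b = m"
    using forest_maximal[OF F, of ?B] by (metis (no_types, lifting) mem_Collect_eq subsetI)
  have gr: "(m', m) \<in> od T" if "m' \<in> nd T" "\<And>v. v \<in> V \<Longrightarrow> (m', v) \<in> od T" for m'
  proof -
    have "(m', v0) \<in> od T" "(m, v0) \<in> od T" using that m v0 by auto
    then consider "(m', m) \<in> od T" | "(m, m') \<in> od T" using forest_chain[OF F] by blast
    then show ?thesis
    proof cases
      case 2
      then have "m' = m" using m(2)[of m'] that by blast
      then show ?thesis using forest_refl[OF F] that by simp
    qed
  qed
  have eq: "glb T V = m" by (rule glb_eqI[OF F]) (use m gr in auto)
  show "glb T V \<in> nd T" using eq m by auto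
  show "v \<in> V \<Longrightarrow> (glb T V, v) \<in> od T" using eq m by auto
  show "(m', glb T V) \<in> od T" if "\<And>v. v \<in> V \<Longrightarrow> (m', v) \<in> od T" for m'
    unfolding eq using gr that v0 forest_sub[OF F] by blast
qed

subsection \<open>The sequence space of a forest of trees\<close>

definition cmds :: "'l lforest lforest \<Rightarrow> (nat \<times> nat) set" where
  "cmds F = {x. fst x \<in> nd F \<and> snd x \<in> nd (lb F (fst x))}"

definition seqs :: "'l lforest lforest \<Rightarrow> (nat \<Rightarrow> nat \<times> nat) set" where
  "seqs F = {s. \<forall>n. s n \<in> cmds F \<and> (fst (s n), fst (s (Suc n))) \<in> od F}"

definition fin :: "(nat \<Rightarrow> nat \<times> nat) \<Rightarrow> nat" where
  "fin s = (THE p. fst ` inf_set s = {p})"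

definition mt :: "'l lforest lforest \<Rightarrow> (nat \<Rightarrow> nat \<times> nat) \<Rightarrow> nat" where
  "mt F s = glb (lb F (fin s)) (snd ` inf_set s)"

definition colr :: "'l lforest lforest \<Rightarrow> (nat \<Rightarrow> nat \<times> nat) \<Rightarrow> 'l" where
  "colr F s = lb (lb F (fin s)) (mt F s)"

text \<open>Only recurring pairs matter. This makes shifts and finite repetitions of entries
  harmless, and it is why a finite automaton can decide the colour by a Muller condition.\<close>

lemma colr_cong: "inf_set s = inf_set s' \<Longrightarrow> colr F s = colr F s'"
  by (simp add: colr_def mt_def fin_def)

context
  fixes k :: nat and F :: "nat lforest lforest"
  assumes F: "F \<in> F_T_k k"
begin

lemma F_forest: "is_forest (T_k k) F"
  using F by (simp add: F_T_k_def)

lemma F_tree: "p \<in> nd F \<Longrightarrow> is_tree {..<k} (lb F p)"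
  using forest_lab[OF F_forest] by (simp add: T_k_def)

lemmas F_tree_forest = tree_forest[OF F_tree]

lemma finite_cmds: "finite (cmds F)"
proof -
  have "cmds F = (SIGMA p:nd F. nd (lb F p))" by (auto simp: cmds_def)
  then show ?thesis
    using forest_finite[OF F_forest] forest_finite[OF F_tree_forest] by simp
qed

lemma cmds_ne: "cmds F \<noteq> {}"
proof -
  obtain p where p: "p \<in> nd F" using forest_ne[OF F_forest] by blast
  obtain t where "t \<in> nd (lb F p)" using forest_ne[OF F_tree_forest[OF p]] by blast
  then have "(p, t) \<in> cmds F" using p by (simp add: cmds_def)
  then show ?thesis by blast
qed

lemma seqs_cmds: "s \<in> seqs F \<Longrightarrow> s n \<in> cmds F"
  by (simp add: seqs_def)

lemma seqs_nd: "s \<in> seqs F \<Longrightarrow> fst (s n) \<in> nd F" "s \<in> seqs F \<Longrightarrow> snd (s n) \<in> nd (lb F (fst (s n)))"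
  using seqs_cmds[of s n] by (auto simp: cmds_def)

lemma seqs_finite_range: "s \<in> seqs F \<Longrightarrow> finite (range s)"
  by (rule finite_subset[OF _ finite_cmds]) (auto intro: seqs_cmds)

lemma seqs_mono:
  assumes "s \<in> seqs F" "i \<le> j"
  shows "(fst (s i), fst (s j)) \<in> od F"
  using assms(2)
proof (induction j rule: dec_induct)
  case base
  show ?case using forest_refl[OF F_forest] seqs_nd[OF assms(1)] by blast
next
  case (step j)
  have "(fst (s j), fst (s (Suc j))) \<in> od F" using assms(1) by (simp add: seqs_def)
  then show ?case using step.IH forest_trans[OF F_forest] by blast
qed

lemma fin_eqI:
  assumes s: "s \<in> seqs F" and "\<forall>\<^sub>\<infinity>n. fst (s n) = p"
  shows "fin s = p"
proof -
  have "inf_set s \<subseteq> {x. fst x = p}" using assms by (intro inf_set_subset) simp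
  moreover have "inf_set s \<noteq> {}" using inf_set_nonempty seqs_finite_range[OF s] by blast
  ultimately have "fst ` inf_set s = {p}" by auto
  then show ?thesis by (simp add: fin_def)
qed

text \<open>A maximal node among the visited outer nodes cannot be left once it is reached, because
  the outer component never descends.\<close>

lemma fin_ev:
  assumes s: "s \<in> seqs F"
  shows "\<forall>\<^sub>\<infinity>n. fst (s n) = fin s"
proof -
  have "range (\<lambda>n. fst (s n)) \<subseteq> nd F" using seqs_nd[OF s] by blast
  then obtain p where p: "p \<in> range (\<lambda>n. fst (s n))" "\<forall>b\<in>range (\<lambda>n. fst (s n)). (p, b) \<in> od F \<longrightarrow> b = p"
    using forest_maximal[OF F_forest, of "range (\<lambda>n. fst (s n))"] by blast
  then obtain i where "p = fst (s i)" by blast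
  then have "\<forall>j\<ge>i. fst (s j) = p" using p seqs_mono[OF s] by blast
  then have ev: "\<forall>\<^sub>\<infinity>n. fst (s n) = p" unfolding MOST_nat_le by blast
  then show ?thesis using fin_eqI[OF s ev] by simp
qed

lemma fin_ge:
  assumes s: "s \<in> seqs F"
  shows "(fst (s i), fin s) \<in> od F"
proof -
  obtain m where "\<forall>n\<ge>m. fst (s n) = fin s" using fin_ev[OF s] unfolding MOST_nat_le by blast
  then have "fst (s (max i m)) = fin s" by simp
  then show ?thesis using seqs_mono[OF s, of i "max i m"] by simp
qed

lemma fin_nd: "s \<in> seqs F \<Longrightarrow> fin s \<in> nd F"
  using fin_ge forest_sub[OF F_forest] by blast

lemma fin_attained:
  assumes s: "s \<in> seqs F"
  shows "\<exists>i. fst (s i) = fin s"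
  using fin_ev[OF s] by (auto simp: MOST_nat_le)

lemma inf_set_fst:
  assumes s: "s \<in> seqs F" and "x \<in> inf_set s"
  shows "fst x = fin s" "snd x \<in> nd (lb F (fin s))"
proof -
  have "inf_set s \<subseteq> {x. fst x = fin s \<and> x \<in> cmds F}"
    using fin_ev[OF s] by (intro inf_set_subset) (auto elim!: MOST_mono intro: seqs_cmds[OF s])
  then show "fst x = fin s" "snd x \<in> nd (lb F (fin s))" using assms(2) by (auto simp: cmds_def)
qed

lemma V_sub:
  assumes s: "s \<in> seqs F"
  shows "snd ` inf_set s \<subseteq> nd (lb F (fin s))" "snd ` inf_set s \<noteq> {}"
  using inf_set_fst[OF s] inf_set_nonempty[OF seqs_finite_range[OF s]] by auto

text \<open>As only finitely many pairs occur, being below every recurring node amounts to being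
  eventually below the sequence. This eventual form avoids any computation of meets later
  on.\<close>

lemma mt_props:
  assumes s: "s \<in> seqs F"
  shows mt_nd: "mt F s \<in> nd (lb F (fin s))"
    and mt_ev: "\<forall>\<^sub>\<infinity>n. (mt F s, snd (s n)) \<in> od (lb F (fin s))"
    and mt_greatest: "\<And>m. \<forall>\<^sub>\<infinity>n. (m, snd (s n)) \<in> od (lb F (fin s)) \<Longrightarrow> (m, mt F s) \<in> od (lb F (fin s))"
proof -
  note T = F_tree[OF fin_nd[OF s]]
  show "mt F s \<in> nd (lb F (fin s))" unfolding mt_def by (rule glb_nd[OF T V_sub[OF s]])
  show "\<forall>\<^sub>\<infinity>n. (mt F s, snd (s n)) \<in> od (lb F (fin s))"
    using ev_in_inf_set[OF seqs_finite_range[OF s]]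
    by (rule MOST_mono) (unfold mt_def, rule glb_le[OF T V_sub[OF s]], simp)
  show "(m, mt F s) \<in> od (lb F (fin s))" if ev: "\<forall>\<^sub>\<infinity>n. (m, snd (s n)) \<in> od (lb F (fin s))" for m
  proof -
    have "inf_set s \<subseteq> {x. (m, snd x) \<in> od (lb F (fin s))}"
      by (rule inf_set_subset) (use ev in simp)
    then show ?thesis
      unfolding mt_def by (intro glb_greatest[OF T V_sub[OF s]]) auto
  qed
qed

lemma mt_eqI:
  assumes s: "s \<in> seqs F" and ev: "\<forall>\<^sub>\<infinity>n. fst (s n) = p" and ev': "\<forall>\<^sub>\<infinity>n. (t, snd (s n)) \<in> od (lb F p)"
    and io: "\<exists>\<^sub>\<infinity>n. snd (s n) = t"
  shows "mt F s = t"
proof -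
  have p: "fin s = p" by (rule fin_eqI[OF s ev])
  note T = F_tree_forest[OF fin_nd[OF s]]
  have "(t, mt F s) \<in> od (lb F (fin s))" using mt_greatest[OF s] ev' p by simp
  moreover have "(mt F s, t) \<in> od (lb F (fin s))"
  proof -
    have "\<exists>\<^sub>\<infinity>n. snd (s n) = t \<and> (mt F s, snd (s n)) \<in> od (lb F (fin s))"
      using io mt_ev[OF s] by (rule INFM_conjI)
    then show ?thesis by (auto dest: frequently_ex)
  qed
  ultimately show ?thesis using forest_antisym[OF T] by blast
qed

lemma colr_eqI:
  assumes s: "s \<in> seqs F" and ev: "\<forall>\<^sub>\<infinity>n. fst (s n) = p" and ev': "\<forall>\<^sub>\<infinity>n. (t, snd (s n)) \<in> od (lb F p)"
    and io: "\<exists>\<^sub>\<infinity>n. snd (s n) = t"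
  shows "colr F s = lb (lb F p) t"
  using mt_eqI[OF assms] fin_eqI[OF s ev] by (simp add: colr_def)

lemma colr_less: "s \<in> seqs F \<Longrightarrow> colr F s < k"
  unfolding colr_def using forest_lab[OF F_tree_forest[OF fin_nd] mt_nd] by simp

subsection \<open>Inserting consecutive meets\<close>

text \<open>Between two nodes of one tree their meet is inserted, so that the limit meet itself
  comes to recur. If the outer node changes, the two inner nodes belong to different trees and the
  later entry is merely repeated.\<close>

definition refine :: "(nat \<Rightarrow> nat \<times> nat) \<Rightarrow> nat \<Rightarrow> nat \<times> nat" where
  "refine s n = (if even n then s (n div 2) else
     let a = s (n div 2); b = s (Suc (n div 2)) in
       if fst a = fst b then (fst a, glb (lb F (fst a)) {snd a, snd b}) else b)"

lemma refine_even: "refine s (2 * n) = s n"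
  by (simp add: refine_def)

lemma refine_odd: "refine s (Suc (2 * n)) =
    (if fst (s n) = fst (s (Suc n)) then (fst (s n), glb (lb F (fst (s n))) {snd (s n), snd (s (Suc n))})
     else s (Suc n))"
  by (simp add: refine_def Let_def)

lemma refine_odd_fst: "fst (refine s (Suc (2 * n))) = fst (s (Suc n))"
  by (simp add: refine_odd)

lemma seqs_glb2:
  assumes s: "s \<in> seqs F" and eq: "fst (s i) = p" "fst (s j) = p"
  shows "glb (lb F p) {snd (s i), snd (s j)} \<in> nd (lb F p)"
    "(glb (lb F p) {snd (s i), snd (s j)}, snd (s i)) \<in> od (lb F p)"
    "(glb (lb F p) {snd (s i), snd (s j)}, snd (s j)) \<in> od (lb F p)"
    "\<And>m. (m, snd (s i)) \<in> od (lb F p) \<Longrightarrow> (m, snd (s j)) \<in> od (lb F p) \<Longrightarrow>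
       (m, glb (lb F p) {snd (s i), snd (s j)}) \<in> od (lb F p)"
proof -
  have T: "is_tree {..<k} (lb F p)" using F_tree seqs_nd(1)[OF s, of i] eq by simp
  have V: "{snd (s i), snd (s j)} \<subseteq> nd (lb F p)" "{snd (s i), snd (s j)} \<noteq> {}"
    using seqs_nd(2)[OF s, of i] seqs_nd(2)[OF s, of j] eq by auto
  show "glb (lb F p) {snd (s i), snd (s j)} \<in> nd (lb F p)" by (rule glb_nd[OF T V])
  show "(glb (lb F p) {snd (s i), snd (s j)}, snd (s i)) \<in> od (lb F p)"
    "(glb (lb F p) {snd (s i), snd (s j)}, snd (s j)) \<in> od (lb F p)"
    by (rule glb_le[OF T V]; simp)+
  show "\<And>m. (m, snd (s i)) \<in> od (lb F p) \<Longrightarrow> (m, snd (s j)) \<in> od (lb F p) \<Longrightarrow>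
       (m, glb (lb F p) {snd (s i), snd (s j)}) \<in> od (lb F p)"
    by (rule glb_greatest[OF T V]) auto
qed

lemma refine_seqs:
  assumes s: "s \<in> seqs F"
  shows "refine s \<in> seqs F"
  unfolding seqs_def
proof (rule CollectI, rule allI)
  fix n
  show "refine s n \<in> cmds F \<and> (fst (refine s n), fst (refine s (Suc n))) \<in> od F"
  proof (cases "even n")
    case True
    then obtain i where n: "n = 2 * i" by blast
    show ?thesis unfolding n refine_even refine_odd_fst
      using s by (simp add: seqs_def)
  next
    case False
    then obtain i where n: "n = Suc (2 * i)" using oddE by fastforce
    have Sn: "Suc n = 2 * Suc i" by (simp add: n)
    have "refine s n \<in> cmds F"
      unfolding n refine_odd using seqs_cmds[OF s] seqs_glb2(1)[OF s, of i "fst (s (Suc i))" "Suc i"] seqs_nd(1)[OF s]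
      by (auto simp: cmds_def)
    moreover have "(fst (refine s n), fst (refine s (Suc n))) \<in> od F"
      unfolding Sn refine_even unfolding n refine_odd_fst
      using forest_refl[OF F_forest seqs_nd(1)[OF s]] .
    ultimately show ?thesis by blast
  qed
qed

text \<open>Needed when sequences are turned into words of an automaton: comparable consecutive
  nodes will stand for nested loops, which can be toured together.\<close>

lemma refine_comparable:
  assumes s: "s \<in> seqs F" and eq: "fst (refine s n) = fst (refine s (Suc n))"
  shows "(snd (refine s n), snd (refine s (Suc n))) \<in> od (lb F (fst (refine s n))) \<or>
         (snd (refine s (Suc n)), snd (refine s n)) \<in> od (lb F (fst (refine s n)))"
proof (cases "even n")
  case True
  then obtain i where n: "n = 2 * i" by blast
  show ?thesis using eq unfolding n refine_even refine_odd_fst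
    using seqs_glb2[OF s, of i "fst (s (Suc i))" "Suc i"] by (simp add: refine_odd)
next
  case False
  then obtain i where n: "n = Suc (2 * i)" using oddE by fastforce
  have Sn: "Suc n = 2 * Suc i" by (simp add: n)
  show ?thesis
  proof (cases "fst (s i) = fst (s (Suc i))")
    case True
    then show ?thesis unfolding Sn refine_even unfolding n
      using seqs_glb2[OF s True, of "Suc i"] by (simp add: refine_odd)
  next
    case False
    then have "refine s n = refine s (Suc n)"
      unfolding Sn refine_even unfolding n refine_odd by simp
    moreover have "(snd (s (Suc i)), snd (s (Suc i))) \<in> od (lb F (fst (s (Suc i))))"
      using forest_refl[OF F_tree_forest] seqs_nd[OF s] by blast
    ultimately show ?thesis unfolding Sn refine_even by simp
  qed
qed

lemma refine_fin_ev:
  assumes s: "s \<in> seqs F"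
  shows "\<forall>\<^sub>\<infinity>n. fst (refine s n) = fin s"
proof -
  obtain m where m: "\<forall>n\<ge>m. fst (s n) = fin s" using fin_ev[OF s] unfolding MOST_nat_le by blast
  have "fst (refine s n) = fin s" if n: "n \<ge> 2 * m" for n
  proof (cases "even n")
    case True
    then obtain i where i: "n = 2 * i" by blast
    then show ?thesis using n m unfolding i refine_even by simp
  next
    case False
    then obtain i where i: "n = Suc (2 * i)" using oddE by fastforce
    then show ?thesis using n m unfolding i refine_odd_fst by simp
  qed
  then show ?thesis unfolding MOST_nat_le by blast
qed

lemma refine_mt_ev:
  assumes s: "s \<in> seqs F"
  shows "\<forall>\<^sub>\<infinity>n. (mt F s, snd (refine s n)) \<in> od (lb F (fin s))"
proof -
  obtain m where m: "\<forall>n\<ge>m. (mt F s, snd (s n)) \<in> od (lb F (fin s)) \<and> fst (s n) = fin s"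
    using eventually_conj[OF mt_ev[OF s] fin_ev[OF s]] unfolding MOST_nat_le by blast
  have "(mt F s, snd (refine s n)) \<in> od (lb F (fin s))" if n: "n \<ge> 2 * m" for n
  proof (cases "even n")
    case True
    then obtain i where i: "n = 2 * i" by blast
    then show ?thesis using n m unfolding i refine_even by simp
  next
    case False
    then obtain i where i: "n = Suc (2 * i)" using oddE by fastforce
    have "i \<ge> m" using n i by simp
    then show ?thesis using m seqs_glb2(4)[OF s, of i "fin s" "Suc i"] unfolding i refine_odd by simp
  qed
  then show ?thesis unfolding MOST_nat_le by blast
qed

text \<open>If the consecutive meets were eventually all strictly above the limit meet, then all later
  entries would lie above one and the same upper neighbour of it.\<close>

lemma refine_mt_io:
  assumes s: "s \<in> seqs F"
  shows "\<exists>\<^sub>\<infinity>n. snd (refine s n) = mt F s"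
  unfolding INFM_nat_le
proof
  fix M
  let ?T = "lb F (fin s)" and ?m = "mt F s"
  note T = F_tree_forest[OF fin_nd[OF s]]
  obtain N where N: "\<forall>n\<ge>N. (?m, snd (s n)) \<in> od ?T \<and> fst (s n) = fin s"
    using eventually_conj[OF mt_ev[OF s] fin_ev[OF s]] unfolding MOST_nat_le by blast
  define n0 where "n0 = max M N"
  have "\<exists>n\<ge>n0. glb ?T {snd (s n), snd (s (Suc n))} = ?m"
  proof (rule ccontr)
    assume "\<not> ?thesis"
    then have ne: "\<And>n. n \<ge> n0 \<Longrightarrow> glb ?T {snd (s n), snd (s (Suc n))} \<noteq> ?m" by blast
    have g: "(glb ?T {snd (s n), snd (s (Suc n))}, snd (s n)) \<in> od ?T"
      "(glb ?T {snd (s n), snd (s (Suc n))}, snd (s (Suc n))) \<in> od ?T"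
      "(?m, glb ?T {snd (s n), snd (s (Suc n))}) \<in> od ?T" if "n \<ge> n0" for n
      using seqs_glb2[OF s, of n "fin s" "Suc n"] N that by (simp_all add: n0_def)
    let ?B = "{y. (y, snd (s n0)) \<in> od ?T \<and> (?m, y) \<in> od ?T \<and> y \<noteq> ?m}"
    have "?B \<noteq> {}" using g[of n0] ne[of n0] by blast
    moreover have "?B \<subseteq> nd ?T" using forest_sub[OF T] by blast
    ultimately obtain y where y: "y \<in> ?B" "\<forall>b\<in>?B. (b, y) \<in> od ?T \<longrightarrow> b = y"
      using forest_minimal[OF T] by blast
    have above: "(y, snd (s n)) \<in> od ?T" if "n \<ge> n0" for n
      using that
    proof (induction n rule: dec_induct)
      case base
      then show ?case using y by blast
    next
      case (step n)
      let ?e = "glb ?T {snd (s n), snd (s (Suc n))}"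
      have "(y, ?e) \<in> od ?T \<or> (?e, y) \<in> od ?T"
        using forest_chain[OF T step.IH g(1)] step by blast
      then show ?case
      proof
        assume "(y, ?e) \<in> od ?T"
        then show ?case using g(2) step forest_trans[OF T] by blast
      next
        \<comment> \<open>A consecutive meet strictly above \<open>?m\<close> and below
          \<open>y\<close> lies in \<open>?B\<close>, so minimality identifies it with
          \<open>y\<close>.\<close>
        assume e: "(?e, y) \<in> od ?T"
        have "?e \<in> ?B"
          using forest_trans[OF T e] y(1) g(3)[of n] ne[of n] step by blast
        then have "?e = y" using y(2) e by blast
        then show ?case using g(2)[of n] step by simp
      qed
    qed
    then have "\<forall>\<^sub>\<infinity>n. (y, snd (s n)) \<in> od ?T" unfolding MOST_nat_le by blast
    then have "(y, ?m) \<in> od ?T" by (rule mt_greatest[OF s])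
    then show False using y(1) forest_antisym[OF T] by blast
  qed
  then obtain n where n: "n \<ge> n0" "glb ?T {snd (s n), snd (s (Suc n))} = ?m" by blast
  have "snd (refine s (Suc (2 * n))) = ?m"
    using n N unfolding refine_odd by (simp add: n0_def)
  moreover have "Suc (2 * n) \<ge> M" using n by (simp add: n0_def)
  ultimately show "\<exists>n\<ge>M. snd (refine s n) = ?m" by blast
qed

lemma refine_seqcont: "seqcont D refine"
  unfolding seqcont_def
proof (intro ballI allI)
  fix s n
  have "refine s' n = refine s n" if "\<forall>i<Suc (Suc (n div 2)). s' i = s i" for s'
    using that by (simp add: refine_def Let_def)
  then show "\<exists>m. \<forall>s'\<in>D. (\<forall>i<m. s' i = s i) \<longrightarrow> refine s' n = refine s n" by blast
qed

end

subsection \<open>Homomorphisms and continuous colour-preserving maps\<close>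

text \<open>In the refined sequence the limit meet is eventually a lower bound and recurs. Both
  properties survive a monotone map, so the image has the image node as its limit meet, and the
  inner maps preserve labels.\<close>

lemma cont_of_hom:
  assumes F: "F \<in> F_T_k k" and G: "G \<in> F_T_k k" and le: "le_F F G"
  shows "\<exists>h. seqcont (seqs F) h \<and> (\<forall>s\<in>seqs F. h s \<in> seqs G \<and> colr G (h s) = colr F s)"
proof -
  obtain \<phi> where \<phi>0: "\<phi> ` nd F \<subseteq> nd G" "\<forall>x\<in>nd F. \<forall>y\<in>nd F. (x, y) \<in> od F \<longrightarrow> (\<phi> x, \<phi> y) \<in> od G"
    "\<forall>x\<in>nd F. le_T (lb F x) (lb G (\<phi> x))"
    using le unfolding le_F_def h_le_alt by (elim exE conjE)
  have \<phi>: "\<phi> x \<in> nd G" if "x \<in> nd F" for x using \<phi>0(1) that by auto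
  have \<phi>2: "(\<phi> x, \<phi> y) \<in> od G" if "(x, y) \<in> od F" for x y
    using \<phi>0(2) forest_sub[OF F_forest[OF F] that] that by simp
  have "\<forall>p\<in>nd F. \<exists>\<psi>. (\<forall>x\<in>nd (lb F p). \<psi> x \<in> nd (lb G (\<phi> p)) \<and> lb (lb F p) x = lb (lb G (\<phi> p)) (\<psi> x)) \<and>
      (\<forall>x y. (x, y) \<in> od (lb F p) \<longrightarrow> (\<psi> x, \<psi> y) \<in> od (lb G (\<phi> p)))"
  proof
    fix p assume p: "p \<in> nd F"
    obtain \<psi> where \<psi>: "\<psi> ` nd (lb F p) \<subseteq> nd (lb G (\<phi> p))"
      "\<forall>x\<in>nd (lb F p). \<forall>y\<in>nd (lb F p). (x, y) \<in> od (lb F p) \<longrightarrow> (\<psi> x, \<psi> y) \<in> od (lb G (\<phi> p))"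
      "\<forall>x\<in>nd (lb F p). lb (lb F p) x = lb (lb G (\<phi> p)) (\<psi> x)"
      using bspec[OF \<phi>0(3) p] unfolding le_T_def h_le_alt by (elim exE conjE)
    have "(\<psi> x, \<psi> y) \<in> od (lb G (\<phi> p))" if "(x, y) \<in> od (lb F p)" for x y
      using \<psi>(2) forest_sub[OF F_tree_forest[OF F p] that] that by simp
    then show "\<exists>\<psi>. (\<forall>x\<in>nd (lb F p). \<psi> x \<in> nd (lb G (\<phi> p)) \<and> lb (lb F p) x = lb (lb G (\<phi> p)) (\<psi> x)) \<and>
      (\<forall>x y. (x, y) \<in> od (lb F p) \<longrightarrow> (\<psi> x, \<psi> y) \<in> od (lb G (\<phi> p)))"
      using \<psi>(1,3) by (intro exI[of _ \<psi>]) auto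
  qed
  then obtain \<psi> where \<psi>0: "\<forall>p\<in>nd F. (\<forall>x\<in>nd (lb F p). \<psi> p x \<in> nd (lb G (\<phi> p)) \<and> lb (lb F p) x = lb (lb G (\<phi> p)) (\<psi> p x)) \<and>
      (\<forall>x y. (x, y) \<in> od (lb F p) \<longrightarrow> (\<psi> p x, \<psi> p y) \<in> od (lb G (\<phi> p)))"
    by (auto dest!: bchoice)
  note \<psi> = \<psi>0[rule_format]
  define g where "g x = (\<phi> (fst x), \<psi> (fst x) (snd x))" for x :: "nat \<times> nat"
  define h where "h s n = g (refine F s n)" for s n
  have cont: "seqcont (seqs F) h"
    using refine_seqcont[OF F, of "seqs F"] unfolding seqcont_def h_def by metis
  have "h s \<in> seqs G \<and> colr G (h s) = colr F s" if s: "s \<in> seqs F" for s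
  proof -
    note r = refine_seqs[OF F s]
    have hs: "h s \<in> seqs G"
      unfolding seqs_def
    proof (rule CollectI, rule allI)
      fix n
      have "refine F s n \<in> cmds F" "(fst (refine F s n), fst (refine F s (Suc n))) \<in> od F"
        using r by (auto simp: seqs_def)
      then show "h s n \<in> cmds G \<and> (fst (h s n), fst (h s (Suc n))) \<in> od G"
        using \<phi> \<phi>2 \<psi> by (auto simp: h_def g_def cmds_def)
    qed
    let ?p = "fin s" and ?t = "mt F s"
    note p = fin_nd[OF F s]
    have "colr G (h s) = lb (lb G (\<phi> ?p)) (\<psi> ?p ?t)"
    proof (rule colr_eqI[OF G hs])
      show "\<forall>\<^sub>\<infinity>n. fst (h s n) = \<phi> ?p"
        using refine_fin_ev[OF F s] by (rule MOST_mono) (simp add: h_def g_def)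
      show "\<forall>\<^sub>\<infinity>n. (\<psi> ?p ?t, snd (h s n)) \<in> od (lb G (\<phi> ?p))"
        using eventually_conj[OF refine_fin_ev[OF F s] refine_mt_ev[OF F s]]
        by (rule MOST_mono) (use \<psi>[OF p] in \<open>auto simp: h_def g_def\<close>)
      have "\<exists>\<^sub>\<infinity>n. snd (refine F s n) = ?t \<and> fst (refine F s n) = ?p"
        using refine_mt_io[OF F s] refine_fin_ev[OF F s] by (rule INFM_conjI)
      then show "\<exists>\<^sub>\<infinity>n. snd (h s n) = \<psi> ?p ?t"
        by (rule INFM_mono) (simp add: h_def g_def)
    qed
    also have "\<dots> = colr F s"
      using \<psi>[OF p] mt_nd[OF F s] by (simp add: colr_def)
    finally show ?thesis using hs by blast
  qed
  then show ?thesis using cont by blast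
qed

section \<open>From continuous maps back to homomorphisms\<close>

text \<open>Recursion up the forest. The strict predecessors of a node form a chain, so it suffices
  to choose a value related to that of the greatest predecessor; transitivity of \<open>R\<close>
  covers the others. Used for the outer forest and again inside each tree.\<close>

lemma forest_choice:
  assumes F: "is_forest Lab F"
    and init: "\<And>p. p \<in> nd F \<Longrightarrow> \<exists>s. Val p s"
    and step: "\<And>q p s. (q, p) \<in> od F \<Longrightarrow> q \<noteq> p \<Longrightarrow> Val q s \<Longrightarrow> \<exists>s'. Val p s' \<and> R s s'"
    and R: "\<And>s s' s''. R s s' \<Longrightarrow> R s' s'' \<Longrightarrow> R s s''"
  shows "\<exists>w. (\<forall>p\<in>nd F. Val p (w p)) \<and> (\<forall>q p. (q, p) \<in> od F \<and> q \<noteq> p \<longrightarrow> R (w q) (w p))"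
proof -
  have "\<exists>w. (\<forall>p\<in>B. Val p (w p)) \<and> (\<forall>q. \<forall>p\<in>B. (q, p) \<in> od F \<and> q \<noteq> p \<longrightarrow> R (w q) (w p))"
    if "finite B" "B \<subseteq> nd F" "\<forall>p\<in>B. \<forall>q. (q, p) \<in> od F \<longrightarrow> q \<in> B" for B
    using that
  proof (induction B rule: finite_psubset_induct)
    case (psubset B)
    show ?case
    proof (cases "B = {}")
      case False
      then obtain m where m: "m \<in> B" "\<forall>b\<in>B. (m, b) \<in> od F \<longrightarrow> b = m"
        using forest_maximal[OF F psubset.prems(1)] by blast
      have "\<exists>w. (\<forall>p\<in>B-{m}. Val p (w p)) \<and> (\<forall>q. \<forall>p\<in>B-{m}. (q, p) \<in> od F \<and> q \<noteq> p \<longrightarrow> R (w q) (w p))"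
      proof (rule psubset.IH)
        show "B - {m} \<subset> B" using m by blast
        show "B - {m} \<subseteq> nd F" using psubset.prems by blast
        show "\<forall>p\<in>B - {m}. \<forall>q. (q, p) \<in> od F \<longrightarrow> q \<in> B - {m}" using psubset.prems m by blast
      qed
      then obtain w where w: "\<And>p. p \<in> B - {m} \<Longrightarrow> Val p (w p)"
        "\<And>p q. p \<in> B - {m} \<Longrightarrow> (q, p) \<in> od F \<Longrightarrow> q \<noteq> p \<Longrightarrow> R (w q) (w p)" by blast
      let ?C = "{q. (q, m) \<in> od F \<and> q \<noteq> m}"
      have "\<exists>s. Val m s \<and> (\<forall>q\<in>?C. R (w q) s)"
      proof (cases "?C = {}")
        case True
        then show ?thesis using init[of m] m psubset.prems by blast
      next
        case False
        have CB: "?C \<subseteq> B - {m}" using psubset.prems m by blast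
        then have "?C \<subseteq> nd F" using psubset.prems by blast
        obtain q where q: "q \<in> ?C" "\<forall>b\<in>?C. (q, b) \<in> od F \<longrightarrow> b = q"
          by (rule bexE[OF forest_maximal[OF F \<open>?C \<subseteq> nd F\<close> False]])
        have qB: "q \<in> B - {m}" using q CB by blast
        obtain s where s: "Val m s" "R (w q) s" using step[of q m "w q"] w(1)[OF qB] q by blast
        have "R (w q') s" if q': "q' \<in> ?C" for q'
        proof (cases "q' = q")
          case True
          then show ?thesis using s by simp
        next
          case False
          then have "(q', q) \<in> od F" using forest_chain[OF F, of q' m q] q q' by blast
          then show ?thesis using w(2)[OF qB _ False] s(2) R by blast
        qed
        then show ?thesis using s by blast
      qed
      then obtain s where s: "Val m s" "\<And>q. (q, m) \<in> od F \<Longrightarrow> q \<noteq> m \<Longrightarrow> R (w q) s" by blast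
      have nm: "q \<noteq> m" if "(q, p) \<in> od F" "p \<in> B" "q \<noteq> p" for p q using that m by blast
      show ?thesis
        by (rule exI[of _ "w(m := s)"]) (use s w in \<open>auto dest: nm\<close>)
    qed simp
  qed
  from this[of "nd F"] show ?thesis
    using forest_finite[OF F] forest_sub[OF F] by blast
qed

definition splice :: "(nat \<Rightarrow> 'a) \<Rightarrow> nat \<Rightarrow> 'a \<Rightarrow> nat \<Rightarrow> 'a" where
  "splice s n x i = (if i < n then s i else x)"

lemma splice_seqs:
  assumes F: "F \<in> F_T_k k" and s: "s \<in> seqs F" and x: "x \<in> cmds F" "(fst (s n), fst x) \<in> od F"
  shows "splice s n x \<in> seqs F"
  unfolding seqs_def
proof (rule CollectI, rule allI)
  fix i
  have c: "splice s n x i \<in> cmds F" using x seqs_cmds[OF F s] by (simp add: splice_def)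
  have "(fst (splice s n x i), fst (splice s n x (Suc i))) \<in> od F"
  proof (cases "i < n")
    case False
    then show ?thesis using forest_refl[OF F_forest[OF F]] x by (simp add: splice_def cmds_def)
  next
    case True
    have le: "(fst (s i), fst (s (Suc i))) \<in> od F" using s by (simp add: seqs_def)
    show ?thesis
    proof (cases "Suc i < n")
      case True
      then show ?thesis using le by (simp add: splice_def)
    next
      case False
      then have "Suc i = n" using True by simp
      then show ?thesis using le x True forest_trans[OF F_forest[OF F]] by (auto simp: splice_def)
    qed
  qed
  then show "splice s n x i \<in> cmds F \<and> (fst (splice s n x i), fst (splice s n x (Suc i))) \<in> od F"
    using c by blast
qed

context
  fixes k :: nat and F G :: "nat lforest lforest" and h :: "(nat \<Rightarrow> nat \<times> nat) \<Rightarrow> nat \<Rightarrow> nat \<times> nat"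
  assumes F: "F \<in> F_T_k k" and G: "G \<in> F_T_k k"
    and cont: "seqcont (seqs F) h" and map: "\<And>s. s \<in> seqs F \<Longrightarrow> h s \<in> seqs G"
    and col: "\<And>s. s \<in> seqs F \<Longrightarrow> colr G (h s) = colr F s"
begin

text \<open>The bound \<open>x\<close> holds on the whole cylinder, also for sequences that later
  leave \<open>p\<close>; this yields monotonicity, since values for nodes above \<open>p\<close>
  are sought inside the same cylinder. For sequences that stay at \<open>p\<close> the bound is
  attained.\<close>

definition topval :: "nat \<Rightarrow> (nat \<Rightarrow> nat \<times> nat) \<times> nat \<times> nat \<Rightarrow> bool" where
  "topval p = (\<lambda>(s, n, x). s \<in> seqs F \<and> (\<forall>i\<ge>n. fst (s i) = p) \<and>
     (\<forall>s'\<in>seqs F. (\<forall>i<n. s' i = s i) \<longrightarrow> (x, fin (h s')) \<in> od G) \<and>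
     (\<forall>s'\<in>seqs F. (\<forall>i<n. s' i = s i) \<and> (\<forall>i\<ge>n. fst (s' i) = p) \<longrightarrow> fin (h s') = x))"

text \<open>Take a continuation whose image ends in a maximal outer node. By continuity some finite
  prefix already forces the image through that node, from where it can only rise; for sequences
  staying at \<open>p\<close> maximality excludes a rise.\<close>

lemma topval_step:
  assumes s0: "s0 \<in> seqs F" "\<forall>i\<ge>n0. fst (s0 i) = p"
  shows "\<exists>s n x. n0 \<le> n \<and> (\<forall>i<n0. s i = s0 i) \<and> topval p (s, n, x)"
proof -
  let ?S = "{s \<in> seqs F. (\<forall>i<n0. s i = s0 i) \<and> (\<forall>i\<ge>n0. fst (s i) = p)}"
  let ?B = "(\<lambda>s. fin (h s)) ` ?S"
  have B: "?B \<subseteq> nd G" "?B \<noteq> {}" using fin_nd[OF G map] s0 by auto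
  obtain x where x: "x \<in> ?B" "\<forall>b\<in>?B. (x, b) \<in> od G \<longrightarrow> b = x"
    by (rule bexE[OF forest_maximal[OF F_forest[OF G] B]])
  obtain s where s: "x = fin (h s)" "s \<in> ?S" by (rule imageE[OF x(1)])
  have sF: "s \<in> seqs F" using s(2) by simp
  obtain j where j: "fst (h s j) = x" using fin_attained[OF G map[OF sF]] s(1) by blast
  obtain m where m: "\<forall>s'\<in>seqs F. (\<forall>i<m. s' i = s i) \<longrightarrow> h s' j = h s j"
    using cont sF unfolding seqcont_def by blast
  have ge: "(x, fin (h s')) \<in> od G" if "s' \<in> seqs F" "\<forall>i<max m n0. s' i = s i" for s'
  proof -
    have "h s' j = h s j" using m that by simp
    then have "fst (h s' j) = x" using j by simp
    then show ?thesis using fin_ge[OF G map[OF that(1)], of j] by simp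
  qed
  have eq: "fin (h s') = x" if s': "s' \<in> seqs F" "\<forall>i<max m n0. s' i = s i" "\<forall>i\<ge>max m n0. fst (s' i) = p" for s'
  proof -
    have 1: "fst (s' i) = p" if "i \<ge> n0" for i
      using s(2) s' that by (cases "i < max m n0") auto
    have 2: "\<forall>i<n0. s' i = s0 i" using s(2) s'(2) by simp
    have "s' \<in> ?S" using 1 2 s'(1) by simp
    then have "fin (h s') \<in> ?B" by (rule imageI)
    then show ?thesis using bspec[OF x(2)] ge[OF s'(1,2)] by simp
  qed
  have "topval p (s, max m n0, x)"
    using s(2) ge eq by (auto simp: topval_def)
  then show ?thesis using s(2) by (intro exI[of _ s] exI[of _ "max m n0"] exI[of _ x]) auto
qed

lemma topval_choice:
  "\<exists>w. (\<forall>p\<in>nd F. topval p (w p)) \<and> (\<forall>q p. (q, p) \<in> od F \<and> q \<noteq> p \<longrightarrow> (snd (snd (w q)), snd (snd (w p))) \<in> od G)"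
proof (rule forest_choice[OF F_forest[OF F], where R = "\<lambda>s s'. (snd (snd s), snd (snd s')) \<in> od G"])
  have ex: "\<exists>t. (p, t) \<in> cmds F" if p: "p \<in> nd F" for p
    using forest_ne[OF F_tree_forest[OF F p]] p by (auto simp: cmds_def)
  show "\<exists>s. topval p s" if p: "p \<in> nd F" for p
  proof -
    obtain t where "(p, t) \<in> cmds F" using ex p by blast
    then have "(\<lambda>_. (p, t)) \<in> seqs F" using forest_refl[OF F_forest[OF F] p] by (simp add: seqs_def)
    then show ?thesis using topval_step[of "\<lambda>_. (p, t)" 0 p] by auto
  qed
  show "\<exists>s'. topval p s' \<and> (snd (snd w), snd (snd s')) \<in> od G"
    if qp: "(q, p) \<in> od F" "q \<noteq> p" and w: "topval q w" for q p w
  proof -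
    obtain s n x where w': "w = (s, n, x)" by (cases w)
    note v = w[unfolded w' topval_def prod.case]
    obtain t where t: "(p, t) \<in> cmds F" using ex qp forest_sub[OF F_forest[OF F]] by blast
    \<comment> \<open>The prefix that guarantees the bound \<open>x\<close> is kept and the sequence
      then moves to \<open>p\<close>. This is allowed because entry \<open>n\<close> of
      \<open>s\<close> still has outer node \<open>q\<close>, which lies below
      \<open>p\<close>.\<close>
    have s0: "splice s n (p, t) \<in> seqs F" using v qp t by (intro splice_seqs[OF F]) auto
    have "\<exists>s' n' x'. n \<le> n' \<and> (\<forall>i<n. s' i = splice s n (p, t) i) \<and> topval p (s', n', x')"
      by (rule topval_step[OF s0]) (simp add: splice_def)
    then obtain s' n' x' where s': "n \<le> n'" "\<forall>i<n. s' i = splice s n (p, t) i" "topval p (s', n', x')" by blast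
    have "\<forall>i<n. s' i = s i" using s' by (simp add: splice_def)
    moreover have "s' \<in> seqs F" "fin (h s') = x'" using s'(3) by (auto simp: topval_def)
    ultimately have "(x, x') \<in> od G" using v by blast
    then show ?thesis using s'(3) w' by auto
  qed
qed (use forest_trans[OF F_forest[OF G]] in blast)

context
  fixes p :: nat and s0 :: "nat \<Rightarrow> nat \<times> nat" and n0 x :: nat
  assumes p: "p \<in> nd F" and top: "topval p (s0, n0, x)"
begin

text \<open>Unlike a cylinder, a cone also restricts the future: from \<open>n\<close> on the
  sequence stays at \<open>p\<close> and above \<open>t\<close>. A bound on the limit meet of the
  image can be expected only under such a promise.\<close>

definition cone :: "nat \<Rightarrow> (nat \<Rightarrow> nat \<times> nat) \<Rightarrow> nat \<Rightarrow> (nat \<Rightarrow> nat \<times> nat) set" where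
  "cone t s n = {s' \<in> seqs F. (\<forall>i<n. s' i = s i) \<and> (\<forall>i\<ge>n. fst (s' i) = p \<and> (t, snd (s' i)) \<in> od (lb F p))}"

definition good :: "nat \<Rightarrow> (nat \<Rightarrow> nat \<times> nat) \<Rightarrow> nat \<Rightarrow> bool" where
  "good t s n \<longleftrightarrow> s \<in> cone t s n \<and> n0 \<le> n \<and> (\<forall>i<n0. s i = s0 i) \<and> (\<forall>i\<ge>n0. fst (s i) = p)"

text \<open>The node \<open>y\<close> bounds the limit meets of all images of the cone, and no
  larger node does so on any smaller cone for the same \<open>t\<close>.\<close>

definition innerval :: "nat \<Rightarrow> (nat \<Rightarrow> nat \<times> nat) \<times> nat \<times> nat \<Rightarrow> bool" where
  "innerval t = (\<lambda>(s, n, y). good t s n \<and> (\<forall>s'\<in>cone t s n. (y, mt G (h s')) \<in> od (lb G x)) \<and>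
     (\<forall>s2\<in>cone t s n. \<forall>n2\<ge>n. \<forall>y2. (y, y2) \<in> od (lb G x) \<and> (\<forall>s'\<in>cone t s2 n2. (y2, mt G (h s')) \<in> od (lb G x)) \<longrightarrow> y2 = y))"

lemma T_forest: "is_forest {..<k} (lb F p)"
  by (rule F_tree_forest[OF F p])

lemma cone_seqs: "s \<in> cone t s1 n1 \<Longrightarrow> s \<in> seqs F"
  by (simp add: cone_def)

lemma cone_trans:
  assumes "s2 \<in> cone t s1 n1" "n1 \<le> n2"
  shows "cone t s2 n2 \<subseteq> cone t s1 n1"
proof
  fix s assume s: "s \<in> cone t s2 n2"
  have "fst (s i) = p \<and> (t, snd (s i)) \<in> od (lb F p)" if "i \<ge> n1" for i
    using assms s that by (cases "i < n2") (auto simp: cone_def)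
  then show "s \<in> cone t s1 n1" using assms s by (auto simp: cone_def)
qed

lemma cone_fin:
  assumes "good t s1 n1" "s \<in> cone t s1 n1"
  shows "fin (h s) = x"
proof -
  have "s \<in> seqs F" "\<forall>i<n0. s i = s0 i" using assms by (auto simp: cone_def good_def)
  moreover have "fst (s i) = p" if "i \<ge> n0" for i
    using assms that by (cases "i < n1") (auto simp: cone_def good_def)
  ultimately show ?thesis using top by (auto simp: topval_def)
qed

lemma good_cone:
  assumes "good t s1 n1" "s \<in> cone t s1 n1" "n1 \<le> n"
  shows "good t s n" "s \<in> cone t s n"
proof -
  have "fst (s i) = p" if "i \<ge> n0" for i
    using assms that by (cases "i < n1") (auto simp: cone_def good_def)
  then show "good t s n" using assms by (auto simp: cone_def good_def)
  then show "s \<in> cone t s n" by (simp add: good_def)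
qed

lemma x_nd: "x \<in> nd G"
  using top fin_nd[OF G map] by (auto simp: topval_def)

lemma T'_forest: "is_forest {..<k} (lb G x)"
  by (rule F_tree_forest[OF G x_nd])

text \<open>Among the nodes above \<open>y0\<close> that are lower bounds on some subcone, take a
  maximal one. Finiteness of the tree replaces continuity, because the limit meet does not depend
  continuously on the sequence.\<close>

lemma innerval_step:
  assumes g: "good t s1 n1" and y0: "y0 \<in> nd (lb G x)" "\<forall>s'\<in>cone t s1 n1. (y0, mt G (h s')) \<in> od (lb G x)"
  shows "\<exists>w. innerval t w \<and> (y0, snd (snd w)) \<in> od (lb G x)"
proof -
  let ?T' = "lb G x"
  let ?B = "{y. (y0, y) \<in> od ?T' \<and> (\<exists>n2\<ge>n1. \<exists>s2\<in>cone t s1 n1. \<forall>s'\<in>cone t s2 n2. (y, mt G (h s')) \<in> od ?T')}"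
  have "y0 \<in> ?B" using y0 g forest_refl[OF T'_forest] by (auto simp: good_def)
  then have B: "?B \<noteq> {}" by blast
  have B': "?B \<subseteq> nd ?T'" using forest_sub[OF T'_forest] by blast
  obtain y where y: "y \<in> ?B" "\<forall>b\<in>?B. (y, b) \<in> od ?T' \<longrightarrow> b = y"
    by (rule bexE[OF forest_maximal[OF T'_forest B' B]])
  from y(1) obtain s n where s: "n \<ge> n1" "s \<in> cone t s1 n1" "\<forall>s'\<in>cone t s n. (y, mt G (h s')) \<in> od ?T'"
    by (elim CollectE conjE exE bexE)
  have "y2 = y" if "s2 \<in> cone t s n" "n2 \<ge> n" "(y, y2) \<in> od ?T'" "\<forall>s'\<in>cone t s2 n2. (y2, mt G (h s')) \<in> od ?T'" for s2 n2 y2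
  proof -
    have 1: "(y0, y2) \<in> od ?T'" using forest_trans[OF T'_forest _ that(3)] y(1) by simp
    have 2: "s2 \<in> cone t s1 n1" using cone_trans[OF s(2,1)] that(1) by (rule subsetD)
    have "n2 \<ge> n1" using that(2) s(1) by simp
    then have "y2 \<in> ?B" using 1 2 that(4) by (intro CollectI conjI exI[of _ n2] bexI[of _ s2])
    then show ?thesis using bspec[OF y(2)] that(3) by simp
  qed
  then have "innerval t (s, n, y)"
    using good_cone[OF g s(2,1)] s by (auto simp: innerval_def)
  then show ?thesis using y by (intro exI[of _ "(s, n, y)"]) auto
qed

lemma good_splice:
  assumes g: "good t s n" and t: "t' \<in> nd (lb F p)"
  shows "good t' (splice s n (p, t')) n"
proof -
  have "splice s n (p, t') \<in> seqs F"
    by (rule splice_seqs[OF F cone_seqs])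
       (use g t p forest_refl[OF F_forest[OF F] p] in \<open>auto simp: good_def cone_def cmds_def\<close>)
  then show ?thesis
    using g t forest_refl[OF T_forest] by (auto simp: good_def cone_def splice_def)
qed

text \<open>The root of \<open>lb G x\<close> is a lower bound to start from. Passing from
  \<open>t\<close> to a node above it shrinks the cone, so the bound found for \<open>t\<close>
  remains valid and can only be raised.\<close>

lemma innerval_choice:
  "\<exists>w. (\<forall>t\<in>nd (lb F p). innerval t (w t)) \<and>
       (\<forall>t t'. (t, t') \<in> od (lb F p) \<and> t \<noteq> t' \<longrightarrow> (snd (snd (w t)), snd (snd (w t'))) \<in> od (lb G x))"
proof (rule forest_choice[OF T_forest, where R = "\<lambda>s s'. (snd (snd s), snd (snd s')) \<in> od (lb G x)"])
  show "\<exists>s. innerval t s" if t: "t \<in> nd (lb F p)" for t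
  proof -
    have s0: "s0 \<in> seqs F" "\<forall>i\<ge>n0. fst (s0 i) = p" using top by (auto simp: topval_def)
    have "splice s0 n0 (p, t) \<in> seqs F"
      by (rule splice_seqs[OF F s0(1)]) (use s0 t p forest_refl[OF F_forest[OF F] p] in \<open>auto simp: cmds_def\<close>)
    then have g: "good t (splice s0 n0 (p, t)) n0"
      using t forest_refl[OF T_forest] by (auto simp: good_def cone_def splice_def)
    obtain y0 where y0: "y0 \<in> nd (lb G x)" "\<forall>y\<in>nd (lb G x). (y0, y) \<in> od (lb G x)"
      using F_tree[OF G x_nd] by (auto simp: is_tree_alt)
    have "\<forall>s'\<in>cone t (splice s0 n0 (p, t)) n0. (y0, mt G (h s')) \<in> od (lb G x)"
      using y0 mt_nd[OF G map[OF cone_seqs]] cone_fin[OF g] by metis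
    then show ?thesis using innerval_step[OF g y0(1)] by blast
  qed
  show "\<exists>s'. innerval t' s' \<and> (snd (snd w), snd (snd s')) \<in> od (lb G x)"
    if tt': "(t, t') \<in> od (lb F p)" "t \<noteq> t'" and w: "innerval t w" for t t' w
  proof -
    obtain s n y where w': "w = (s, n, y)" by (cases w)
    note v = w[unfolded w' innerval_def prod.case]
    have g: "good t' (splice s n (p, t')) n" using good_splice v tt' forest_sub[OF T_forest] by blast
    have "cone t' (splice s n (p, t')) n \<subseteq> cone t s n"
      using tt' forest_trans[OF T_forest] by (auto simp: cone_def splice_def)
    then have *: "\<forall>s'\<in>cone t' (splice s n (p, t')) n. (y, mt G (h s')) \<in> od (lb G x)" using v by blast
    have "y \<in> nd (lb G x)" using * g forest_sub[OF T'_forest] by (auto simp: good_def)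
    then show ?thesis using innerval_step[OF g _ *] w' by simp
  qed
qed (use forest_trans[OF T'_forest] in blast)

text \<open>A sufficiently generic sequence of the cone visits \<open>t\<close> infinitely often and, by the
  maximality of \<open>y\<close>, its image leaves every upper neighbourhood above \<open>y\<close> infinitely often.\<close>

lemma innerval_colour:
  assumes t: "t \<in> nd (lb F p)" and v0: "innerval t (s1, n1, y)"
  shows "lb (lb F p) t = lb (lb G x) y"
proof -
  let ?T = "lb F p" and ?T' = "lb G x"
  note v = v0[unfolded innerval_def prod.case]
  have g: "good t s1 n1" using v by blast
  \<comment> \<open>The first component of the decoded pair lists every number infinitely often, so
    each node of the target tree is dealt with at arbitrarily late stages.\<close>
  define e where "e i = fst (prod_decode i)" for i
  have e: "\<exists>\<^sub>\<infinity>i. e i = z" for z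
    unfolding INFM_nat_le
  proof
    fix m
    have "e (prod_encode (z, m)) = z" by (simp add: e_def)
    moreover have "m \<le> prod_encode (z, m)" by (rule le_prod_encode_2)
    ultimately show "\<exists>n\<ge>m. e n = z" by blast
  qed
  \<comment> \<open>A stage consists of a sequence and the length of its prefix that is already
    fixed. Stage \<open>i\<close> adds a visit to \<open>t\<close> and, if \<open>e i\<close> is
    strictly above \<open>y\<close>, a prefix forcing the image not to be above \<open>e i\<close>
    at some position \<open>j\<close> with \<open>i \<le> j\<close>.\<close>
  define P where "P i w \<longleftrightarrow> fst w \<in> cone t s1 n1 \<and> n1 \<le> snd w \<and> i \<le> snd w" for i :: nat and w :: "(nat \<Rightarrow> nat \<times> nat) \<times> nat"
  define Q where "Q i w w' \<longleftrightarrow> snd w < snd w' \<and> (\<forall>j<snd w. fst w' j = fst w j) \<and>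
     (\<exists>j\<ge>snd w. j < snd w' \<and> fst w' j = (p, t)) \<and>
     ((y, e i) \<in> od ?T' \<and> e i \<noteq> y \<longrightarrow>
       (\<exists>j\<ge>i. \<forall>s\<in>seqs F. (\<forall>l<snd w'. s l = fst w' l) \<longrightarrow> (e i, snd (h s j)) \<notin> od ?T'))"
    for i :: nat and w w' :: "(nat \<Rightarrow> nat \<times> nat) \<times> nat"
  have "\<exists>f. \<forall>i. P i (f i) \<and> Q i (f i) (f (Suc i))"
  proof (rule dependent_nat_choice)
    have "P 0 (s1, n1)" using g by (simp add: P_def good_def)
    then show "\<exists>w. P 0 w" by blast
    fix w i assume P: "P i w"
    obtain s m where w: "w = (s, m)" by (cases w)
    have s: "s \<in> cone t s1 n1" "n1 \<le> m" "i \<le> m" using P by (auto simp: P_def w)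
    have "\<exists>r\<in>cone t s m. \<exists>l. (y, e i) \<in> od ?T' \<and> e i \<noteq> y \<longrightarrow>
       (\<exists>j\<ge>i. \<forall>s\<in>seqs F. (\<forall>a<l. s a = r a) \<longrightarrow> (e i, snd (h s j)) \<notin> od ?T')"
    proof (cases "(y, e i) \<in> od ?T' \<and> e i \<noteq> y")
      case True
      \<comment> \<open>If there were no such \<open>r\<close>, the larger node \<open>e i\<close>
        would be a lower bound on a subcone, against the maximality of \<open>y\<close>.\<close>
      then obtain r where r: "r \<in> cone t s m" "(e i, mt G (h r)) \<notin> od ?T'" using v s by blast
      have r1: "r \<in> cone t s1 n1" using cone_trans[OF s(1,2)] r by blast
      have rF: "r \<in> seqs F" by (rule cone_seqs[OF r1])
      have "\<not> (\<forall>\<^sub>\<infinity>j. (e i, snd (h r j)) \<in> od ?T')"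
        using mt_greatest[OF G map[OF rF], of "e i"] r(2) unfolding cone_fin[OF g r1] by (rule contrapos_nn[rotated])
      then obtain j where j: "j \<ge> i" "(e i, snd (h r j)) \<notin> od ?T'" unfolding MOST_nat_le by blast
      obtain l where "\<forall>s\<in>seqs F. (\<forall>a<l. s a = r a) \<longrightarrow> h s j = h r j"
        using cont rF unfolding seqcont_def by blast
      then have "\<forall>s\<in>seqs F. (\<forall>a<l. s a = r a) \<longrightarrow> (e i, snd (h s j)) \<notin> od ?T'" using j by metis
      then show ?thesis using r j by blast
    next
      case False
      then show ?thesis using good_cone(2)[OF g s(1,2)] by blast
    qed
    then obtain r l where r: "r \<in> cone t s m" "(y, e i) \<in> od ?T' \<and> e i \<noteq> y \<longrightarrow>
       (\<exists>j\<ge>i. \<forall>s\<in>seqs F. (\<forall>a<l. s a = r a) \<longrightarrow> (e i, snd (h s j)) \<notin> od ?T')" by blast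
    have r1: "r \<in> cone t s1 n1" using cone_trans[OF s(1,2)] r by blast
    define M where "M = max l m"
    define s2 where "s2 = splice r M (p, t)"
    have gr: "good t r M" using good_cone(1)[OF g r1, of M] s by (simp add: M_def)
    have "s2 \<in> seqs F" using good_splice[OF gr t] by (auto simp: s2_def good_def cone_def)
    moreover have "n1 \<le> M" using s by (simp add: M_def)
    ultimately have c: "s2 \<in> cone t s1 n1" using r1 t forest_refl[OF T_forest t] by (auto simp: cone_def s2_def splice_def)
    have ag: "s2 a = r a" if "a < M" for a using that by (simp add: s2_def splice_def)
    have "P (Suc i) (s2, Suc M)" using c s by (auto simp: P_def M_def)
    moreover have "Q i w (s2, Suc M)"
      unfolding Q_def w fst_conv snd_conv
    proof (intro conjI)
      show "m < Suc M" by (simp add: M_def)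
      show "\<forall>j<m. s2 j = s j" using ag r(1) by (auto simp: M_def cone_def)
      show "\<exists>j\<ge>m. j < Suc M \<and> s2 j = (p, t)" by (rule exI[of _ M]) (simp add: M_def s2_def splice_def)
      show "(y, e i) \<in> od ?T' \<and> e i \<noteq> y \<longrightarrow>
       (\<exists>j\<ge>i. \<forall>s\<in>seqs F. (\<forall>l<Suc M. s l = s2 l) \<longrightarrow> (e i, snd (h s j)) \<notin> od ?T')"
      proof
        assume "(y, e i) \<in> od ?T' \<and> e i \<noteq> y"
        then obtain j where j: "j \<ge> i" "\<forall>s\<in>seqs F. (\<forall>a<l. s a = r a) \<longrightarrow> (e i, snd (h s j)) \<notin> od ?T'" using r by blast
        have "\<forall>a<l. s' a = r a" if "\<forall>l<Suc M. s' l = s2 l" for s'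
          using that ag by (simp add: M_def)
        then have "\<forall>s\<in>seqs F. (\<forall>l<Suc M. s l = s2 l) \<longrightarrow> (e i, snd (h s j)) \<notin> od ?T'" using j(2) by simp
        then show "\<exists>j\<ge>i. \<forall>s\<in>seqs F. (\<forall>l<Suc M. s l = s2 l) \<longrightarrow> (e i, snd (h s j)) \<notin> od ?T'"
          using j(1) by (intro exI[of _ j] conjI)
      qed
    qed
    ultimately show "\<exists>w'. P (Suc i) w' \<and> Q i w w'" by blast
  qed
  then obtain f where f: "\<And>i. P i (f i)" "\<And>i. Q i (f i) (f (Suc i))" by blast
  \<comment> \<open>The limit of the stages: entry \<open>j\<close> is final at stage
    \<open>Suc j\<close>, whose fixed prefix has length at least \<open>Suc j\<close>.\<close>
  define r where "r j = fst (f (Suc j)) j" for j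
  have agree: "fst (f i') j = fst (f i) j" if "i \<le> i'" "j < snd (f i)" for i i' j
    using that(1)
  proof (induction i' rule: dec_induct)
    case (step i')
    have "snd (f i) \<le> snd (f i')"
      by (rule lift_Suc_mono_le[of "\<lambda>i. snd (f i)"]) (use f(2) step in \<open>auto simp: Q_def less_imp_le\<close>)
    then show ?case using step f(2)[of i'] that(2) by (auto simp: Q_def)
  qed simp
  have r_eq: "r j = fst (f i) j" if "j < snd (f i)" for i j
  proof (cases "i \<le> Suc j")
    case True
    then show ?thesis using agree[OF True that] by (simp add: r_def)
  next
    case False
    have "j < snd (f (Suc j))" using f(1)[of "Suc j"] by (simp add: P_def)
    then show ?thesis using agree[of "Suc j" i j] False by (simp add: r_def)
  qed
  have big: "j < snd (f (Suc j))" for j using f(1)[of "Suc j"] by (simp add: P_def)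
  have fF: "fst (f i) \<in> seqs F" "fst (f i) \<in> cone t s1 n1" for i using f(1)[of i] by (auto simp: P_def cone_def)
  have rF: "r \<in> seqs F"
    unfolding seqs_def
  proof (rule CollectI, rule allI)
    fix n
    have n: "r n = fst (f (Suc (Suc n))) n" "r (Suc n) = fst (f (Suc (Suc n))) (Suc n)"
      using big[of "Suc n"] by (auto intro: r_eq)
    show "r n \<in> cmds F \<and> (fst (r n), fst (r (Suc n))) \<in> od F"
      unfolding n using fF(1)[of "Suc (Suc n)"] by (auto simp: seqs_def)
  qed
  have rc: "r \<in> cone t s1 n1"
    using rF fF(2) by (auto simp: cone_def r_def)
  have "colr F r = lb ?T t"
  proof (rule colr_eqI[OF F rF])
    show "\<forall>\<^sub>\<infinity>n. fst (r n) = p" "\<forall>\<^sub>\<infinity>n. (t, snd (r n)) \<in> od ?T"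
      using rc unfolding MOST_nat_le cone_def by blast+
    show "\<exists>\<^sub>\<infinity>n. snd (r n) = t"
      unfolding INFM_nat_le
    proof
      fix m
      obtain j where j: "j \<ge> snd (f m)" "j < snd (f (Suc m))" "fst (f (Suc m)) j = (p, t)"
        using f(2)[of m] by (auto simp: Q_def)
      have "m \<le> snd (f m)" using f(1)[of m] by (simp add: P_def)
      then have "j \<ge> m" using j(1) by simp
      moreover have "snd (r j) = t" using r_eq[OF j(2)] j(3) by simp
      ultimately show "\<exists>n\<ge>m. snd (r n) = t" by blast
    qed
  qed
  moreover have "colr G (h r) = lb ?T' y"
  proof -
    have x: "fin (h r) = x" by (rule cone_fin[OF g rc])
    have "(y, mt G (h r)) \<in> od ?T'" using v rc by blast
    moreover have "mt G (h r) = y"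
    proof (rule ccontr)
      assume ne: "mt G (h r) \<noteq> y"
      obtain N where N: "\<forall>n\<ge>N. (mt G (h r), snd (h r n)) \<in> od ?T'"
        using mt_ev[OF G map[OF rF]] unfolding x MOST_nat_le by blast
      \<comment> \<open>The supposed meet is treated at a stage \<open>i\<close> after
        \<open>N\<close>; the position forced there is at least \<open>i\<close> and violates the
        eventual bound.\<close>
      obtain i where i: "i \<ge> N" "e i = mt G (h r)" using e[of "mt G (h r)"] unfolding INFM_nat_le by blast
      have "\<exists>j\<ge>i. \<forall>s\<in>seqs F. (\<forall>l<snd (f (Suc i)). s l = fst (f (Suc i)) l) \<longrightarrow> (e i, snd (h s j)) \<notin> od ?T'"
        using f(2)[of i] ne i \<open>(y, mt G (h r)) \<in> od ?T'\<close> by (simp add: Q_def)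
      then obtain j where j: "j \<ge> i"
        "\<forall>s\<in>seqs F. (\<forall>l<snd (f (Suc i)). s l = fst (f (Suc i)) l) \<longrightarrow> (e i, snd (h s j)) \<notin> od ?T'"
        by (elim exE conjE)
      have "(e i, snd (h r j)) \<notin> od ?T'" using bspec[OF j(2) rF] r_eq by simp
      then show False using N i j(1) by simp
    qed
    ultimately show ?thesis using x by (simp add: colr_def)
  qed
  ultimately show ?thesis using col[OF rF] by simp
qed

lemma inner_hom: "le_T (lb F p) (lb G x)"
proof -
  obtain w where w: "\<And>t. t \<in> nd (lb F p) \<Longrightarrow> innerval t (w t)"
    "\<And>t t'. (t, t') \<in> od (lb F p) \<Longrightarrow> t \<noteq> t' \<Longrightarrow> (snd (snd (w t)), snd (snd (w t'))) \<in> od (lb G x)"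
    using innerval_choice by blast
  have nd: "snd (snd (w t)) \<in> nd (lb G x)" if t: "t \<in> nd (lb F p)" for t
  proof -
    obtain s n y where y: "w t = (s, n, y)" by (cases "w t")
    show ?thesis using w(1)[OF t] forest_sub[OF T'_forest] unfolding y innerval_def good_def by auto
  qed
  have lab: "lb (lb F p) t = lb (lb G x) (snd (snd (w t)))" if t: "t \<in> nd (lb F p)" for t
    using innerval_colour[OF t] w(1)[OF t] by (cases "w t") auto
  show ?thesis
    unfolding le_T_def h_le_alt
    by (rule exI[of _ "\<lambda>t. snd (snd (w t))"]) (use nd lab w(2) forest_refl[OF T'_forest] in blast)
qed

end

lemma hom_of_cont: "le_F F G"
proof -
  obtain w where w: "\<And>p. p \<in> nd F \<Longrightarrow> topval p (w p)"
    "\<And>p q. (q, p) \<in> od F \<Longrightarrow> q \<noteq> p \<Longrightarrow> (snd (snd (w q)), snd (snd (w p))) \<in> od G"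
    using topval_choice by blast
  have *: "snd (snd (w p)) \<in> nd G \<and> le_T (lb F p) (lb G (snd (snd (w p))))" if p: "p \<in> nd F" for p
    using x_nd[OF p, of "fst (w p)" "fst (snd (w p))" "snd (snd (w p))"] inner_hom[OF p, of "fst (w p)" "fst (snd (w p))" "snd (snd (w p))"] w(1)[OF p] by simp
  show ?thesis
    unfolding le_F_def h_le_alt
    by (rule exI[of _ "\<lambda>p. snd (snd (w p))"]) (use * w(2) forest_refl[OF F_forest[OF G]] in blast)
qed

end

section \<open>Partitions represented by forests\<close>

text \<open>The colouring \<open>colr F\<close> lives on \<open>seqs F\<close> and not on words over
  the alphabet, so \<open>ca_le\<close> does not apply to it; equivalence is stated as one
  continuous reduction each way.\<close>

definition represents :: "('x oword \<Rightarrow> nat) \<Rightarrow> nat lforest lforest \<Rightarrow> bool" where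
  "represents L F \<longleftrightarrow> (\<exists>\<sigma> e. seqcont UNIV \<sigma> \<and> (\<forall>\<xi>. \<sigma> \<xi> \<in> seqs F \<and> L \<xi> = colr F (\<sigma> \<xi>)) \<and>
     seqcont (seqs F) e \<and> (\<forall>s\<in>seqs F. L (e s) = colr F s))"

text \<open>Composing with the reductions of both representations turns a reduction of partitions
  into a colour-preserving map of sequence spaces, and back.\<close>

theorem ca_le_iff_le_F:
  assumes F: "F \<in> F_T_k k" and G: "G \<in> F_T_k k" and L: "represents L F" and L': "represents L' G"
  shows "ca_le L L' \<longleftrightarrow> le_F F G"
proof -
  obtain \<sigma> e where 1: "seqcont UNIV \<sigma>" "\<And>\<xi>. \<sigma> \<xi> \<in> seqs F" "\<And>\<xi>. L \<xi> = colr F (\<sigma> \<xi>)"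
    "seqcont (seqs F) e" "\<And>s. s \<in> seqs F \<Longrightarrow> L (e s) = colr F s" using L unfolding represents_def by blast
  obtain \<sigma>' e' where 2: "seqcont UNIV \<sigma>'" "\<And>\<xi>. \<sigma>' \<xi> \<in> seqs G" "\<And>\<xi>. L' \<xi> = colr G (\<sigma>' \<xi>)"
    "seqcont (seqs G) e'" "\<And>s. s \<in> seqs G \<Longrightarrow> L' (e' s) = colr G s" using L' unfolding represents_def by blast
  show ?thesis
  proof
    assume "ca_le L L'"
    then obtain g where g: "seqcont UNIV g" "\<And>\<xi>. L \<xi> = L' (g \<xi>)" unfolding ca_le_iff by blast
    show "le_F F G"
    proof (rule hom_of_cont[OF F G])
      have "seqcont UNIV (\<lambda>\<xi>. \<sigma>' (g \<xi>))" by (rule seqcont_comp[OF g(1) 2(1)]) simp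
      then show "seqcont (seqs F) (\<lambda>s. \<sigma>' (g (e s)))" by (rule seqcont_comp[OF 1(4)]) simp
      show "\<sigma>' (g (e s)) \<in> seqs G" for s by (rule 2)
      show "colr G (\<sigma>' (g (e s))) = colr F s" if "s \<in> seqs F" for s
        using 1(5)[OF that] g(2) 2(3) by simp
    qed
  next
    assume "le_F F G"
    then obtain h where h: "seqcont (seqs F) h" "\<And>s. s \<in> seqs F \<Longrightarrow> h s \<in> seqs G"
      "\<And>s. s \<in> seqs F \<Longrightarrow> colr G (h s) = colr F s"
      using cont_of_hom[OF F G] by blast
    have "seqcont UNIV (\<lambda>\<xi>. h (\<sigma> \<xi>))" by (rule seqcont_comp[OF 1(1) h(1) 1(2)])
    then have "seqcont UNIV (\<lambda>\<xi>. e' (h (\<sigma> \<xi>)))" by (rule seqcont_comp[OF _ 2(4)]) (rule h(2)[OF 1(2)])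
    moreover have "L \<xi> = L' (e' (h (\<sigma> \<xi>)))" for \<xi>
      using 1(2,3) 2(5) h(2,3) by simp
    ultimately show "ca_le L L'"
      unfolding ca_le_iff by (intro exI[of _ "\<lambda>\<xi>. e' (h (\<sigma> \<xi>))"]) simp
  qed
qed

subsection \<open>Every forest is represented by an aperiodic partition\<close>

lemma enumeration_cmds:
  assumes F: "F \<in> F_T_k k"
  shows "\<exists>(cmd :: nat \<Rightarrow> nat \<times> nat) N. (\<forall>n. cmd n \<in> cmds F) \<and> (\<forall>x\<in>cmds F. \<exists>n\<le>N. cmd n = x)"
proof -
  obtain g where g: "bij_betw g {0..<card (cmds F)} (cmds F)"
    using ex_bij_betw_nat_finite[OF finite_cmds[OF F]] by blast
  have c: "card (cmds F) > 0" using finite_cmds[OF F] cmds_ne[OF F] by (simp add: card_gt_0_iff)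
  let ?N = "card (cmds F) - 1"
  \<comment> \<open>Indices beyond the last one are truncated, which makes the enumeration total
    with values in \<open>cmds F\<close>.\<close>
  let ?cmd = "\<lambda>n. g (min n ?N)"
  have "?cmd n \<in> cmds F" for n
    using bij_betwE[OF g] c by (simp add: min_def)
  moreover have "\<exists>n\<le>?N. ?cmd n = x" if x: "x \<in> cmds F" for x
  proof -
    have "x \<in> g ` {0..<card (cmds F)}" using g x by (simp add: bij_betw_def)
    then obtain n where n: "x = g n" "n < card (cmds F)" by auto
    then have "n \<le> ?N" by simp
    then show ?thesis using n(1) by (intro exI[of _ n]) simp
  qed
  ultimately show ?thesis by (intro exI[of _ ?cmd] exI[of _ ?N]) simp
qed

text \<open>The word \<open>a\<^sup>m b\<close> issues the command \<open>cmd m\<close>. The automaton counts the letters \<open>a\<close> up to \<open>N\<close> and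
  obeys exactly those commands that do not descend in the outer forest. Its initial state \<open>None\<close> is left
  after at most \<open>N + 1\<close> letters, since it must not act as an additional root below the forest.\<close>

context
  fixes k :: nat and F :: "nat lforest lforest" and a b :: 'x and cmd :: "nat \<Rightarrow> nat \<times> nat" and N :: nat
  assumes F: "F \<in> F_T_k k" and ab: "a \<noteq> b"
    and cmd: "\<And>n. cmd n \<in> cmds F" and cmd_surj: "\<And>x. x \<in> cmds F \<Longrightarrow> \<exists>n\<le>N. cmd n = x"
begin

text \<open>Saturation at \<open>N\<close>, instead of counting modulo a number, keeps the counter
  aperiodic: a nonempty block of letters \<open>a\<close> either raises it or finds it at
  \<open>N\<close>.\<close>

definition tick :: "nat \<Rightarrow> 'x \<Rightarrow> nat" where
  "tick c x = (if x = a then min (Suc c) N else 0)"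

definition obey :: "nat \<Rightarrow> 'x \<Rightarrow> (nat \<times> nat) option \<Rightarrow> (nat \<times> nat) option" where
  "obey c x st = (case st of
      None \<Rightarrow> if x \<noteq> a \<or> c = N then Some (cmd c) else None
    | Some s \<Rightarrow> if x \<noteq> a \<and> (fst s, fst (cmd c)) \<in> od F then Some (cmd c) else Some s)"

definition mstep :: "nat \<times> (nat \<times> nat) option \<Rightarrow> 'x \<Rightarrow> nat \<times> (nat \<times> nat) option" where
  "mstep q x = (tick (fst q) x, obey (fst q) x (snd q))"

definition mstates :: "(nat \<times> (nat \<times> nat) option) set" where
  "mstates = {..N} \<times> insert None (Some ` cmds F)"

definition arun :: "'x oword \<Rightarrow> nat \<Rightarrow> nat \<times> (nat \<times> nat) option" where
  "arun \<xi> n = foldl mstep (0, None) (map \<xi> [0..<n])"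

lemma arun_0: "arun \<xi> 0 = (0, None)" and arun_Suc: "arun \<xi> (Suc n) = mstep (arun \<xi> n) (\<xi> n)"
  by (simp_all add: arun_def)

lemma fst_mstep: "fst (foldl mstep q u) = foldl tick (fst q) u"
  by (induction u arbitrary: q) (simp_all add: mstep_def)

lemma finite_mstates: "finite mstates"
  using finite_cmds[OF F] by (simp add: mstates_def)

lemma mstep_mstates: "q \<in> mstates \<Longrightarrow> mstep q x \<in> mstates"
  using cmd by (auto simp: mstates_def mstep_def tick_def obey_def split: option.splits)

lemma foldl_mstates: "q \<in> mstates \<Longrightarrow> foldl mstep q u \<in> mstates"
  by (induction u arbitrary: q) (simp_all add: mstep_mstates)

lemma arun_mstates: "arun \<xi> n \<in> mstates"
  unfolding arun_def by (rule foldl_mstates) (simp add: mstates_def)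

lemma mstep_None:
  assumes "snd (mstep q x) = None" "fst q \<le> N"
  shows "snd q = None" "fst (mstep q x) = Suc (fst q)"
  using assms by (auto simp: mstep_def obey_def tick_def split: option.splits if_splits)

text \<open>Before the first obeyed command the counter has not been reset, so it measures the
  letters read. Its bound \<open>N\<close> limits the time spent in \<open>None\<close>, and no
  cycle can pass through \<open>None\<close>.\<close>

lemma foldl_None:
  assumes "snd (foldl mstep q u) = None" "fst q \<le> N"
  shows "snd q = None \<and> fst (foldl mstep q u) = fst q + length u"
  using assms
proof (induction u arbitrary: q)
  case Nil
  then show ?case by simp
next
  case (Cons x u)
  have "fst (mstep q x) \<le> N" using Cons.prems(2) by (auto simp: mstep_def tick_def)
  then have IH: "snd (mstep q x) = None \<and> fst (foldl mstep (mstep q x) u) = fst (mstep q x) + length u"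
    using Cons.prems(1) by (intro Cons.IH) simp_all
  then show ?case using mstep_None[of q x] Cons.prems(2) by simp
qed

lemma mstep_Some:
  assumes "snd q = Some s" "s \<in> cmds F"
  shows "\<exists>s'\<in>cmds F. snd (mstep q x) = Some s' \<and> (fst s, fst s') \<in> od F"
proof (cases "x \<noteq> a \<and> (fst s, fst (cmd (fst q))) \<in> od F")
  case True
  then show ?thesis using assms cmd by (intro bexI[of _ "cmd (fst q)"]) (simp_all add: mstep_def obey_def)
next
  case False
  moreover have "(fst s, fst s) \<in> od F" using assms(2) forest_refl[OF F_forest[OF F]] by (simp add: cmds_def)
  ultimately show ?thesis using assms by (intro bexI[of _ s]) (auto simp: mstep_def obey_def)
qed

lemma foldl_Some:
  assumes "snd q = Some s" "s \<in> cmds F"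
  shows "\<exists>s'\<in>cmds F. snd (foldl mstep q u) = Some s' \<and> (fst s, fst s') \<in> od F"
  using assms
proof (induction u arbitrary: q s)
  case Nil
  then show ?case using forest_refl[OF F_forest[OF F]] by (auto simp: cmds_def)
next
  case (Cons x u)
  obtain s1 where s1: "s1 \<in> cmds F" "snd (mstep q x) = Some s1" "(fst s, fst s1) \<in> od F"
    using mstep_Some[OF Cons.prems] by blast
  obtain s2 where "s2 \<in> cmds F" "snd (foldl mstep (mstep q x) u) = Some s2" "(fst s1, fst s2) \<in> od F"
    using Cons.IH[OF s1(2,1)] by blast
  then show ?case using s1(3) forest_trans[OF F_forest[OF F]] by (intro bexI[of _ s2]) auto
qed

lemma arun_Some:
  assumes "n > N"
  shows "\<exists>s\<in>cmds F. snd (arun \<xi> n) = Some s"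
proof (cases "snd (arun \<xi> n)")
  case None
  then have "fst (arun \<xi> n) = n" using foldl_None[of "(0, None)" "map \<xi> [0..<n]"] by (simp add: arun_def)
  moreover have "fst (arun \<xi> n) \<le> N" using arun_mstates[of \<xi> n] by (auto simp: mstates_def)
  ultimately show ?thesis using assms by simp
next
  case (Some s)
  then show ?thesis using arun_mstates[of \<xi> n] by (auto simp: mstates_def)
qed

text \<open>The offset \<open>Suc N\<close> skips the positions at which the state may still be
  \<open>None\<close>, so \<open>the\<close> is applied to proper values only.\<close>

definition dec :: "'x oword \<Rightarrow> nat \<Rightarrow> nat \<times> nat" where
  "dec \<xi> n = the (snd (arun \<xi> (n + Suc N)))"

lemma dec_seqs: "dec \<xi> \<in> seqs F"
  unfolding seqs_def
proof (rule CollectI, rule allI)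
  fix n
  obtain s where s: "s \<in> cmds F" "snd (arun \<xi> (n + Suc N)) = Some s"
    using arun_Some[of "n + Suc N" \<xi>] by auto
  obtain s' where "snd (arun \<xi> (Suc n + Suc N)) = Some s'" "(fst s, fst s') \<in> od F"
    using mstep_Some[OF s(2,1), of "\<xi> (n + Suc N)"] by (auto simp: arun_Suc)
  then show "dec \<xi> n \<in> cmds F \<and> (fst (dec \<xi> n), fst (dec \<xi> (Suc n))) \<in> od F"
    using s by (simp add: dec_def)
qed

lemma dec_seqcont: "seqcont UNIV dec"
  unfolding seqcont_def
proof (intro ballI allI)
  fix \<xi> :: "'x oword" and n
  have "dec \<xi>' n = dec \<xi> n" if "\<forall>i<n + Suc N. \<xi>' i = \<xi> i" for \<xi>'
  proof -
    have "map \<xi>' [0..<n + Suc N] = map \<xi> [0..<n + Suc N]" using that by (intro map_cong) auto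
    then show ?thesis by (simp only: dec_def arun_def)
  qed
  then show "\<exists>m. \<forall>\<xi>'\<in>UNIV. (\<forall>i<m. \<xi>' i = \<xi> i) \<longrightarrow> dec \<xi>' n = dec \<xi> n" by blast
qed

section \<open>Coding sequences by words\<close>

text \<open>An index of at most \<open>N\<close> is reached by the counter exactly, before
  saturation could blur it.\<close>

definition idx :: "nat \<times> nat \<Rightarrow> nat" where
  "idx x = (SOME n. n \<le> N \<and> cmd n = x)"

lemma idx: "x \<in> cmds F \<Longrightarrow> idx x \<le> N \<and> cmd (idx x) = x"
  unfolding idx_def using cmd_surj by (rule someI_ex)

definition word :: "(nat \<Rightarrow> nat \<times> nat) \<Rightarrow> nat \<Rightarrow> 'x list" where
  "word s n = replicate (idx (s n)) a @ [b]"

definition enc :: "(nat \<Rightarrow> nat \<times> nat) \<Rightarrow> 'x oword" where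
  "enc s = iconcat (word s)"

lemma word_ne: "word s n \<noteq> []"
  by (simp add: word_def)

lemma enc_seqcont: "seqcont D enc"
proof -
  have "seqcont D word"
    unfolding seqcont_def
  proof (intro ballI allI)
    fix s n
    show "\<exists>m. \<forall>s'\<in>D. (\<forall>i<m. s' i = s i) \<longrightarrow> word s' n = word s n"
      by (intro exI[of _ "Suc n"]) (simp add: word_def)
  qed
  then show ?thesis unfolding enc_def by (rule seqcont_iconcat)
qed

lemma foldl_a: "j \<le> N \<Longrightarrow> foldl mstep (0, st) (replicate j a) = (j, st)"
proof (induction j)
  case (Suc j)
  have "replicate (Suc j) a = replicate j a @ [a]" by (simp add: replicate_append_same)
  then have "foldl mstep (0, st) (replicate (Suc j) a) = mstep (j, st) a"
    using Suc by (simp del: replicate_Suc)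
  also have "\<dots> = (Suc j, st)" using Suc.prems by (simp add: mstep_def tick_def obey_def split: option.split)
  finally show ?case .
qed simp

lemma arun_enc_mid:
  assumes "fst (arun (enc s) (bpos (word s) n)) = 0" "s \<in> seqs F" "j < length (word s n)"
  shows "arun (enc s) (bpos (word s) n + j) = (j, snd (arun (enc s) (bpos (word s) n)))"
proof -
  have j: "j \<le> idx (s n)" using assms(3) by (simp add: word_def)
  have "arun (enc s) (bpos (word s) n + j) =
      foldl mstep (foldl mstep (0, None) (concat (map (word s) [0..<n]))) (take j (word s n))"
    unfolding arun_def enc_def map_iconcat_mid[of "word s", OF word_ne less_imp_le[OF assms(3)]] by simp
  also have "foldl mstep (0, None) (concat (map (word s) [0..<n])) = arun (enc s) (bpos (word s) n)"
    unfolding arun_def enc_def map_iconcat[of "word s", OF word_ne] ..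
  also have "arun (enc s) (bpos (word s) n) = (0, snd (arun (enc s) (bpos (word s) n)))"
    using assms(1) by (metis prod.collapse)
  also have "take j (word s n) = replicate j a" using j by (simp add: word_def)
  finally show ?thesis using foldl_a[of j] j idx[OF seqs_cmds[OF F assms(2)], of n] by simp
qed

text \<open>No command of a sequence from \<open>seqs F\<close> descends in the outer order, so each
  one is obeyed, and the closing letter \<open>b\<close> resets the counter for the next
  word.\<close>

lemma arun_enc:
  assumes s: "s \<in> seqs F"
  shows "fst (arun (enc s) (bpos (word s) n)) = 0 \<and>
    (case n of 0 \<Rightarrow> snd (arun (enc s) (bpos (word s) n)) = None | Suc m \<Rightarrow> snd (arun (enc s) (bpos (word s) n)) = Some (s m))"
proof (induction n)
  case 0
  then show ?case by (simp add: arun_0)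
next
  case (Suc n)
  let ?j = "idx (s n)"
  have len: "length (word s n) = Suc ?j" by (simp add: word_def)
  have i: "?j \<le> N" "cmd ?j = s n" using idx[OF seqs_cmds[OF F s]] by auto
  have "enc s (bpos (word s) n + ?j) = concat (map (word s) [0..<Suc n]) ! (bpos (word s) n + ?j)"
    unfolding enc_def by (rule iconcat_nth[OF word_ne]) (simp add: bpos_Suc len)
  also have "\<dots> = b" by (simp add: nth_append bpos_def word_def)
  finally have eb: "enc s (bpos (word s) n + ?j) = b" .
  have "arun (enc s) (bpos (word s) (Suc n)) = mstep (?j, snd (arun (enc s) (bpos (word s) n))) b"
    using arun_enc_mid[of s n ?j] Suc.IH s len by (simp add: bpos_Suc arun_Suc eb)
  also have "\<dots> = (0, Some (s n))"
  proof (cases n)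
    case 0
    then show ?thesis using Suc.IH ab i by (simp add: mstep_def tick_def obey_def)
  next
    case (Suc m)
    then have "(fst (s m), fst (s n)) \<in> od F" using s by (simp add: seqs_def)
    then show ?thesis using Suc.IH Suc ab i by (simp add: mstep_def tick_def obey_def)
  qed
  finally show ?case by simp
qed

text \<open>Each entry of \<open>s\<close> persists while the next word is read. Hence the decoded
  sequence is, up to its beginning, \<open>s\<close> with every entry repeated finitely
  often.\<close>

lemma inf_set_dec_enc:
  assumes s: "s \<in> seqs F"
  shows "inf_set (dec (enc s)) = inf_set s"
proof -
  let ?z = "\<lambda>n. the (snd (arun (enc s) n))"
  note sm = bpos_strict_mono[of "word s", OF word_ne]
  have z: "?z (bpos (word s) (Suc n) + j) = s n" if "j < length (word s (Suc n))" for n j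
    using arun_enc_mid[of s "Suc n" j] arun_enc[OF s, of "Suc n"] s that by simp
  have "inf_set (dec (enc s)) = inf_set ?z"
    unfolding dec_def by (rule inf_set_shift)
  also have "inf_set ?z = inf_set s"
  proof (intro set_eqI iffI)
    fix x assume x: "x \<in> inf_set s"
    show "x \<in> inf_set ?z"
      unfolding inf_set_def INFM_nat_le
    proof (rule CollectI, rule allI)
      fix M
      obtain n where n: "n \<ge> M" "s n = x" using x unfolding inf_set_def INFM_nat_le by blast
      have "?z (bpos (word s) (Suc n)) = x" using z[of 0 n] n word_ne by simp
      moreover have "bpos (word s) (Suc n) \<ge> M"
        using strict_mono_imp_increasing[OF sm, of "Suc n"] n by simp
      ultimately show "\<exists>n\<ge>M. ?z n = x" by blast
    qed
  next
    fix x assume x: "x \<in> inf_set ?z"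
    show "x \<in> inf_set s"
      unfolding inf_set_def INFM_nat_le
    proof (rule CollectI, rule allI)
      fix M
      have "\<exists>i\<ge>bpos (word s) (Suc M). ?z i = x" using x unfolding inf_set_def INFM_nat_le by simp
      then obtain i where i: "i \<ge> bpos (word s) (Suc M)" "?z i = x" by blast
      obtain n' j where n': "i = bpos (word s) n' + j" "j < length (word s n')"
        using bpos_locate[of "word s" i, OF word_ne] by blast
      have "bpos (word s) (Suc M) < bpos (word s) (Suc n')" using i(1) n' by (simp add: bpos_Suc)
      then have "Suc M \<le> n'" using strict_mono_less[OF sm] by simp
      then obtain n where n: "n' = Suc n" "n \<ge> M" by (cases n') auto
      have "s n = x" using z[of j n] n' i(2) n(1) by simp
      then show "\<exists>n\<ge>M. s n = x" using n(2) by blast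
    qed
  qed
  finally show ?thesis .
qed

definition part :: "'x oword \<Rightarrow> nat" where
  "part \<xi> = colr F (dec \<xi>)"

lemma part_represents: "represents part F"
  unfolding represents_def
  by (intro exI[of _ dec] exI[of _ enc])
     (auto simp: part_def dec_seqcont enc_seqcont dec_seqs colr_cong[OF inf_set_dec_enc])

section \<open>Aperiodicity of the automaton\<close>

lemma foldl_tick_a:
  "set u \<subseteq> {a} \<Longrightarrow> c \<le> N \<Longrightarrow> foldl tick c u = min (c + length u) N"
  by (induction u arbitrary: c) (auto simp: tick_def)

lemma foldl_tick_reset:
  assumes "\<not> set u \<subseteq> {a}"
  shows "foldl tick c u = foldl tick c' u"
  using assms by (induction u arbitrary: c c') (auto simp: tick_def)

text \<open>Whether a command is obeyed depends on the counter and the outer node but not on the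
  inner node. So, uniformly in \<open>t\<close>, a word moves strictly above \<open>p\<close>, does
  nothing, or overwrites the inner node by a constant.\<close>

lemma obey_Some_cases:
  assumes p: "p \<in> nd F"
  shows "(\<forall>t. \<exists>s'\<in>cmds F. snd (foldl mstep (c, Some (p, t)) u) = Some s' \<and> (p, fst s') \<in> od F \<and> fst s' \<noteq> p) \<or>
    (\<forall>t. snd (foldl mstep (c, Some (p, t)) u) = Some (p, t)) \<or>
    (\<exists>t'. \<forall>t. snd (foldl mstep (c, Some (p, t)) u) = Some (p, t'))"
proof (induction u arbitrary: c)
  case Nil
  then show ?case by simp
next
  case (Cons x u)
  show ?case
  proof (cases "x \<noteq> a \<and> (p, fst (cmd c)) \<in> od F")
    case False
    have "mstep (c, Some (p, t)) x = (tick c x, Some (p, t))" for t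
      using False by (auto simp: mstep_def obey_def)
    then show ?thesis using Cons.IH[of "tick c x"] by simp
  next
    case True
    then have e: "mstep (c, Some (p, t)) x = (tick c x, Some (cmd c))" for t
      by (auto simp: mstep_def obey_def)
    show ?thesis
    proof (cases "fst (cmd c) = p")
      case eq: True
      obtain t0 where t0: "cmd c = (p, t0)" using eq by (cases "cmd c") auto
      show ?thesis using Cons.IH[of "tick c x"] unfolding foldl.simps e t0 by blast
    next
      case False
      obtain s' where s': "s' \<in> cmds F" "snd (foldl mstep (tick c x, Some (cmd c)) u) = Some s'"
        "(fst (cmd c), fst s') \<in> od F"
        using foldl_Some[of "(tick c x, Some (cmd c))" "cmd c" u] cmd by auto
      have "(p, fst s') \<in> od F" using True s'(3) forest_trans[OF F_forest[OF F]] by blast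
      moreover have "fst s' \<noteq> p" using True s'(3) False forest_antisym[OF F_forest[OF F]] by blast
      ultimately show ?thesis unfolding foldl.simps e using s' by blast
    qed
  qed
qed

text \<open>If a power of \<open>u\<close> fixes the state, then \<open>u\<close> fixes the counter:
  it is saturated if \<open>u\<close> consists of letters \<open>a\<close> only, and otherwise its
  value after \<open>u\<close> does not depend on the value before. Of the three actions of
  \<open>u\<close> on the command, an ascent cannot be undone and a constant action is
  idempotent.\<close>

lemma mstep_aperiodic:
  assumes q: "q \<in> mstates" and u: "u \<noteq> []" and n: "n > 0"
    and per: "foldl mstep q (concat (replicate n u)) = q"
  shows "foldl mstep q u = q"
proof -
  obtain m where m: "n = Suc m" using n by (cases n) auto
  obtain c st where cst: "q = (c, st)" by (cases q)
  have cN: "c \<le> N" using q cst by (auto simp: mstates_def)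
  have len: "length (concat (replicate n u)) = n * length u"
    by (induction n) auto
  have lenpos: "length (concat (replicate n u)) > 0" using u n unfolding len by simp
  show ?thesis
  proof (cases st)
    case None
    then have "fst (foldl mstep q (concat (replicate n u))) = c + length (concat (replicate n u))"
      using foldl_None[of q "concat (replicate n u)"] per cst cN by simp
    then show ?thesis using per cst lenpos by simp
  next
    case (Some s)
    obtain p t where s: "s = (p, t)" by (cases s)
    have sc: "s \<in> cmds F" using q cst Some by (auto simp: mstates_def)
    then have p: "p \<in> nd F" by (simp add: cmds_def s)
    have c1: "foldl tick c u = c"
    proof (cases "set u \<subseteq> {a}")
      case True
      have "set (concat (replicate n u)) \<subseteq> {a}" using True by auto
      then have "c = min (c + length (concat (replicate n u))) N"
        using foldl_tick_a[OF _ cN] fst_mstep[of q "concat (replicate n u)"] per cst by simp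
      then have "c = N" using lenpos by linarith
      then show ?thesis using foldl_tick_a[OF True cN] by simp
    next
      case False
      have "concat (replicate n u) = concat (replicate m u) @ u"
        unfolding m replicate_Suc by (simp flip: replicate_append_same)
      then have "c = foldl tick (foldl tick c (concat (replicate m u))) u"
        using fst_mstep[of q "concat (replicate n u)"] per cst by simp
      then show ?thesis using foldl_tick_reset[OF False] by metis
    qed
    have fst1: "fst (foldl mstep q u) = c" using c1 cst by (simp add: fst_mstep)
    have per': "foldl mstep (foldl mstep q u) (concat (replicate m u)) = q"
      using per by (simp add: m)
    have q': "q = (c, Some (p, t))" using cst Some s by simp
    consider (up) "\<exists>s'\<in>cmds F. snd (foldl mstep q u) = Some s' \<and> (p, fst s') \<in> od F \<and> fst s' \<noteq> p"
      | (id) "snd (foldl mstep q u) = Some (p, t)"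
      | (const) t' where "\<And>t. snd (foldl mstep (c, Some (p, t)) u) = Some (p, t')"
      using obey_Some_cases[OF p, of c u] unfolding q' by blast
    then show ?thesis
    proof cases
      case up
      then obtain s' where s': "s' \<in> cmds F" "snd (foldl mstep q u) = Some s'" "(p, fst s') \<in> od F" "fst s' \<noteq> p"
        by blast
      have "(fst s', p) \<in> od F"
        using foldl_Some[OF s'(2,1), of "concat (replicate m u)"] per' q' by auto
      then show ?thesis using s' forest_antisym[OF F_forest[OF F]] by blast
    next
      case id
      then show ?thesis using fst1 q' by (metis prod.collapse)
    next
      case const
      have *: "foldl mstep (c, Some (p, t'')) u = (c, Some (p, t'))" for t''
        using const[of t''] c1 fst_mstep[of "(c, Some (p, t''))" u] by (simp add: prod_eq_iff)
      have "foldl mstep (c, Some (p, t')) (concat (replicate i u)) = (c, Some (p, t'))" for i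
        by (induction i) (simp_all add: *)
      then have "q = (c, Some (p, t'))" using per' unfolding q' * by simp
      then show ?thesis using * by simp
    qed
  qed
qed

section \<open>The automaton on natural numbers and its Muller conditions\<close>

definition nstep :: "nat \<Rightarrow> 'x \<Rightarrow> nat" where
  "nstep q x = to_nat (mstep (from_nat q) x)"

lemma foldl_nstep: "foldl nstep (to_nat q) u = to_nat (foldl mstep q u)"
  by (induction u arbitrary: q) (simp_all add: nstep_def)

lemma run_nstep: "run nstep (to_nat (0::nat, None :: (nat \<times> nat) option)) \<xi> n = to_nat (arun \<xi> n)"
  by (simp add: run_def ext_tr_def foldl_nstep arun_def)

text \<open>The recurring commands are a projection of the recurring states, since the state set is
  finite; hence the colour is a function of the recurring states.\<close>

lemma inf_set_dec:
  "inf_set (dec \<xi>) = (\<lambda>q. the (snd (from_nat q :: nat \<times> (nat \<times> nat) option))) `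
     inf_states nstep (to_nat (0::nat, None :: (nat \<times> nat) option)) \<xi>"
proof -
  let ?r = "run nstep (to_nat (0::nat, None :: (nat \<times> nat) option)) \<xi>"
  let ?g = "\<lambda>q. the (snd (from_nat q :: nat \<times> (nat \<times> nat) option))"
  have "range ?r \<subseteq> to_nat ` mstates" using arun_mstates by (auto simp: run_nstep)
  then have fin: "finite (range ?r)" using finite_mstates finite_subset by blast
  have "dec \<xi> = (\<lambda>n. ?g (?r (n + Suc N)))" by (simp add: fun_eq_iff dec_def run_nstep)
  then have "inf_set (dec \<xi>) = inf_set (\<lambda>n. ?g (?r n))"
    using inf_set_shift[of "\<lambda>n. ?g (?r n)" "Suc N"] by simp
  also have "\<dots> = ?g ` inf_set ?r" by (rule inf_set_comp[OF fin])
  finally show ?thesis by (simp add: inf_states_eq)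
qed

lemma part_A_k: "part \<in> A_k k"
  unfolding A_k_def kpartitions_def
proof (intro CollectI conjI allI impI)
  show "part \<xi> < k" for \<xi> unfolding part_def by (rule colr_less[OF F dec_seqs])
  fix i assume "i < k"
  let ?Q = "to_nat ` mstates" and ?q0 = "to_nat (0::nat, None :: (nat \<times> nat) option)"
  \<comment> \<open>The accepting sets are collected from the words of colour \<open>i\<close>. No
    other word has such a recurring set, because equal recurring sets give equal colours.\<close>
  let ?F = "{inf_states nstep ?q0 \<xi> |\<xi>. part \<xi> = i}"
  have aut: "is_automaton ?Q nstep ?q0"
    using finite_mstates mstep_mstates by (auto simp: is_automaton_def nstep_def mstates_def)
  have "aperiodic_automaton ?Q nstep"
    unfolding aperiodic_automaton_def
  proof (intro ballI allI impI)
    fix q and u :: "'x list" and n :: nat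
    assume "q \<in> ?Q" and A: "u \<noteq> [] \<and> 0 < n \<and> ext_tr nstep q (concat (replicate n u)) = q"
    then obtain q' where q': "q' \<in> mstates" "q = to_nat q'" by blast
    have "foldl mstep q' (concat (replicate n u)) = q'" using A unfolding ext_tr_def q' foldl_nstep by simp
    then have "foldl mstep q' u = q'" using mstep_aperiodic[OF q'(1)] A by blast
    then show "ext_tr nstep q u = q" by (simp add: ext_tr_def q' foldl_nstep)
  qed
  moreover have "?F \<subseteq> Pow ?Q"
  proof -
    have "run nstep ?q0 \<xi> n \<in> ?Q" for \<xi> n using arun_mstates by (simp add: run_nstep)
    then have "inf_states nstep ?q0 \<xi> \<subseteq> ?Q" for \<xi>
      unfolding inf_states_eq by (intro inf_set_subset) simp
    then show ?thesis by blast
  qed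
  moreover have "part -` {i} = muller_lang nstep ?q0 ?F"
  proof -
    have "part \<xi> = part \<eta>" if "inf_states nstep ?q0 \<xi> = inf_states nstep ?q0 \<eta>" for \<xi> \<eta>
      unfolding part_def using that by (intro colr_cong) (simp add: inf_set_dec)
    then show ?thesis unfolding muller_lang_def by blast
  qed
  ultimately show "aperiodic_lang (part -` {i})" unfolding aperiodic_lang_def using aut by blast
qed

end

theorem exists_aperiodic_representation:
  assumes "CARD('x::finite) \<ge> 2" and F: "F \<in> F_T_k k"
  shows "\<exists>L :: 'x oword \<Rightarrow> nat. L \<in> A_k k \<and> represents L F"
proof -
  obtain a b :: 'x where ab: "a \<noteq> b"
    using assms(1) card_le_Suc0_iff_eq[of "UNIV :: 'x set"] by fastforce
  obtain cmd :: "nat \<Rightarrow> nat \<times> nat" and N where "\<forall>n. cmd n \<in> cmds F" "\<forall>x\<in>cmds F. \<exists>n\<le>N. cmd n = x"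
    using enumeration_cmds[OF F] by blast
  then have c: "\<And>n. cmd n \<in> cmds F" "\<And>x. x \<in> cmds F \<Longrightarrow> \<exists>n\<le>N. cmd n = x" by blast+
  show ?thesis
    using part_A_k[OF F ab c] part_represents[OF F ab c] by blast
qed

subsection \<open>Regular partitions are determined by the infinity set of one automaton\<close>

lemma run_0: "run f q \<xi> 0 = q" and run_Suc: "run f q \<xi> (Suc n) = f (run f q \<xi> n) (\<xi> n)"
  by (simp_all add: run_def ext_tr_def)

lemma run_in:
  assumes "is_automaton Q f q0"
  shows "run f q0 \<xi> n \<in> Q"
  using assms by (induction n) (auto simp: run_0 run_Suc is_automaton_def)

lemma A_k_subset_R_k: "A_k k \<subseteq> R_k k"
  unfolding A_k_def R_k_def aperiodic_lang_def regular_lang_def by blast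

text \<open>Product of the \<open>k\<close> acceptors, with tuples coded as lists because states are
  numbers. The recurring states of a component are the projections of the recurring tuples, so these
  decide membership in every component of the partition.\<close>

lemma R_k_automaton:
  fixes L :: "'x oword \<Rightarrow> nat"
  assumes "L \<in> R_k k"
  shows "\<exists>Q f q0. is_automaton Q f q0 \<and> (\<forall>\<xi> \<eta>. inf_states f q0 \<xi> = inf_states f q0 \<eta> \<longrightarrow> L \<xi> = L \<eta>)"
proof -
  have "\<forall>i. \<exists>A. i < k \<longrightarrow> is_automaton (fst A) (fst (snd A)) (fst (snd (snd A))) \<and>
      L -` {i} = muller_lang (fst (snd A)) (fst (snd (snd A))) (snd (snd (snd A)))"
  proof
    fix i
    show "\<exists>A. i < k \<longrightarrow> is_automaton (fst A) (fst (snd A)) (fst (snd (snd A))) \<and>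
      L -` {i} = muller_lang (fst (snd A)) (fst (snd (snd A))) (snd (snd (snd A)))"
    proof (cases "i < k")
      case True
      then have "regular_lang (L -` {i})" using assms by (simp add: R_k_def)
      then obtain Q f q0 F where "is_automaton Q f q0" "L -` {i} = muller_lang f q0 F"
        unfolding regular_lang_def by (elim exE conjE)
      then show ?thesis by (intro exI[of _ "(Q, f, q0, F)"]) simp
    qed simp
  qed
  then obtain A where A: "\<forall>i. i < k \<longrightarrow> is_automaton (fst (A i)) (fst (snd (A i))) (fst (snd (snd (A i)))) \<and>
      L -` {i} = muller_lang (fst (snd (A i))) (fst (snd (snd (A i)))) (snd (snd (snd (A i))))"
    by (elim choice[elim_format] exE)
  define Qs fs qs Fs where defs: "Qs i = fst (A i)" "fs i = fst (snd (A i))" "qs i = fst (snd (snd (A i)))"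
    "Fs i = snd (snd (snd (A i)))" for i
  have aut: "is_automaton (Qs i) (fs i) (qs i)" and lang: "L -` {i} = muller_lang (fs i) (qs i) (Fs i)"
    if "i < k" for i
    using A that by (auto simp: defs)
  define vec where "vec v = to_nat (map v [0..<k])" for v :: "nat \<Rightarrow> nat"
  define comp where "comp q i = (from_nat q :: nat list) ! i" for q i
  have comp_vec: "comp (vec v) i = v i" if "i < k" for v i
    using that by (simp add: comp_def vec_def)
  define f where "f q x = vec (\<lambda>i. fs i (comp q i) x)" for q x
  define Q where "Q = vec ` {v. \<forall>i<k. v i \<in> Qs i}"
  have finQ: "finite Q"
  proof -
    let ?B = "{l. set l \<subseteq> (\<Union>i<k. Qs i) \<and> length l = k}"
    have fin: "finite ?B"
      by (rule finite_lists_length_eq) (use aut in \<open>auto simp: is_automaton_def\<close>)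
    have "Q \<subseteq> to_nat ` ?B"
    proof
      fix q assume "q \<in> Q"
      then obtain v where v: "q = vec v" "\<forall>i<k. v i \<in> Qs i" by (auto simp: Q_def)
      have "map v [0..<k] \<in> ?B" using v(2) by auto
      then show "q \<in> to_nat ` ?B" using v(1) by (simp add: vec_def)
    qed
    then show ?thesis using finite_imageI[OF fin] by (rule finite_subset)
  qed
  have "is_automaton Q f (vec qs)"
    unfolding is_automaton_def
  proof (intro conjI ballI allI)
    show "vec qs \<in> Q" unfolding Q_def using aut by (auto simp: is_automaton_def)
    fix q x assume "q \<in> Q"
    then obtain v where v: "q = vec v" "\<forall>i<k. v i \<in> Qs i" by (auto simp: Q_def)
    then have "\<forall>i<k. fs i (comp q i) x \<in> Qs i" using aut comp_vec by (auto simp: is_automaton_def)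
    then show "f q x \<in> Q" by (auto simp: f_def Q_def)
  qed (rule finQ)
  have run: "run f (vec qs) \<xi> n = vec (\<lambda>i. run (fs i) (qs i) \<xi> n)" for \<xi> n
  proof (induction n)
    case 0
    then show ?case by (simp add: run_0)
  next
    case (Suc n)
    have vec_cong: "vec v = vec w" if "\<And>i. i < k \<Longrightarrow> v i = w i" for v w using that by (simp add: vec_def)
    show ?case unfolding run_Suc Suc unfolding f_def by (rule vec_cong) (simp add: comp_vec)
  qed
  have inf: "inf_states (fs i) (qs i) \<xi> = (\<lambda>q. comp q i) ` inf_states f (vec qs) \<xi>" if i: "i < k" for i \<xi>
  proof -
    have "range (run f (vec qs) \<xi>) \<subseteq> Q" using run_in[OF \<open>is_automaton Q f (vec qs)\<close>] by blast
    then have fin: "finite (range (run f (vec qs) \<xi>))" using finQ finite_subset by blast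
    have "run (fs i) (qs i) \<xi> = (\<lambda>n. comp (run f (vec qs) \<xi> n) i)"
      by (simp add: fun_eq_iff run comp_vec[OF i])
    then show ?thesis using inf_set_comp[OF fin, of "\<lambda>q. comp q i"] by (simp add: inf_states_eq)
  qed
  have "L \<xi> = L \<eta>" if eq: "inf_states f (vec qs) \<xi> = inf_states f (vec qs) \<eta>" for \<xi> \<eta>
  proof -
    have i: "L \<xi> < k" using assms by (simp add: R_k_def kpartitions_def)
    have "\<xi> \<in> muller_lang (fs (L \<xi>)) (qs (L \<xi>)) (Fs (L \<xi>))" using lang[OF i] by blast
    then have "\<eta> \<in> muller_lang (fs (L \<xi>)) (qs (L \<xi>)) (Fs (L \<xi>))"
      unfolding muller_lang_def by (simp add: inf[OF i] eq)
    then show ?thesis using lang[OF i] by (metis vimage_singleton_eq)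
  qed
  then show ?thesis using \<open>is_automaton Q f (vec qs)\<close> by blast
qed

subsection \<open>Visited states and loops\<close>

text \<open>The start state is left out and the end state is counted, so that consecutive blocks of
  a run account for each position once.\<close>

primrec vis :: "(nat \<Rightarrow> 'x \<Rightarrow> nat) \<Rightarrow> nat \<Rightarrow> 'x list \<Rightarrow> nat set" where
  "vis f q [] = {}"
| "vis f q (x # u) = insert (f q x) (vis f (f q x) u)"

lemma vis_append: "vis f q (u @ v) = vis f q u \<union> vis f (foldl f q u) v"
  by (induction u arbitrary: q) auto

lemma vis_eq: "vis f q u = {foldl f q (take (Suc j) u) |j. j < length u}"
proof (induction u arbitrary: q)
  case Nil
  then show ?case by simp
next
  case (Cons x u)
  have "{foldl f q (take (Suc j) (x # u)) |j. j < length (x # u)} =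
      insert (f q x) {foldl f (f q x) (take (Suc j) u) |j. j < length u}"
    by (auto simp: less_Suc_eq_0_disj) force
  then show ?case using Cons.IH[of "f q x"] by simp
qed

lemma last_vis: "u \<noteq> [] \<Longrightarrow> foldl f q u \<in> vis f q u"
  by (induction u rule: rev_induct) (auto simp: vis_append)

lemma inf_states_iconcat:
  assumes b: "\<And>n. b n \<noteq> []"
  shows "inf_states f q0 (iconcat b) =
    {q. \<exists>\<^sub>\<infinity>n. q \<in> vis f (foldl f q0 (concat (map b [0..<n]))) (b n)}"
proof -
  note sm = bpos_strict_mono[of b, OF b]
  have r: "run f q0 (iconcat b) (bpos b n + j) = foldl f (foldl f q0 (concat (map b [0..<n]))) (take j (b n))"
    if "j \<le> length (b n)" for n j
    unfolding run_def ext_tr_def map_iconcat_mid[of b, OF b that] by simp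
  show ?thesis
  proof (intro set_eqI iffI)
    fix q assume q: "q \<in> inf_states f q0 (iconcat b)"
    show "q \<in> {q. \<exists>\<^sub>\<infinity>n. q \<in> vis f (foldl f q0 (concat (map b [0..<n]))) (b n)}"
      unfolding INFM_nat_le
    proof (rule CollectI, rule allI)
      fix M
      \<comment> \<open>One position is skipped since the state at the start of a block is credited
        to the preceding block.\<close>
      have "\<exists>i\<ge>Suc (bpos b M). run f q0 (iconcat b) i = q"
        using q unfolding inf_states_def INFM_nat_le by simp
      then obtain i where i: "i \<ge> Suc (bpos b M)" "run f q0 (iconcat b) i = q" by blast
      obtain i' where i': "i = Suc i'" using i(1) by (cases i) auto
      obtain n j where n: "i' = bpos b n + j" "j < length (b n)" using bpos_locate[of b i', OF b] by blast
      have "bpos b M < bpos b (Suc n)" using i(1) i' n by (simp add: bpos_Suc)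
      then have "n \<ge> M" using strict_mono_less[OF sm] by simp
      moreover have "q \<in> vis f (foldl f q0 (concat (map b [0..<n]))) (b n)"
        unfolding vis_eq using r[of "Suc j" n] i(2) i' n by (intro CollectI exI[of _ j]) simp
      ultimately show "\<exists>n\<ge>M. q \<in> vis f (foldl f q0 (concat (map b [0..<n]))) (b n)" by blast
    qed
  next
    fix q assume q: "q \<in> {q. \<exists>\<^sub>\<infinity>n. q \<in> vis f (foldl f q0 (concat (map b [0..<n]))) (b n)}"
    show "q \<in> inf_states f q0 (iconcat b)"
      unfolding inf_states_def INFM_nat_le
    proof (rule CollectI, rule allI)
      fix M
      obtain n where n: "n \<ge> M" "q \<in> vis f (foldl f q0 (concat (map b [0..<n]))) (b n)"
        using q unfolding INFM_nat_le by blast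
      then obtain j where j: "j < length (b n)" "q = foldl f (foldl f q0 (concat (map b [0..<n]))) (take (Suc j) (b n))"
        unfolding vis_eq by blast
      then have "run f q0 (iconcat b) (bpos b n + Suc j) = q" using r[of "Suc j" n] by simp
      moreover have "bpos b n + Suc j \<ge> M" using strict_mono_imp_increasing[OF sm, of n] n(1) by simp
      ultimately show "\<exists>n\<ge>M. run f q0 (iconcat b) n = q" by blast
    qed
  qed
qed

subsection \<open>Forests of lists ordered by prefix\<close>

definition code :: "nat set list \<Rightarrow> nat" where
  "code l = list_encode (map set_encode l)"

definition decode :: "nat \<Rightarrow> nat set list" where
  "decode n = map set_decode (list_decode n)"

lemma decode_code: "\<forall>A\<in>set l. finite A \<Longrightarrow> decode (code l) = l"
  by (simp add: code_def decode_def map_idI)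

text \<open>The prefixes of a list form a chain, so any finite nonempty family of lists of finite
  sets is a forest under the prefix order, closed under prefixes or not. Nodes are codes because
  forests live on numbers.\<close>

definition pforest :: "nat set list set \<Rightarrow> (nat set list \<Rightarrow> 'l) \<Rightarrow> 'l lforest" where
  "pforest X lab = (code ` X, {(code l, code l') |l l'. l \<in> X \<and> l' \<in> X \<and> prefix l l'}, \<lambda>n. lab (decode n))"

lemma pforest_simps:
  "nd (pforest X lab) = code ` X" "lb (pforest X lab) n = lab (decode n)"
  by (simp_all add: pforest_def)

lemma od_pforest:
  assumes X: "\<forall>l\<in>X. \<forall>A\<in>set l. finite A" and "l \<in> X" "l' \<in> X"
  shows "(code l, code l') \<in> od (pforest X lab) \<longleftrightarrow> prefix l l'"
proof -
  have inj: "l1 = l2" if "code l1 = code l2" "l1 \<in> X" "l2 \<in> X" for l1 l2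
    using decode_code[of l1] decode_code[of l2] X that by metis
  show ?thesis unfolding pforest_def using assms(2,3) inj by auto
qed

lemma od_pforestE:
  assumes "(x, y) \<in> od (pforest X lab)"
  shows "\<exists>l l'. x = code l \<and> y = code l' \<and> l \<in> X \<and> l' \<in> X \<and> prefix l l'"
  using assms by (auto simp: pforest_def)

lemma is_forest_pforest:
  assumes X: "\<forall>l\<in>X. \<forall>A\<in>set l. finite A" and fin: "finite X" and ne: "X \<noteq> {}"
    and lab: "\<And>l. l \<in> X \<Longrightarrow> lab l \<in> Lab"
  shows "is_forest Lab (pforest X lab)"
proof -
  let ?F = "pforest X lab"
  note iff = od_pforest[OF X]
  have "partial_order_on (nd ?F) (od ?F)"
    unfolding partial_order_on_def preorder_on_def
  proof (intro conjI)
    show "od ?F \<subseteq> nd ?F \<times> nd ?F" by (auto simp: pforest_def)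
    show "refl_on (nd ?F) (od ?F)" by (auto simp: pforest_def refl_on_def)
    show "trans (od ?F)"
    proof (rule transI)
      fix x y z assume xy: "(x, y) \<in> od ?F" and yz: "(y, z) \<in> od ?F"
      obtain l l' where l: "x = code l" "y = code l'" "l \<in> X" "l' \<in> X" "prefix l l'"
        using od_pforestE[OF xy] by (elim exE conjE)
      obtain m m' where m: "y = code m" "z = code m'" "m \<in> X" "m' \<in> X" "prefix m m'"
        using od_pforestE[OF yz] by (elim exE conjE)
      have "prefix l' m'" using yz iff[OF l(4) m(4), of lab] l m by simp
      then have "prefix l m'" using l(5) prefix_order.trans by blast
      then show "(x, z) \<in> od ?F" using iff[OF l(3) m(4), of lab] l m by simp
    qed
    show "antisym (od ?F)"
    proof (rule antisymI)
      fix x y assume xy: "(x, y) \<in> od ?F" and yx: "(y, x) \<in> od ?F"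
      obtain l l' where l: "x = code l" "y = code l'" "l \<in> X" "l' \<in> X" "prefix l l'"
        using od_pforestE[OF xy] by (elim exE conjE)
      have "prefix l' l" using yx iff[OF l(4,3), of lab] l by simp
      then show "x = y" using l prefix_order.antisym by blast
    qed
  qed
  moreover have "(y, z) \<in> od ?F \<or> (z, y) \<in> od ?F" if yx: "(y, x) \<in> od ?F" and zx: "(z, x) \<in> od ?F" for x y z
  proof -
    obtain l l' where l: "y = code l" "x = code l'" "l \<in> X" "l' \<in> X" "prefix l l'"
      using od_pforestE[OF yx] by (elim exE conjE)
    obtain m m' where m: "z = code m" "x = code m'" "m \<in> X" "m' \<in> X" "prefix m m'"
      using od_pforestE[OF zx] by (elim exE conjE)
    have "prefix m l'" using zx iff[OF m(3) l(4), of lab] l m by simp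
    then have "prefix l m \<or> prefix m l" using l(5) prefix_same_cases by blast
    then show ?thesis using iff[OF l(3) m(3), of lab] iff[OF m(3) l(3), of lab] l m by simp
  qed
  moreover have "lb ?F x \<in> Lab" if "x \<in> nd ?F" for x
    using that lab decode_code X by (auto simp: pforest_simps)
  ultimately show ?thesis
    using fin ne unfolding is_forest_alt by (simp add: pforest_simps(1)) blast
qed

lemma is_tree_pforest:
  assumes X: "\<forall>l\<in>X. \<forall>A\<in>set l. finite A" and fin: "finite X"
    and root: "m \<in> X" "\<And>l. l \<in> X \<Longrightarrow> prefix m l" and lab: "\<And>l. l \<in> X \<Longrightarrow> lab l \<in> Lab"
  shows "is_tree Lab (pforest X lab)"
  unfolding is_tree_alt
proof (intro conjI bexI[of _ "code m"] ballI)
  show "is_forest Lab (pforest X lab)" using root(1) by (intro is_forest_pforest X fin lab) auto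
  show "code m \<in> nd (pforest X lab)" using root(1) by (simp add: pforest_simps)
  show "(code m, x) \<in> od (pforest X lab)" if "x \<in> nd (pforest X lab)" for x
    using that root od_pforest[OF X, of m] by (auto simp: pforest_simps)
qed

subsection \<open>The forest of an automaton\<close>

locale determining_automaton =
  fixes Q :: "nat set" and f :: "nat \<Rightarrow> 'x \<Rightarrow> nat" and q0 :: nat and L :: "'x oword \<Rightarrow> nat" and k :: nat
  assumes aut: "is_automaton Q f q0"
    and det: "\<And>\<xi> \<eta>. inf_states f q0 \<xi> = inf_states f q0 \<eta> \<Longrightarrow> L \<xi> = L \<eta>"
    and Lk: "\<And>\<xi>. L \<xi> < k"
begin

text \<open>A set that is not the recurring set of any word receives the default colour 0, which is
  legal because \<open>L\<close> takes values below \<open>k\<close>.\<close>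

definition col :: "nat set \<Rightarrow> nat" where
  "col A = (if \<exists>\<xi>. inf_states f q0 \<xi> = A then L (SOME \<xi>. inf_states f q0 \<xi> = A) else 0)"

lemma col_inf: "col (inf_states f q0 \<xi>) = L \<xi>"
proof -
  have "inf_states f q0 (SOME \<eta>. inf_states f q0 \<eta> = inf_states f q0 \<xi>) = inf_states f q0 \<xi>"
    by (rule someI_ex[of "\<lambda>\<eta>. inf_states f q0 \<eta> = inf_states f q0 \<xi>"]) blast
  then have "L (SOME \<eta>. inf_states f q0 \<eta> = inf_states f q0 \<xi>) = L \<xi>" by (rule det)
  moreover have "\<exists>\<eta>. inf_states f q0 \<eta> = inf_states f q0 \<xi>" by blast
  ultimately show ?thesis unfolding col_def by simp
qed

lemma col_less: "col A < k"
proof -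
  have "0 < k" using Lk[of undefined] by linarith
  then show ?thesis by (simp add: col_def Lk)
qed

text \<open>These are the possible recurring sets: reachable and strongly connected within
  themselves. Nonempty paths are demanded so that a single state counts only if it has a transition
  to itself.\<close>

definition loop :: "nat set \<Rightarrow> bool" where
  "loop A \<longleftrightarrow> A \<noteq> {} \<and> A \<subseteq> Q \<and> (\<exists>u. foldl f q0 u \<in> A) \<and>
     (\<forall>q\<in>A. \<forall>q'\<in>A. \<exists>u. u \<noteq> [] \<and> foldl f q u = q' \<and> vis f q u \<subseteq> A)"

lemma finQ: "finite Q"
  using aut by (simp add: is_automaton_def)

lemma loop_finite: "loop A \<Longrightarrow> finite A"
  using finQ finite_subset unfolding loop_def by blast

lemma finite_loops: "finite (Collect loop)"
  by (rule finite_subset[of _ "Pow Q"]) (auto simp: loop_def finQ)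

lemma loop_path:
  assumes "loop A" "q \<in> A" "q' \<in> A"
  obtains u where "u \<noteq> []" "foldl f q u = q'" "vis f q u \<subseteq> A"
  using assms unfolding loop_def by blast

text \<open>Collect the states of \<open>A\<close> one at a time along a path that stays inside
  \<open>A\<close>, then walk to \<open>q'\<close>.\<close>

lemma loop_full:
  assumes A: "loop A" and q: "q \<in> A" and q': "q' \<in> A"
  shows "\<exists>u. u \<noteq> [] \<and> foldl f q u = q' \<and> vis f q u = A"
proof -
  have "\<exists>u. foldl f q u \<in> A \<and> B \<subseteq> vis f q u \<and> vis f q u \<subseteq> A" if "finite B" "B \<subseteq> A" for B
    using that
  proof (induction B rule: finite_induct)
    case empty
    show ?case using q by (intro exI[of _ "[]"]) simp
  next
    case (insert x B)
    then obtain u where u: "foldl f q u \<in> A" "B \<subseteq> vis f q u" "vis f q u \<subseteq> A" by auto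
    have xA: "x \<in> A" using insert.prems by simp
    obtain v where v: "v \<noteq> []" "foldl f (foldl f q u) v = x" "vis f (foldl f q u) v \<subseteq> A"
      using loop_path[OF A u(1) xA] .
    have "x \<in> vis f (foldl f q u) v" using last_vis[OF v(1)] v(2) by metis
    then show ?case using u v xA by (intro exI[of _ "u @ v"]) (auto simp: vis_append)
  qed
  from this[OF loop_finite[OF A] subset_refl] obtain u
    where u: "foldl f q u \<in> A" "A \<subseteq> vis f q u" "vis f q u \<subseteq> A" by (elim exE conjE)
  obtain v where v: "v \<noteq> []" "foldl f (foldl f q u) v = q'" "vis f (foldl f q u) v \<subseteq> A"
    using loop_path[OF A u(1) q'] .
  then show ?thesis using u by (intro exI[of _ "u @ v"]) (auto simp: vis_append)
qed

definition reach :: "nat set \<Rightarrow> nat set \<Rightarrow> bool" where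
  "reach A B \<longleftrightarrow> (\<exists>q\<in>A. \<exists>u. foldl f q u \<in> B)"

text \<open>Nodes further up end in smaller loops, which are candidates for the recurring set. A
  meet falls back to a loop containing all the loops above it.\<close>

definition inner_lists :: "nat set \<Rightarrow> nat set list set" where
  "inner_lists S = {l. l \<noteq> [] \<and> hd l = S \<and> (\<forall>A\<in>set l. loop A) \<and> sorted_wrt (\<lambda>A B. B \<subset> A) l}"

definition outer_lists :: "nat set list set" where
  "outer_lists = {l. l \<noteq> [] \<and> (\<forall>A\<in>set l. loop A) \<and> distinct l \<and> sorted_wrt reach l}"

definition tr :: "nat set \<Rightarrow> nat lforest" where
  "tr S = pforest (inner_lists S) (\<lambda>l. col (last l))"

definition FM :: "nat lforest lforest" where
  "FM = pforest outer_lists (\<lambda>l. tr (last l))"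

lemma inner_finite_sets: "\<forall>l\<in>inner_lists S. \<forall>A\<in>set l. finite A"
  by (simp add: inner_lists_def loop_finite)

lemma outer_finite_sets: "\<forall>l\<in>outer_lists. \<forall>A\<in>set l. finite A"
  by (simp add: outer_lists_def loop_finite)

lemma finite_inner: "finite (inner_lists S)"
proof (rule finite_subset[OF _ finite_subset_distinct[OF finite_loops]])
  have "distinct l" if "sorted_wrt (\<lambda>A B. B \<subset> A) l" for l :: "nat set list"
    using that by (induction l) auto
  then show "inner_lists S \<subseteq> {xs. set xs \<subseteq> Collect loop \<and> distinct xs}"
    by (auto simp: inner_lists_def)
qed

lemma finite_outer: "finite outer_lists"
  by (rule finite_subset[OF _ finite_subset_distinct[OF finite_loops]]) (auto simp: outer_lists_def)

lemma tr_tree: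
  assumes "loop S"
  shows "is_tree {..<k} (tr S)"
  unfolding tr_def
proof (rule is_tree_pforest)
  show "[S] \<in> inner_lists S" using assms by (simp add: inner_lists_def)
  show "prefix [S] l" if "l \<in> inner_lists S" for l
    using that by (cases l) (auto simp: inner_lists_def)
qed (auto simp: inner_finite_sets finite_inner col_less)

lemma FM_F_T_k:
  assumes "outer_lists \<noteq> {}"
  shows "FM \<in> F_T_k k"
proof -
  have "is_forest (T_k k) FM"
    unfolding FM_def
  proof (rule is_forest_pforest)
    show "tr (last l) \<in> T_k k" if "l \<in> outer_lists" for l
      using that tr_tree by (simp add: T_k_def outer_lists_def)
  qed (use assms in \<open>auto simp: outer_finite_sets finite_outer\<close>)
  then show ?thesis by (simp add: F_T_k_def)
qed

lemma inner_last_subset: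
  assumes "l \<in> inner_lists S"
  shows "loop (last l)" "last l \<subseteq> S"
proof -
  obtain m where m: "l = S # m" using assms by (cases l) (auto simp: inner_lists_def)
  show "loop (last l)" using assms by (simp add: inner_lists_def)
  show "last l \<subseteq> S" using assms m by (cases "m = []") (auto simp: inner_lists_def)
qed

lemma inner_prefix_last:
  assumes "l \<in> inner_lists S" "l' \<in> inner_lists S" "prefix l l'"
  shows "last l' \<subseteq> last l"
proof -
  obtain z where z: "l' = l @ z" using assms(3) by (auto simp: prefix_def)
  show ?thesis
  proof (cases "z = []")
    case False
    then have "last z \<in> set z" "last l \<in> set l" using assms by (auto simp: inner_lists_def)
    then have "last z \<subset> last l" using assms(2) z by (auto simp: inner_lists_def sorted_wrt_append)
    then show ?thesis using z False by auto
  qed (simp add: z)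
qed

section \<open>Turning sequences into words of the automaton\<close>

definition lst :: "nat \<times> nat \<Rightarrow> nat set" where
  "lst x = last (decode (snd x))"

text \<open>A fixed meeting point in the current loop; the words inserted for successive commands
  lead from one such state to the next.\<close>

definition rep :: "nat \<times> nat \<Rightarrow> nat" where
  "rep x = (SOME q. q \<in> lst x)"

lemma cmds_FM:
  assumes "x \<in> cmds FM"
  obtains l l' where "fst x = code l" "l \<in> outer_lists" "snd x = code l'" "l' \<in> inner_lists (last l)" "lst x = last l'"
    "decode (fst x) = l"
proof -
  obtain l where l: "fst x = code l" "l \<in> outer_lists" using assms by (auto simp: cmds_def FM_def pforest_simps)
  have d: "decode (code l) = l" using l outer_finite_sets decode_code by blast
  have "snd x \<in> code ` inner_lists (last l)"
    using assms l by (simp add: cmds_def FM_def pforest_simps d tr_def)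
  then obtain l' where l': "snd x = code l'" "l' \<in> inner_lists (last l)" by blast
  have "decode (code l') = l'" using l' inner_finite_sets decode_code by blast
  then have "lst x = last l'" using l' by (simp add: lst_def)
  then show thesis using that l l' d by simp
qed

lemma lst_loop: "x \<in> cmds FM \<Longrightarrow> loop (lst x)"
  using inner_last_subset by (metis cmds_FM)

lemma rep_lst: "x \<in> cmds FM \<Longrightarrow> rep x \<in> lst x"
  unfolding rep_def using lst_loop[of x] by (simp add: loop_def some_in_eq)

lemma path_between:
  assumes x: "x \<in> cmds FM" and y: "y \<in> cmds FM" and le: "(fst x, fst y) \<in> od FM"
  shows "\<exists>u. u \<noteq> [] \<and> foldl f (rep x) u = rep y"
proof -
  obtain l l' where l: "fst x = code l" "l \<in> outer_lists" "l' \<in> inner_lists (last l)" "lst x = last l'"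
    using cmds_FM[OF x] by metis
  obtain m m' where m: "fst y = code m" "m \<in> outer_lists" "m' \<in> inner_lists (last m)" "lst y = last m'"
    using cmds_FM[OF y] by metis
  have pre: "prefix l m"
    using le unfolding FM_def l(1) m(1) od_pforest[OF outer_finite_sets l(2) m(2)] .
  have rx: "rep x \<in> last l" using rep_lst[OF x] inner_last_subset[OF l(3)] l by auto
  have ry: "rep y \<in> last m" using rep_lst[OF y] inner_last_subset[OF m(3)] m by auto
  have ll: "loop (last l)" using l(2) by (simp add: outer_lists_def)
  have lm: "loop (last m)" using m(2) by (simp add: outer_lists_def)
  obtain z where z: "m = l @ z" using pre by (auto simp: prefix_def)
  show ?thesis
  proof (cases "z = []")
    case True
    then show ?thesis using loop_path[OF ll rx, of "rep y"] ry z by auto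
  next
    case False
    have "last l \<in> set l" "last z \<in> set z" using l False by (auto simp: outer_lists_def)
    then have "reach (last l) (last z)" using m(2) z by (simp add: outer_lists_def sorted_wrt_append)
    then obtain q u where u: "q \<in> last l" "foldl f q u \<in> last m" using False z by (auto simp: reach_def)
    obtain v where v: "v \<noteq> []" "foldl f (rep x) v = q" using loop_path[OF ll rx u(1)] by blast
    obtain w where w: "w \<noteq> []" "foldl f (foldl f q u) w = rep y" using loop_path[OF lm u(2) ry] by blast
    show ?thesis using v w by (intro exI[of _ "v @ u @ w"]) simp
  qed
qed

definition first_word :: "nat \<times> nat \<Rightarrow> 'x list" where
  "first_word y = (SOME u. u \<noteq> [] \<and> foldl f q0 u = rep y)"

definition next_word :: "nat \<times> nat \<Rightarrow> nat \<times> nat \<Rightarrow> 'x list" where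
  "next_word x y = (SOME u. u \<noteq> [] \<and> foldl f (rep x) u = rep y \<and>
     (fst x = fst y \<and> (lst x \<subseteq> lst y \<or> lst y \<subseteq> lst x) \<longrightarrow> vis f (rep x) u = lst x \<union> lst y))"

lemma first_word:
  assumes "y \<in> cmds FM"
  shows "first_word y \<noteq> [] \<and> foldl f q0 (first_word y) = rep y"
  unfolding first_word_def
proof (rule someI_ex)
  note lp = lst_loop[OF assms]
  obtain u where u: "foldl f q0 u \<in> lst y" using lp by (auto simp: loop_def)
  obtain v where v: "v \<noteq> []" "foldl f (foldl f q0 u) v = rep y"
    using loop_path[OF lp u rep_lst[OF assms]] by blast
  then show "\<exists>u. u \<noteq> [] \<and> foldl f q0 u = rep y" by (intro exI[of _ "u @ v"]) simp
qed

text \<open>The union of two nested loops is the larger of them, hence a loop that can be toured in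
  full from one chosen state to the other. In the remaining cases only a connecting path is
  required.\<close>

lemma next_word:
  assumes x: "x \<in> cmds FM" and y: "y \<in> cmds FM" and le: "(fst x, fst y) \<in> od FM"
  shows "next_word x y \<noteq> [] \<and> foldl f (rep x) (next_word x y) = rep y \<and>
     (fst x = fst y \<and> (lst x \<subseteq> lst y \<or> lst y \<subseteq> lst x) \<longrightarrow> vis f (rep x) (next_word x y) = lst x \<union> lst y)"
  unfolding next_word_def
proof (rule someI_ex)
  show "\<exists>u. u \<noteq> [] \<and> foldl f (rep x) u = rep y \<and>
     (fst x = fst y \<and> (lst x \<subseteq> lst y \<or> lst y \<subseteq> lst x) \<longrightarrow> vis f (rep x) u = lst x \<union> lst y)"
  proof (cases "lst x \<subseteq> lst y \<or> lst y \<subseteq> lst x")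
    case True
    then have "lst x \<union> lst y = lst x \<or> lst x \<union> lst y = lst y" by blast
    then have "loop (lst x \<union> lst y)" using lst_loop[OF x] lst_loop[OF y] by auto
    then show ?thesis using loop_full[of "lst x \<union> lst y" "rep x" "rep y"] rep_lst[OF x] rep_lst[OF y] by auto
  next
    case False
    then show ?thesis using path_between[OF assms] by blast
  qed
qed

definition traverse :: "(nat \<Rightarrow> nat \<times> nat) \<Rightarrow> nat \<Rightarrow> 'x list" where
  "traverse r n = (case n of 0 \<Rightarrow> first_word (r 0) | Suc m \<Rightarrow> next_word (r m) (r (Suc m)))"

text \<open>Refinement is applied first because it makes consecutive loops nested, once the outer
  node is constant, and makes the limit meet recur.\<close>

definition encM :: "(nat \<Rightarrow> nat \<times> nat) \<Rightarrow> 'x oword" where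
  "encM s = iconcat (traverse (refine FM s))"

context
  assumes outer_ne: "outer_lists \<noteq> {}"
begin

lemmas FM = FM_F_T_k[OF outer_ne]

lemma traverse_ne:
  assumes "r \<in> seqs FM"
  shows "traverse r n \<noteq> []"
proof (cases n)
  case 0
  then show ?thesis using first_word seqs_cmds[OF FM assms] by (simp add: traverse_def)
next
  case (Suc m)
  have "(fst (r m), fst (r (Suc m))) \<in> od FM" using assms by (simp add: seqs_def)
  then show ?thesis using Suc next_word seqs_cmds[OF FM assms] by (simp add: traverse_def)
qed

lemma traverse_state:
  assumes r: "r \<in> seqs FM"
  shows "foldl f q0 (concat (map (traverse r) [0..<Suc n])) = rep (r n)"
proof (induction n)
  case 0
  then show ?case using first_word[OF seqs_cmds[OF FM r]] by (simp add: traverse_def)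
next
  case (Suc n)
  have le: "(fst (r n), fst (r (Suc n))) \<in> od FM" using r by (simp add: seqs_def)
  have "foldl f q0 (concat (map (traverse r) [0..<Suc (Suc n)])) = foldl f (rep (r n)) (traverse r (Suc n))"
    using Suc.IH by simp
  also have "\<dots> = rep (r (Suc n))"
    using next_word[OF seqs_cmds[OF FM r] seqs_cmds[OF FM r] le] by (simp add: traverse_def)
  finally show ?case .
qed

lemma od_inner_lst:
  assumes x: "x \<in> cmds FM" and t: "(t, snd x) \<in> od (lb FM (fst x))"
  shows "lst x \<subseteq> last (decode t)"
proof -
  obtain l l' where l: "l \<in> outer_lists" "snd x = code l'" "l' \<in> inner_lists (last l)" "lst x = last l'" "decode (fst x) = l"
    using cmds_FM[OF x] by metis
  have tl: "(t, code l') \<in> od (tr (last l))" using t l by (simp add: FM_def pforest_simps)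
  obtain m where m: "t = code m" "m \<in> inner_lists (last l)"
    using od_pforestE[OF tl[unfolded tr_def]] by blast
  have "prefix m l'"
    using tl unfolding m(1) tr_def od_pforest[OF inner_finite_sets m(2) l(3)] .
  moreover have "decode (code m) = m" using m inner_finite_sets decode_code by blast
  ultimately show ?thesis using inner_prefix_last[OF m(2) l(3)] l(4) m(1) by simp
qed

text \<open>Once the outer node is constant, every block visits exactly the union of two nested
  loops. All these loops lie in the last loop \<open>?A\<close> of the limit meet; as the meet
  recurs, \<open>?A\<close> is toured again and again and is the recurring set.\<close>

lemma encM_colour:
  assumes s: "s \<in> seqs FM"
  shows "L (encM s) = colr FM s"
proof -
  let ?r = "refine FM s"
  let ?p = "fin s" and ?t = "mt FM s"
  let ?A = "last (decode ?t)"
  let ?v = "\<lambda>n. vis f (foldl f q0 (concat (map (traverse ?r) [0..<n]))) (traverse ?r n)"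
  note r = refine_seqs[OF FM s]
  note c = seqs_cmds[OF FM r]
  obtain N where N: "\<And>n. n \<ge> N \<Longrightarrow> fst (?r n) = ?p \<and> (?t, snd (?r n)) \<in> od (lb FM ?p)"
    using eventually_conj[OF refine_fin_ev[OF FM s] refine_mt_ev[OF FM s]] unfolding MOST_nat_le by blast
  have v: "?v (Suc n) = lst (?r n) \<union> lst (?r (Suc n))" if "n \<ge> N" for n
  proof -
    have le: "(fst (?r n), fst (?r (Suc n))) \<in> od FM" using r by (simp add: seqs_def)
    have eq: "fst (?r n) = fst (?r (Suc n))" using N[of n] N[of "Suc n"] that by simp
    have "lst (?r n) \<subseteq> lst (?r (Suc n)) \<or> lst (?r (Suc n)) \<subseteq> lst (?r n)"
      using refine_comparable[OF FM s eq]
    proof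
      assume "(snd (?r n), snd (?r (Suc n))) \<in> od (lb FM (fst (?r n)))"
      then have "lst (?r (Suc n)) \<subseteq> lst (?r n)"
        using od_inner_lst[OF c, of "snd (?r n)" "Suc n"] eq by (simp add: lst_def)
      then show ?thesis by blast
    next
      assume "(snd (?r (Suc n)), snd (?r n)) \<in> od (lb FM (fst (?r n)))"
      then have "lst (?r n) \<subseteq> lst (?r (Suc n))"
        using od_inner_lst[OF c, of "snd (?r (Suc n))" n] by (simp add: lst_def)
      then show ?thesis by blast
    qed
    then have "vis f (rep (?r n)) (next_word (?r n) (?r (Suc n))) = lst (?r n) \<union> lst (?r (Suc n))"
      using next_word[OF c c le] eq by blast
    then show ?thesis unfolding traverse_state[OF r] by (simp add: traverse_def)
  qed
  have sub: "lst (?r n) \<subseteq> ?A" if "n \<ge> N" for n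
    using od_inner_lst[OF c, of ?t n] N[OF that] by simp
  have "inf_states f q0 (encM s) = {q. \<exists>\<^sub>\<infinity>n. q \<in> ?v n}"
    unfolding encM_def by (rule inf_states_iconcat) (rule traverse_ne[OF r])
  also have "\<dots> = ?A"
  proof (intro set_eqI iffI)
    fix q assume "q \<in> {q. \<exists>\<^sub>\<infinity>n. q \<in> ?v n}"
    then have "\<exists>n\<ge>Suc N. q \<in> ?v n" unfolding INFM_nat_le by blast
    then obtain n where n: "n \<ge> Suc N" "q \<in> ?v n" by blast
    then obtain m where m: "n = Suc m" "m \<ge> N" by (cases n) auto
    then have "q \<in> lst (?r m) \<union> lst (?r (Suc m))" using n v by blast
    then show "q \<in> ?A" using sub[of m] sub[of "Suc m"] m by auto
  next
    fix q assume q: "q \<in> ?A"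
    show "q \<in> {q. \<exists>\<^sub>\<infinity>n. q \<in> ?v n}"
      unfolding INFM_nat_le
    proof (rule CollectI, rule allI)
      fix M
      obtain n where n: "n \<ge> max M N" "snd (?r n) = ?t"
        using refine_mt_io[OF FM s] unfolding INFM_nat_le by blast
      then have "lst (?r n) = ?A" by (simp add: lst_def)
      then have "q \<in> ?v (Suc n)" using v[of n] n q by simp
      moreover have "Suc n \<ge> M" using n by simp
      ultimately show "\<exists>n\<ge>M. q \<in> ?v n" by blast
    qed
  qed
  finally have "L (encM s) = col ?A" using col_inf by metis
  also have "\<dots> = colr FM s" by (simp add: colr_def FM_def pforest_simps tr_def)
  finally show ?thesis .
qed

lemma encM_seqcont: "seqcont D encM"
proof -
  have t: "seqcont E traverse" for E
    unfolding seqcont_def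
  proof (intro ballI allI)
    fix r n
    show "\<exists>m. \<forall>r'\<in>E. (\<forall>i<m. r' i = r i) \<longrightarrow> traverse r' n = traverse r n"
      by (intro exI[of _ "Suc n"]) (simp add: traverse_def split: nat.split)
  qed
  have "seqcont D (\<lambda>s. traverse (refine FM s))"
    by (rule seqcont_comp[OF refine_seqcont[OF FM] t[of UNIV]]) simp
  then show ?thesis unfolding encM_def by (rule seqcont_iconcat)
qed

end

end

subsection \<open>Following a run by strongly connected components and hit sets\<close>

context determining_automaton
begin

text \<open>Paths have to be nonempty, so a state on no cycle has the empty class;
  \<open>chain\<close> and \<open>stack\<close> ignore such states.\<close>

definition scc :: "nat \<Rightarrow> nat set" where
  "scc q = {q'. (\<exists>u. u \<noteq> [] \<and> foldl f q u = q') \<and> (\<exists>v. v \<noteq> [] \<and> foldl f q' v = q)}"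

lemma sccI: "u \<noteq> [] \<Longrightarrow> foldl f q u = q' \<Longrightarrow> v \<noteq> [] \<Longrightarrow> foldl f q' v = q \<Longrightarrow> q' \<in> scc q"
  unfolding scc_def by blast

lemma scc_self:
  assumes "scc q \<noteq> {}"
  shows "q \<in> scc q"
proof -
  obtain q' u v where "u \<noteq> []" "foldl f q u = q'" "v \<noteq> []" "foldl f q' v = q"
    using assms unfolding scc_def by blast
  then show ?thesis by (intro sccI[of "u @ v" _ _ "u @ v"]) simp_all
qed

lemma scc_subset:
  assumes u: "u \<noteq> []" "foldl f q u = q'" and v: "v \<noteq> []" "foldl f q' v = q"
  shows "scc q \<subseteq> scc q'"
proof
  fix x assume "x \<in> scc q"
  then obtain w w' where w: "w \<noteq> []" "foldl f q w = x" "w' \<noteq> []" "foldl f x w' = q"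
    unfolding scc_def by blast
  show "x \<in> scc q'"
    by (rule sccI[of "v @ w" _ _ "w' @ u"]) (use u v w in simp_all)
qed

lemma scc_eq:
  assumes u: "u \<noteq> []" "foldl f q u = q'" and v: "v \<noteq> []" "foldl f q' v = q"
  shows "scc q = scc q'"
  using scc_subset[OF u v] scc_subset[OF v u] by blast

lemma scc_loop:
  assumes ne: "scc q \<noteq> {}" and reach: "foldl f q0 w = q"
  shows "loop (scc q)"
  unfolding loop_def
proof (intro conjI ballI)
  show "scc q \<noteq> {}" by (rule ne)
  show "\<exists>u. foldl f q0 u \<in> scc q" using scc_self[OF ne] reach by blast
  have Q: "foldl f q u \<in> Q" if "q \<in> Q" for q u
    using that aut by (induction u arbitrary: q) (auto simp: is_automaton_def)
  have "q \<in> Q" using Q[of q0 w] reach aut by (simp add: is_automaton_def)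
  then show "scc q \<subseteq> Q" using Q unfolding scc_def by blast
  fix x y assume x: "x \<in> scc q" and y: "y \<in> scc q"
  obtain a a' where a: "a \<noteq> []" "foldl f q a = x" "a' \<noteq> []" "foldl f x a' = q"
    using x unfolding scc_def by blast
  obtain b b' where b: "b \<noteq> []" "foldl f q b = y" "b' \<noteq> []" "foldl f y b' = q"
    using y unfolding scc_def by blast
  have "vis f x (a' @ b) \<subseteq> scc q"
  proof
    fix z assume "z \<in> vis f x (a' @ b)"
    then obtain j where j: "j < length (a' @ b)" "z = foldl f x (take (Suc j) (a' @ b))"
      unfolding vis_eq by blast
    have "foldl f (foldl f x (take (Suc j) (a' @ b))) (drop (Suc j) (a' @ b)) = y"
      by (metis a(4) b(2) append_take_drop_id foldl_append)
    then have "foldl f z (drop (Suc j) (a' @ b) @ b') = q" using j b by simp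
    moreover have "foldl f q (a @ take (Suc j) (a' @ b)) = z" using a j by simp
    ultimately show "z \<in> scc q"
      by (intro sccI[of "a @ take (Suc j) (a' @ b)" _ _ "drop (Suc j) (a' @ b) @ b'"]) (use a b in simp_all)
  qed
  then show "\<exists>u. u \<noteq> [] \<and> foldl f x u = y \<and> vis f x u \<subseteq> scc q"
    using a b by (intro exI[of _ "a' @ b"]) simp
qed

primrec chain :: "(nat \<Rightarrow> nat) \<Rightarrow> nat \<Rightarrow> nat set list" where
  "chain r 0 = []"
| "chain r (Suc n) = (if scc (r n) = {} \<or> chain r n \<noteq> [] \<and> last (chain r n) = scc (r n) then chain r n
     else chain r n @ [scc (r n)])"

text \<open>The cycle closed at time \<open>n\<close>, from the previous visit of
  \<open>r n\<close>. On a first visit there is none and the component serves as a default: if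
  nonempty it is a loop, and first visits are finite in number.\<close>

definition hit :: "(nat \<Rightarrow> nat) \<Rightarrow> nat \<Rightarrow> nat set" where
  "hit r n = (if \<exists>l<n. r l = r n then r ` {Max {l. l < n \<and> r l = r n}<..n} else scc (r n))"

text \<open>Keeps the initial entries that contain \<open>H\<close> and lets the list end in
  \<open>H\<close> without duplicating it. On the stacks used here the first entry contains
  \<open>H\<close>, so \<open>last pre\<close> is taken of a nonempty list.\<close>

definition push :: "nat set \<Rightarrow> nat set list \<Rightarrow> nat set list" where
  "push H l = (let pre = takeWhile (\<lambda>A. H \<subseteq> A) l in if last pre = H then pre else pre @ [H])"

primrec stack :: "(nat \<Rightarrow> nat) \<Rightarrow> nat \<Rightarrow> nat set list" where
  "stack r 0 = []"
| "stack r (Suc n) = (if scc (r n) = {} then stack r n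
     else if chain r n = [] \<or> last (chain r n) \<noteq> scc (r n) then [scc (r n)]
     else push (hit r n) (stack r n))"

lemma hit_cong:
  assumes "\<forall>i\<le>n. r' i = r i"
  shows "hit r' n = hit r n"
proof -
  have 1: "{l. l < n \<and> r' l = r' n} = {l. l < n \<and> r l = r n}" using assms by auto
  have 2: "r' ` {m<..n} = r ` {m<..n}" for m using assms by (intro image_cong) auto
  have 3: "(\<exists>l<n. r' l = r' n) = (\<exists>l<n. r l = r n)" using assms by (metis less_imp_le order_refl)
  show ?thesis unfolding hit_def 1 2 3 using assms by auto
qed

lemma chain_stack_cong:
  assumes "\<forall>i<n. r' i = r i"
  shows "chain r' n = chain r n \<and> stack r' n = stack r n"
  using assms
proof (induction n)
  case (Suc n)
  then have "chain r' n = chain r n \<and> stack r' n = stack r n" by simp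
  moreover have "hit r' n = hit r n" using Suc.prems by (intro hit_cong) simp
  ultimately show ?case using Suc.prems by simp
qed simp

section \<open>Chains and stacks along a fixed run\<close>

context
  fixes \<xi> :: "'x oword" and r :: "nat \<Rightarrow> nat"
  assumes r: "r = run f q0 \<xi>"
begin

lemma run_path: "i \<le> j \<Longrightarrow> foldl f (r i) (map \<xi> [i..<j]) = r j"
  unfolding r by (induction j rule: dec_induct) (simp_all add: run_Suc)

lemma run_reach: "foldl f q0 (map \<xi> [0..<j]) = r j"
  using run_path[of 0 j] by (simp add: r run_0)

lemma vis_run: "i \<le> j \<Longrightarrow> vis f (r i) (map \<xi> [i..<j]) = r ` {i<..j}"
proof (induction j rule: dec_induct)
  case (step j)
  have "{i<..Suc j} = insert (Suc j) {i<..j}" using step by auto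
  moreover have "f (r j) (\<xi> j) = r (Suc j)" by (simp add: r run_Suc)
  ultimately show ?case using step run_path[of i j] by (simp add: vis_append)
qed simp

lemma r_Q: "r n \<in> Q"
  unfolding r by (rule run_in[OF aut])

lemma r_scc:
  assumes "i < j" "r i = r j"
  shows "r i \<in> scc (r i)"
  using run_path[of i j] assms by (intro sccI[of "map \<xi> [i..<j]" _ _ "map \<xi> [i..<j]"]) auto

lemma chain_loops: "A \<in> set (chain r n) \<Longrightarrow> loop A \<and> (\<exists>j<n. A = scc (r j))"
proof (induction n)
  case (Suc n)
  show ?case
  proof (cases "A \<in> set (chain r n)")
    case True
    then show ?thesis using Suc.IH by (meson less_SucI)
  next
    case False
    then have "A = scc (r n)" "scc (r n) \<noteq> {}" using Suc.prems by (auto split: if_splits)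
    then show ?thesis using scc_loop run_reach by blast
  qed
qed simp

text \<open>Each state between times \<open>j\<close> and \<open>n\<close> is reached from
  \<open>r j\<close> and leads back to it, so it belongs to the same component and nothing is
  appended.\<close>

lemma chain_last:
  assumes "j < n" "scc (r j) \<noteq> {}" "foldl f (r n) u = r j"
  shows "chain r n \<noteq> [] \<and> last (chain r n) = scc (r j)"
  using assms
proof (induction n arbitrary: u)
  case (Suc n)
  have bwd: "foldl f (r n) (\<xi> n # u) = r j" using Suc.prems(3) by (simp add: r run_Suc)
  show ?case
  proof (cases "j = n")
    case True
    then show ?thesis using Suc.prems(2) by simp
  next
    case False
    then have j: "j < n" using Suc.prems(1) by simp
    have IH: "chain r n \<noteq> [] \<and> last (chain r n) = scc (r j)" by (rule Suc.IH[OF j Suc.prems(2) bwd])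
    have "scc (r n) = scc (r j)"
      by (rule scc_eq[OF _ bwd, of "map \<xi> [j..<n]"]) (use run_path[of j n] j in auto)
    then show ?thesis using IH by simp
  qed
qed simp

text \<open>A component that has been left is never entered again, since a way back would have kept
  it last in the chain; this gives distinctness, and the run itself witnesses reachability.\<close>

lemma chain_outer: "distinct (chain r n) \<and> sorted_wrt (reach) (chain r n)"
proof (induction n)
  case (Suc n)
  show ?case
  proof (cases "scc (r n) = {} \<or> chain r n \<noteq> [] \<and> last (chain r n) = scc (r n)")
    case False
    then have ne: "scc (r n) \<noteq> {}" and last: "chain r n = [] \<or> last (chain r n) \<noteq> scc (r n)" by auto
    have "scc (r n) \<notin> set (chain r n)"
    proof
      assume "scc (r n) \<in> set (chain r n)"
      then obtain j where j: "j < n" "scc (r n) = scc (r j)" using chain_loops by blast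
      then have "r j \<in> scc (r n)" using scc_self[of "r j"] ne by simp
      then obtain u where "foldl f (r n) u = r j" unfolding scc_def by blast
      then show False using chain_last[OF j(1)] j(2) ne last by simp
    qed
    moreover have "reach A (scc (r n))" if A: "A \<in> set (chain r n)" for A
    proof -
      obtain j where j: "j < n" "A = scc (r j)" "A \<noteq> {}"
        using chain_loops[OF A] by (auto simp: loop_def)
      then have "r j \<in> A" using scc_self[of "r j"] by simp
      moreover have "foldl f (r j) (map \<xi> [j..<n]) \<in> scc (r n)"
        using run_path[of j n] j scc_self[OF ne] by simp
      ultimately show ?thesis unfolding reach_def by blast
    qed
    ultimately show ?thesis using Suc.IH False by (auto simp: sorted_wrt_append)
  qed (use Suc.IH in auto)
qed simp

lemma chain_prefix: "i \<le> j \<Longrightarrow> prefix (chain r i) (chain r j)"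
proof (induction j rule: dec_induct)
  case (step j)
  have "prefix (chain r j) (chain r (Suc j))" by simp
  then show ?case using step.IH prefix_order.trans by blast
qed simp

text \<open>Pigeonhole: one of the first \<open>card Q + 1\<close> states repeats and thus has a
  nonempty component. This is the origin of the offset in \<open>trace\<close>; the empty chain is
  not a node of the forest.\<close>

lemma chain_nonempty:
  assumes "card Q \<le> n"
  shows "chain r n \<noteq> []"
proof -
  have "finite Q" using aut by (simp add: is_automaton_def)
  then have "card (r ` {..card Q}) \<le> card Q" using r_Q by (intro card_mono) auto
  then have "\<not> inj_on r {..card Q}" by (metis Suc_n_not_le_n card_atMost card_image)
  then obtain i j where ij: "i < j" "j \<le> card Q" "r i = r j"
    unfolding inj_on_def by (metis atMost_iff nat_neq_iff)
  then have "scc (r i) \<noteq> {}" using r_scc by blast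
  then have "chain r (Suc i) \<noteq> []" by auto
  moreover have "prefix (chain r (Suc i)) (chain r n)" using ij assms by (intro chain_prefix) simp
  ultimately show ?thesis by auto
qed

text \<open>The stretch since the previous visit of \<open>r n\<close> is a closed walk, so any two
  of its states are connected by going round it.\<close>

lemma hit_loop:
  assumes ne: "scc (r n) \<noteq> {}"
  shows "loop (hit r n) \<and> hit r n \<subseteq> scc (r n)"
proof (cases "\<exists>l<n. r l = r n")
  case False
  then have "hit r n = scc (r n)" unfolding hit_def by (rule if_not_P)
  then show ?thesis using scc_loop[OF ne run_reach] by simp
next
  case True
  define l where "l = Max {l. l < n \<and> r l = r n}"
  have l: "l < n" "r l = r n" using Max_in[of "{l. l < n \<and> r l = r n}"] True by (auto simp: l_def)
  have h: "hit r n = r ` {l<..n}" unfolding hit_def l_def using True by (rule if_P)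
  have sub: "hit r n \<subseteq> scc (r n)"
  proof
    fix x assume "x \<in> hit r n"
    then obtain i where i: "l < i" "i \<le> n" "x = r i" unfolding h by auto
    show "x \<in> scc (r n)"
      by (rule sccI[of "map \<xi> [l..<i]" _ _ "map \<xi> [i..<n] @ map \<xi> [l..<n]"])
         (use run_path[of l i] run_path[of i n] run_path[of l n] i l in auto)
  qed
  have "loop (hit r n)"
    unfolding loop_def
  proof (intro conjI ballI)
    show "hit r n \<noteq> {}" "hit r n \<subseteq> Q" using l r_Q unfolding h by auto
    have "r n \<in> hit r n" unfolding h using l by simp
    then show "\<exists>u. foldl f q0 u \<in> hit r n" using run_reach[of n] by metis
    fix x y assume "x \<in> hit r n" "y \<in> hit r n"
    then obtain i j where ij: "l < i" "i \<le> n" "x = r i" "l < j" "j \<le> n" "y = r j" unfolding h by auto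
    let ?u = "map \<xi> [i..<n] @ map \<xi> [l..<j]"
    have "?u \<noteq> []" using ij by simp
    moreover have "foldl f x ?u = y" using ij l run_path[of i n] run_path[of l j] by simp
    moreover have "vis f x ?u = r ` {i<..n} \<union> r ` {l<..j}"
      using ij l run_path[of i n] vis_run[of i n] vis_run[of l j] by (simp add: vis_append)
    moreover have "r ` {i<..n} \<union> r ` {l<..j} \<subseteq> hit r n" unfolding h using ij by auto
    ultimately show "\<exists>u. u \<noteq> [] \<and> foldl f x u = y \<and> vis f x u \<subseteq> hit r n" by metis
  qed
  then show ?thesis using sub by blast
qed

lemma push_inner:
  assumes l: "l \<in> inner_lists S" and H: "loop H" "H \<subseteq> S"
  shows "push H l \<in> inner_lists S"
proof -
  define pre where "pre = takeWhile (\<lambda>A. H \<subseteq> A) l"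
  obtain m where m: "l = S # m" using l by (cases l) (auto simp: inner_lists_def)
  have pre_ne: "pre \<noteq> []" "hd pre = S" using m H by (auto simp: pre_def)
  have "l = pre @ dropWhile (\<lambda>A. H \<subseteq> A) l" by (simp add: pre_def)
  then have "sorted_wrt (\<lambda>A B. B \<subset> A) (pre @ dropWhile (\<lambda>A. H \<subseteq> A) l)"
    using l by (simp add: inner_lists_def)
  then have sorted: "sorted_wrt (\<lambda>A B. B \<subset> A) pre" unfolding sorted_wrt_append by blast
  have loops: "\<forall>A\<in>set pre. loop A" using l set_takeWhileD by (fastforce simp: pre_def inner_lists_def)
  have sup: "H \<subseteq> A" if "A \<in> set pre" for A using that set_takeWhileD by (fastforce simp: pre_def)
  show ?thesis
  proof (cases "last pre = H")
    case True
    then have "push H l = pre" by (simp add: push_def pre_def)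
    then show ?thesis using pre_ne sorted loops by (simp add: inner_lists_def)
  next
    case False
    then have p: "push H l = pre @ [H]" by (simp add: push_def pre_def Let_def)
    \<comment> \<open>Containment is strict at the last kept entry, and the entries before it are
      larger still.\<close>
    have "H \<subset> A" if A: "A \<in> set pre" for A
    proof -
      obtain b where b: "pre = b @ [last pre]" using pre_ne by (metis append_butlast_last_id)
      have "sorted_wrt (\<lambda>A B. B \<subset> A) (b @ [last pre])" using sorted b by simp
      then have "\<forall>B\<in>set b. last pre \<subset> B" by (simp add: sorted_wrt_append)
      moreover have "A \<in> set b \<or> A = last pre" using A b by (metis Un_iff empty_iff empty_set insert_iff list.simps(15) set_append)
      moreover have "H \<subset> last pre" using sup[of "last pre"] False pre_ne by auto
      ultimately show ?thesis by auto
    qed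
    then show ?thesis unfolding p using pre_ne sorted loops H(1)
      by (auto simp: inner_lists_def sorted_wrt_append)
  qed
qed

lemma stack_inner: "chain r n \<noteq> [] \<Longrightarrow> stack r n \<in> inner_lists (last (chain r n))"
proof (induction n)
  case (Suc n)
  consider "scc (r n) = {}" | "scc (r n) \<noteq> {}" "chain r n = [] \<or> last (chain r n) \<noteq> scc (r n)"
    | "scc (r n) \<noteq> {}" "chain r n \<noteq> []" "last (chain r n) = scc (r n)" by blast
  then show ?case
  proof cases
    case 1
    then show ?thesis using Suc by simp
  next
    case 2
    then show ?thesis using scc_loop[OF _ run_reach] by (auto simp: inner_lists_def)
  next
    case 3
    then show ?thesis using push_inner[OF Suc.IH[OF 3(2)]] hit_loop[OF 3(1)] by simp
  qed
qed simp

end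

declare chain.simps(2) [simp del] and stack.simps(2) [simp del]

definition trace :: "'x oword \<Rightarrow> nat \<Rightarrow> nat \<times> nat" where
  "trace \<xi> n = (code (chain (run f q0 \<xi>) (n + card Q)), code (stack (run f q0 \<xi>) (n + card Q)))"

lemma chain_in_outer: "card Q \<le> n \<Longrightarrow> chain (run f q0 \<xi>) n \<in> outer_lists"
  unfolding outer_lists_def
  using chain_nonempty[OF refl] chain_outer[OF refl] chain_loops[OF refl] by blast

lemma outer_nonempty: "outer_lists \<noteq> {}"
  using chain_in_outer[of "card Q"] by blast

lemmas FM_forest = FM_F_T_k[OF outer_nonempty]

lemma lb_forest:
  assumes "l \<in> outer_lists"
  shows "lb FM (code l) = tr (last l)"
  unfolding FM_def pforest_simps
  using decode_code[OF bspec[OF outer_finite_sets assms]] by simp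

lemma trace_seqs: "trace \<xi> \<in> seqs FM"
  unfolding seqs_def
proof (rule CollectI, rule allI)
  fix n
  let ?r = "run f q0 \<xi>"
  have c: "chain ?r (n + card Q) \<in> outer_lists" "chain ?r (Suc n + card Q) \<in> outer_lists"
    by (rule chain_in_outer, simp)+
  have s: "stack ?r (n + card Q) \<in> inner_lists (last (chain ?r (n + card Q)))"
    by (rule stack_inner[OF refl]) (rule chain_nonempty[OF refl], simp)
  have "fst (trace \<xi> n) \<in> nd FM"
    using c(1) by (simp add: trace_def FM_def pforest_simps(1))
  moreover have "snd (trace \<xi> n) \<in> nd (lb FM (fst (trace \<xi> n)))"
    using s by (simp add: trace_def lb_forest[OF c(1)] tr_def pforest_simps(1))
  ultimately have "trace \<xi> n \<in> cmds FM" by (simp add: cmds_def)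
  moreover have "(fst (trace \<xi> n), fst (trace \<xi> (Suc n))) \<in> od FM"
    unfolding trace_def fst_conv FM_def od_pforest[OF outer_finite_sets c]
    by (rule chain_prefix[OF refl]) simp
  ultimately show "trace \<xi> n \<in> cmds FM \<and> (fst (trace \<xi> n), fst (trace \<xi> (Suc n))) \<in> od FM" by blast
qed

lemma trace_seqcont: "seqcont UNIV trace"
  unfolding seqcont_def
proof (intro ballI allI)
  fix \<xi> n
  have "trace \<xi>' n = trace \<xi> n" if eq: "\<forall>i<n + card Q. \<xi>' i = \<xi> i" for \<xi>'
  proof -
    have "\<forall>i<n + card Q. run f q0 \<xi>' i = run f q0 \<xi> i"
    proof (intro allI impI)
      fix i assume "i < n + card Q"
      then have "map \<xi>' [0..<i] = map \<xi> [0..<i]" using eq by (intro map_cong) auto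
      then show "run f q0 \<xi>' i = run f q0 \<xi> i" by (simp only: run_def)
    qed
    from chain_stack_cong[OF this] show ?thesis by (simp add: trace_def)
  qed
  then show "\<exists>m. \<forall>\<xi>'\<in>UNIV. (\<forall>i<m. \<xi>' i = \<xi> i) \<longrightarrow> trace \<xi>' n = trace \<xi> n" by blast
qed

text \<open>All entries up to \<open>I\<close> contain \<open>H\<close> and therefore survive. The
  entries after \<open>I\<close> are strictly smaller, so pushing \<open>I\<close> itself discards
  every one of them.\<close>

lemma push_above:
  assumes l: "sorted_wrt (\<lambda>A B. B \<subset> A) (base @ rest)" and base: "base \<noteq> []" "last base = I" "\<forall>A\<in>set base. I \<subseteq> A"
    and H: "H \<subseteq> I"
  shows "prefix base (push H (base @ rest))" "H = I \<Longrightarrow> push H (base @ rest) = base"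
proof -
  have tw: "takeWhile (\<lambda>A. H \<subseteq> A) (base @ rest) = base @ takeWhile (\<lambda>A. H \<subseteq> A) rest"
    by (rule takeWhile_append2) (use base H in blast)
  show "prefix base (push H (base @ rest))" unfolding push_def tw by (simp add: Let_def)
  assume HI: "H = I"
  have "I \<in> set base" using base(1,2) by auto
  then have "\<forall>B\<in>set rest. B \<subset> I" using l unfolding sorted_wrt_append by blast
  then have "takeWhile (\<lambda>A. H \<subseteq> A) rest = []" using HI by (cases rest) auto
  then show "push H (base @ rest) = base" unfolding push_def tw using base HI by simp
qed

text \<open>Once only the states of the infinity set \<open>I\<close> occur, every hit set is contained in \<open>I\<close>, and it equals \<open>I\<close>
  whenever the state which has not been seen for the longest time recurs. Hence the stack keeps the part
  ending in \<open>I\<close> forever and is infinitely often cut down to it.\<close>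

lemma trace_colour: "colr FM (trace \<xi>) = L \<xi>"
proof -
  define r where "r = run f q0 \<xi>"
  define I where "I = inf_states f q0 \<xi>"
  have "range r \<subseteq> Q" using r_Q[OF r_def] by blast
  moreover have finQ: "finite Q" using aut by (simp add: is_automaton_def)
  ultimately have fin: "finite (range r)" by (rule finite_subset)
  have I: "I = inf_set r" by (simp add: I_def r_def inf_states_eq)
  have finI: "finite I"
    by (rule finite_subset[OF _ fin]) (auto simp: I inf_set_def dest!: frequently_ex)
  obtain n0 where n0: "\<And>n. n \<ge> n0 \<Longrightarrow> r n \<in> I"
    using ev_in_inf_set[OF fin] unfolding I MOST_nat_le by blast
  have rec: "\<exists>n\<ge>m. r n = q" if "q \<in> I" for q m
    using that unfolding I inf_set_def INFM_nat_le by blast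
  have recS: "\<exists>n>m. r n = q" if "q \<in> I" for q m
    using rec[OF that, of "Suc m"] by (auto simp: Suc_le_eq)
  have "\<forall>\<^sub>\<infinity>n. \<forall>q\<in>I. \<exists>l\<ge>n0. l < n \<and> r l = q"
  proof (rule eventually_ball_finite[OF finI], rule ballI)
    fix q assume "q \<in> I"
    then obtain l where l: "l \<ge> n0" "r l = q" using rec by blast
    then have "\<forall>n\<ge>Suc l. \<exists>l\<ge>n0. l < n \<and> r l = q" by (auto intro!: exI[of _ l])
    then show "\<forall>\<^sub>\<infinity>n. \<exists>l\<ge>n0. l < n \<and> r l = q" unfolding MOST_nat_le by blast
  qed
  \<comment> \<open>From \<open>n1\<close> on, the previous visit of the current state happened at
    \<open>n0\<close> or later, so hit sets consist of states of \<open>I\<close> and the default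
    value of \<open>hit\<close> no longer occurs.\<close>
  then obtain n1 where n1: "\<And>n q. n \<ge> n1 \<Longrightarrow> q \<in> I \<Longrightarrow> \<exists>l\<ge>n0. l < n \<and> r l = q"
    unfolding MOST_nat_le by blast
  define S where "S = scc (r n0)"
  have scc_S: "scc (r n) = S" if n: "n \<ge> n0" for n
  proof -
    obtain m where m: "m > n" "r m = r n0" using recS[OF n0[of n0]] by blast
    obtain m' where m': "m' > n0" "r m' = r n" using recS[OF n0[OF n]] by blast
    show ?thesis unfolding S_def
      by (rule scc_eq[of "map \<xi> [n..<m]" _ _ "map \<xi> [n0..<m']"])
         (use m m' run_path[OF r_def, of n m] run_path[OF r_def, of n0 m'] in auto)
  qed
  have S_ne: "S \<noteq> {}"
    using recS[OF n0[of n0], of n0] r_scc[OF r_def, of n0] unfolding S_def by (metis empty_iff order_refl)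
  define C where "C = chain r (Suc n0)"
  have C_last: "C \<noteq> []" "last C = S"
    using S_ne by (auto simp: C_def S_def chain.simps(2))
  have chain_C: "chain r n = C" if "n > n0" for n
  proof -
    have "Suc n0 \<le> n" using that by simp
    then show ?thesis
    proof (induction n rule: dec_induct)
      case (step n)
      then show ?case using scc_S[of n] C_last by (simp add: chain.simps(2))
    qed (simp add: C_def)
  qed
  have n01: "n0 < n1"
    using n1[of n1 "r n0"] n0[of n0] by auto
  have stack_Suc: "stack r (Suc n) = push (hit r n) (stack r n)" if "n \<ge> n1" for n
    using that n01 chain_C[of n] scc_S[of n] C_last S_ne by (simp add: stack.simps(2))
  have hit_eq: "hit r n = r ` {Max {l. l < n \<and> r l = r n}<..n}" "n0 \<le> Max {l. l < n \<and> r l = r n}"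
    if n: "n \<ge> n1" for n
  proof -
    obtain l where l: "l \<ge> n0" "l < n" "r l = r n" using n1[OF n n0[of n]] n n01 by auto
    then have "\<exists>l<n. r l = r n" by blast
    then show "hit r n = r ` {Max {l. l < n \<and> r l = r n}<..n}" unfolding hit_def by (rule if_P)
    have "l \<le> Max {l. l < n \<and> r l = r n}" using l by (intro Max_ge) auto
    with l(1) show "n0 \<le> Max {l. l < n \<and> r l = r n}" by (rule le_trans)
  qed
  have hit_sub: "hit r n \<subseteq> I" if n: "n \<ge> n1" for n
    using hit_eq[OF n] n0 by auto
  have hit_io: "\<exists>n\<ge>M. hit r n = I" if M: "M \<ge> n1" for M
  proof -
    define lv where "lv q = Max {l. l \<le> M \<and> r l = q}" for q
    have lv: "lv q \<le> M" "r (lv q) = q" if q: "q \<in> I" for q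
    proof -
      have "{l. l \<le> M \<and> r l = q} \<noteq> {}" using n1[OF M q] by (auto dest: less_imp_le)
      then have "lv q \<in> {l. l \<le> M \<and> r l = q}" unfolding lv_def by (intro Max_in) auto
      then show "lv q \<le> M" "r (lv q) = q" by auto
    qed
    have "I \<noteq> {}" using n0 by blast
    \<comment> \<open>The last visit of \<open>q\<close> up to time \<open>M\<close> is the oldest
      one. Between it and the next occurrence \<open>n\<close> of \<open>q\<close> all other states
      of \<open>I\<close> are visited.\<close>
    then obtain q where q: "q \<in> I" "\<And>q'. q' \<in> I \<Longrightarrow> lv q \<le> lv q'"
      using ex_is_arg_min_if_finite[OF finI, of lv] unfolding is_arg_min_linorder by blast
    define n where "n = (LEAST n. n > M \<and> r n = q)"
    have n: "n > M" "r n = q"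
      using LeastI_ex[OF recS[OF q(1), of M]] unfolding n_def by auto
    have least: "r m \<noteq> q" if "M < m" "m < n" for m
      using not_less_Least[of m "\<lambda>n. n > M \<and> r n = q"] that unfolding n_def by blast
    have set_eq: "{l. l < n \<and> r l = r n} = {l. l \<le> M \<and> r l = q}"
    proof (intro Collect_cong iffI)
      fix l assume l: "l < n \<and> r l = r n"
      then have "\<not> M < l" using least[of l] n(2) by auto
      then show "l \<le> M \<and> r l = q" using l n(2) by simp
    next
      fix l assume "l \<le> M \<and> r l = q"
      then show "l < n \<and> r l = r n" using n by simp
    qed
    have "n1 \<le> n" using n M by simp
    from hit_eq(1)[OF this] have l: "hit r n = r ` {lv q<..n}" unfolding set_eq lv_def .
    have "I \<subseteq> hit r n"
    proof
      fix q' assume q': "q' \<in> I"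
      show "q' \<in> hit r n"
      proof (cases "lv q' = lv q")
        case True
        have "q' = r (lv q')" by (rule lv(2)[OF q', symmetric])
        also have "\<dots> = r n" unfolding True lv(2)[OF q(1)] n(2) ..
        finally have "q' = r n" .
        moreover have "n \<in> {lv q<..n}" using lv(1)[OF q(1)] n(1) by simp
        ultimately show ?thesis unfolding l by (metis imageI)
      next
        case False
        then have "lv q < lv q'" using q(2)[OF q'] by simp
        then have "lv q' \<in> {lv q<..n}" using lv(1)[OF q'] n by simp
        then show ?thesis using lv(2)[OF q'] unfolding l by (metis imageI)
      qed
    qed
    moreover have "n \<ge> n1" using n M by simp
    ultimately show ?thesis using hit_sub[of n] n by (intro exI[of _ n]) auto
  qed
  have inner: "stack r n \<in> inner_lists S" if "n > n0" for n
    using stack_inner[OF r_def, of n] chain_C[OF that] C_last by simp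
  obtain n2 where n2: "n2 \<ge> n1" "hit r n2 = I" using hit_io[of n1] by blast
  define base where "base = stack r (Suc n2)"
  have base: "base \<in> inner_lists S" "base \<noteq> []" "last base = I" "\<forall>A\<in>set base. I \<subseteq> A"
  proof -
    show b: "base \<in> inner_lists S" unfolding base_def using n2 n01 by (intro inner) simp
    then show "base \<noteq> []" by (simp add: inner_lists_def)
    have e: "base = push I (stack r n2)" unfolding base_def stack_Suc[OF n2(1)] n2(2) ..
    show "last base = I" unfolding e push_def by (simp add: Let_def)
    have "\<forall>A\<in>set (takeWhile (\<lambda>A. I \<subseteq> A) (stack r n2)). I \<subseteq> A" by (auto dest: set_takeWhileD)
    then show "\<forall>A\<in>set base. I \<subseteq> A" unfolding e push_def by (auto simp: Let_def)
  qed
  have base_prefix: "prefix base (stack r n)" if "n \<ge> Suc n2" for n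
    using that
  proof (induction n rule: dec_induct)
    case (step n)
    then obtain rest where rest: "stack r n = base @ rest" by (auto simp: prefix_def)
    have "sorted_wrt (\<lambda>A B. B \<subset> A) (base @ rest)"
      using inner[of n] step n2 n01 rest by (simp add: inner_lists_def)
    then show ?case
      using push_above(1)[of base rest I "hit r n"] base hit_sub[of n] stack_Suc[of n] rest step n2 by simp
  qed (simp add: base_def)
  have base_io: "stack r (Suc n) = base" if n: "n \<ge> Suc n2" "hit r n = I" for n
  proof -
    obtain rest where rest: "stack r n = base @ rest" using base_prefix[OF n(1)] by (auto simp: prefix_def)
    have "sorted_wrt (\<lambda>A B. B \<subset> A) (base @ rest)"
      using inner[of n] n n2 n01 rest by (simp add: inner_lists_def)
    then show ?thesis
      using push_above(2)[of base rest I "hit r n"] base stack_Suc[of n] rest n n2 by simp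
  qed
  have Cout: "C \<in> outer_lists"
    using chain_in_outer[of "Suc n0 + card Q" \<xi>] chain_C[of "Suc n0 + card Q"] by (simp add: r_def)
  have lbC: "lb FM (code C) = tr S" using lb_forest[OF Cout] C_last by simp
  have "colr FM (trace \<xi>) = lb (lb FM (code C)) (code base)"
  proof (rule colr_eqI[OF FM_forest trace_seqs])
    have "fst (trace \<xi> n) = code C" if "n > n0" for n
      using chain_C[of "n + card Q"] that by (simp add: trace_def r_def)
    then show "\<forall>\<^sub>\<infinity>n. fst (trace \<xi> n) = code C" unfolding MOST_nat by blast
    have "(code base, snd (trace \<xi> n)) \<in> od (lb FM (code C))" if n: "n \<ge> Suc n2" for n
    proof -
      have "stack r (n + card Q) \<in> inner_lists S" using n n2 n01 by (intro inner) simp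
      moreover have "prefix base (stack r (n + card Q))" using n by (intro base_prefix) simp
      ultimately show ?thesis
        unfolding lbC tr_def trace_def snd_conv r_def[symmetric]
        using od_pforest[OF inner_finite_sets base(1)] by blast
    qed
    then show "\<forall>\<^sub>\<infinity>n. (code base, snd (trace \<xi> n)) \<in> od (lb FM (code C))" unfolding MOST_nat_le by blast
    show "\<exists>\<^sub>\<infinity>n. snd (trace \<xi> n) = code base"
      unfolding INFM_nat_le
    proof
      fix M
      have "n1 \<le> max (Suc n2) (M + card Q)" using n2(1) by (simp add: max_def)
      then obtain n where n: "n \<ge> max (Suc n2) (M + card Q)" "hit r n = I"
        using hit_io by blast
      \<comment> \<open>The subtraction undoes the offset in \<open>trace\<close>; it is not
        truncated because \<open>n\<close> is at least \<open>M + card Q\<close>.\<close>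
      have "snd (trace \<xi> (Suc n - card Q)) = code (stack r (Suc n))" using n by (simp add: trace_def r_def)
      also have "\<dots> = code base" using base_io[of n] n by simp
      finally have "snd (trace \<xi> (Suc n - card Q)) = code base" .
      moreover have "Suc n - card Q \<ge> M" using n(1) by auto
      ultimately show "\<exists>n\<ge>M. snd (trace \<xi> n) = code base" by blast
    qed
  qed
  also have "\<dots> = col (last base)"
    unfolding lbC tr_def pforest_simps
    using decode_code[OF bspec[OF inner_finite_sets base(1)]] by simp
  also have "\<dots> = L \<xi>" unfolding base(3) I_def by (rule col_inf)
  finally show ?thesis .
qed

lemma FM_represents: "represents L FM"
  unfolding represents_def
proof (intro exI conjI allI ballI)
  show "seqcont UNIV trace" by (rule trace_seqcont)
  show "trace \<xi> \<in> seqs FM" for \<xi> by (rule trace_seqs)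
  show "L \<xi> = colr FM (trace \<xi>)" for \<xi> by (rule trace_colour[symmetric])
  show "seqcont (seqs FM) (encM)" by (rule encM_seqcont[OF outer_nonempty])
  show "L (encM s) = colr FM s" if "s \<in> seqs FM" for s
    by (rule encM_colour[OF outer_nonempty that])
qed

end

theorem exists_forest_representation:
  fixes L :: "'x oword \<Rightarrow> nat"
  assumes "L \<in> R_k k"
  shows "\<exists>F\<in>F_T_k k. represents L F"
proof -
  obtain Q f q0 where A: "is_automaton Q f q0" "\<And>\<xi> \<eta>. inf_states f q0 \<xi> = inf_states f q0 \<eta> \<Longrightarrow> L \<xi> = L \<eta>"
    using R_k_automaton[OF assms] by blast
  have Lk: "\<And>\<xi>. L \<xi> < k" using assms by (simp add: R_k_def kpartitions_def)
  interpret determining_automaton Q f q0 L k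
    by unfold_locales (use A Lk in blast)+
  show ?thesis using FM_forest FM_represents by blast
qed

subsection \<open>Quotient orders\<close>

lemma quot_le_iff:
  assumes refl: "\<And>a. a \<in> S \<Longrightarrow> le a a" and trans: "\<And>a b c. le a b \<Longrightarrow> le b c \<Longrightarrow> le a c"
    and ab: "a \<in> S" "b \<in> S"
  shows "quot_le le (equiv_class S le a) (equiv_class S le b) \<longleftrightarrow> le a b"
proof
  assume "quot_le le (equiv_class S le a) (equiv_class S le b)"
  then obtain a' b' where "le a a'" "le a' b'" "le b' b"
    unfolding quot_le_def equiv_class_def by auto
  then show "le a b" using trans[OF trans] by blast
next
  assume "le a b"
  then show "quot_le le (equiv_class S le a) (equiv_class S le b)"
    unfolding quot_le_def equiv_class_def using refl[OF ab(1)] refl[OF ab(2)] ab by auto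
qed

text \<open>A relation that is total on both sides and matches the two preorders induces an
  isomorphism of the quotients; it need not be a function, as related elements are determined up to
  equivalence.\<close>

lemma quot_isoI:
  assumes reflS: "\<And>a. a \<in> S \<Longrightarrow> le a a" and transS: "\<And>a b c. le a b \<Longrightarrow> le b c \<Longrightarrow> le a c"
    and reflT: "\<And>a. a \<in> T \<Longrightarrow> le' a a" and transT: "\<And>a b c. le' a b \<Longrightarrow> le' b c \<Longrightarrow> le' a c"
    and ex1: "\<And>a. a \<in> S \<Longrightarrow> \<exists>t\<in>T. E a t" and ex2: "\<And>t. t \<in> T \<Longrightarrow> \<exists>a\<in>S. E a t"
    and iff: "\<And>a b t u. a \<in> S \<Longrightarrow> b \<in> S \<Longrightarrow> t \<in> T \<Longrightarrow> u \<in> T \<Longrightarrow> E a t \<Longrightarrow> E b u \<Longrightarrow> le a b \<longleftrightarrow> le' t u"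
  shows "quot_iso S le T le'"
proof -
  have "\<forall>a\<in>S. \<exists>t. t \<in> T \<and> E a t" using ex1 by blast
  then obtain g where "\<forall>a\<in>S. g a \<in> T \<and> E a (g a)" by (elim bchoice[elim_format] exE)
  then have g: "\<And>a. a \<in> S \<Longrightarrow> g a \<in> T" "\<And>a. a \<in> S \<Longrightarrow> E a (g a)" by blast+
  have g_iff: "le a b \<longleftrightarrow> le' (g a) (g b)" if "a \<in> S" "b \<in> S" for a b
    using iff[of a b "g a" "g b"] g that by blast
  have clS: "equiv_class S le a = equiv_class S le b" if "le a b" "le b a" for a b
    unfolding equiv_class_def using transS that by blast
  have clT: "equiv_class T le' a = equiv_class T le' b" if "le' a b" "le' b a" for a b
    unfolding equiv_class_def using transT that by blast
  define h where "h C = equiv_class T le' (g (SOME a. a \<in> C))" for C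
  have h: "h (equiv_class S le a) = equiv_class T le' (g a)" if a: "a \<in> S" for a
  proof -
    have "a \<in> equiv_class S le a" using a reflS by (simp add: equiv_class_def)
    then have "(SOME b. b \<in> equiv_class S le a) \<in> equiv_class S le a" by (rule someI)
    then have b: "(SOME b. b \<in> equiv_class S le a) \<in> S" "le a (SOME b. b \<in> equiv_class S le a)"
      "le (SOME b. b \<in> equiv_class S le a) a" by (auto simp: equiv_class_def)
    show ?thesis unfolding h_def using g_iff[OF a b(1)] g_iff[OF b(1) a] b by (intro clT) auto
  qed
  have qS: "quot_le le (equiv_class S le a) (equiv_class S le b) \<longleftrightarrow> le a b" if "a \<in> S" "b \<in> S" for a b
    by (rule quot_le_iff[OF reflS transS that])
  have qT: "quot_le le' (equiv_class T le' a) (equiv_class T le' b) \<longleftrightarrow> le' a b" if "a \<in> T" "b \<in> T" for a b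
    by (rule quot_le_iff[OF reflT transT that])
  have order: "quot_le le C D \<longleftrightarrow> quot_le le' (h C) (h D)"
    if CD: "C \<in> quot_classes S le" "D \<in> quot_classes S le" for C D
  proof -
    obtain a b where ab: "a \<in> S" "b \<in> S" "C = equiv_class S le a" "D = equiv_class S le b"
      using CD unfolding quot_classes_def by blast
    show ?thesis unfolding ab h[OF ab(1)] h[OF ab(2)] qS[OF ab(1,2)] qT[OF g(1)[OF ab(1)] g(1)[OF ab(2)]]
      by (rule g_iff[OF ab(1,2)])
  qed
  have "bij_betw h (quot_classes S le) (quot_classes T le')"
    unfolding bij_betw_def
  proof
    show "inj_on h (quot_classes S le)"
    proof (rule inj_onI)
      fix C D assume C: "C \<in> quot_classes S le" and D: "D \<in> quot_classes S le" and eq: "h C = h D"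
      obtain a b where ab: "a \<in> S" "b \<in> S" "C = equiv_class S le a" "D = equiv_class S le b"
        using C D unfolding quot_classes_def by blast
      have "g a \<in> equiv_class T le' (g a)" using g ab reflT by (simp add: equiv_class_def)
      then have "g a \<in> equiv_class T le' (g b)" using eq h ab by simp
      then have "le' (g a) (g b)" "le' (g b) (g a)" by (auto simp: equiv_class_def)
      then show "C = D" using g_iff ab clS by simp
    qed
    show "h ` quot_classes S le = quot_classes T le'"
    proof (intro set_eqI iffI)
      fix D assume "D \<in> h ` quot_classes S le"
      then obtain a where "a \<in> S" "D = h (equiv_class S le a)" unfolding quot_classes_def by blast
      then show "D \<in> quot_classes T le'" using h g by (simp add: quot_classes_def)
    next
      fix D assume "D \<in> quot_classes T le'"
      then obtain t where t: "t \<in> T" "D = equiv_class T le' t" unfolding quot_classes_def by blast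
      obtain a where a: "a \<in> S" "E a t" using ex2[OF t(1)] by blast
      have "le' (g a) t" "le' t (g a)"
        using iff[OF a(1) a(1) g(1)[OF a(1)] t(1) g(2)[OF a(1)] a(2)] iff[OF a(1) a(1) t(1) g(1)[OF a(1)] a(2) g(2)[OF a(1)]]
          reflS[OF a(1)] by auto
      then have "h (equiv_class S le a) = D" unfolding h[OF a(1)] t(2) by (rule clT)
      then show "D \<in> h ` quot_classes S le" using a(1) by (auto simp: quot_classes_def)
    qed
  qed
  then show ?thesis unfolding quot_iso_def using order by blast
qed

lemma ca_le_refl: "ca_le A A"
  unfolding ca_le_iff by (intro exI[of _ "\<lambda>x. x"]) (auto simp: seqcont_def)

lemma ca_le_trans:
  assumes "ca_le A B" "ca_le B C"
  shows "ca_le A C"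
proof -
  obtain g where g: "seqcont UNIV g" "\<forall>\<xi>. A \<xi> = B (g \<xi>)" using assms(1) unfolding ca_le_iff by blast
  obtain h where h: "seqcont UNIV h" "\<forall>\<xi>. B \<xi> = C (h \<xi>)" using assms(2) unfolding ca_le_iff by blast
  have "seqcont UNIV (\<lambda>\<xi>. h (g \<xi>))" by (rule seqcont_comp[OF g(1) h(1)]) simp
  then show ?thesis unfolding ca_le_iff using g(2) h(2) by auto
qed

lemma h_le_trans:
  assumes tr: "\<And>a b c. leq a b \<Longrightarrow> leq b c \<Longrightarrow> leq a c" and "h_le leq F G" "h_le leq G H"
  shows "h_le leq F H"
proof -
  obtain \<phi> where \<phi>: "\<phi> ` nd F \<subseteq> nd G" "\<forall>x\<in>nd F. \<forall>y\<in>nd F. (x, y) \<in> od F \<longrightarrow> (\<phi> x, \<phi> y) \<in> od G"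
    "\<forall>x\<in>nd F. leq (lb F x) (lb G (\<phi> x))" using assms(2) unfolding h_le_alt by (elim exE conjE)
  obtain \<psi> where \<psi>: "\<psi> ` nd G \<subseteq> nd H" "\<forall>x\<in>nd G. \<forall>y\<in>nd G. (x, y) \<in> od G \<longrightarrow> (\<psi> x, \<psi> y) \<in> od H"
    "\<forall>x\<in>nd G. leq (lb G x) (lb H (\<psi> x))" using assms(3) unfolding h_le_alt by (elim exE conjE)
  have 1: "\<phi> x \<in> nd G" if "x \<in> nd F" for x using \<phi>(1) that by blast
  show ?thesis
    unfolding h_le_alt
  proof (intro exI[of _ "\<lambda>x. \<psi> (\<phi> x)"] conjI ballI impI)
    show "(\<lambda>x. \<psi> (\<phi> x)) ` nd F \<subseteq> nd H" using \<psi>(1) 1 by blast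
    show "(\<psi> (\<phi> x), \<psi> (\<phi> y)) \<in> od H" if "x \<in> nd F" "y \<in> nd F" "(x, y) \<in> od F" for x y
      using \<phi>(2) \<psi>(2) 1 that by simp
    show "leq (lb F x) (lb H (\<psi> (\<phi> x)))" if "x \<in> nd F" for x
      using tr[of "lb F x" "lb G (\<phi> x)"] \<phi>(3) \<psi>(3) 1 that by simp
  qed
qed

lemma h_le_refl: "(\<And>a. leq a a) \<Longrightarrow> h_le leq F F"
  unfolding h_le_alt by (intro exI[of _ "\<lambda>x. x"]) simp

lemma le_T_refl: "le_T F F"
  unfolding le_T_def by (rule h_le_refl) simp

lemma le_T_trans: "le_T F G \<Longrightarrow> le_T G H \<Longrightarrow> le_T F H"
  unfolding le_T_def by (rule h_le_trans[of "(=)"]) simp_all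

lemma le_F_refl: "le_F F F"
  unfolding le_F_def by (rule h_le_refl) (rule le_T_refl)

lemma le_F_trans: "le_F F G \<Longrightarrow> le_F G H \<Longrightarrow> le_F F H"
  unfolding le_F_def by (rule h_le_trans[of le_T]) (rule le_T_trans)

theorem theorem4p1:
  fixes k :: nat
  assumes "CARD('x::finite) \<ge> 2" and "k \<ge> 2"
  shows "quot_iso (R_k k :: ('x oword \<Rightarrow> nat) set) ca_le (A_k k :: ('x oword \<Rightarrow> nat) set) ca_le
       \<and> quot_iso (R_k k :: ('x oword \<Rightarrow> nat) set) ca_le (F_T_k k) le_F
       \<and> quot_iso (A_k k :: ('x oword \<Rightarrow> nat) set) ca_le (F_T_k k) le_F"
proof -
  have forest: "\<exists>F\<in>F_T_k k. represents L F" if "L \<in> R_k k" for L :: "'x oword \<Rightarrow> nat"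
    using that by (rule exists_forest_representation)
  have part: "\<exists>L\<in>A_k k. represents (L :: 'x oword \<Rightarrow> nat) F" if "F \<in> F_T_k k" for F
    using exists_aperiodic_representation[OF assms(1) that] by blast
  have AR: "L \<in> R_k k" if "L \<in> A_k k" for L :: "'x oword \<Rightarrow> nat"
    using that A_k_subset_R_k by blast
  \<comment> \<open>One argument serves both classes: members of \<open>S\<close> have forests
    because they are regular, and each forest is represented in \<open>S\<close> because
    \<open>S\<close> contains the aperiodic partitions.\<close>
  have iso: "quot_iso S ca_le (F_T_k k) le_F"
    if S: "A_k k \<subseteq> S" "S \<subseteq> R_k k" for S :: "('x oword \<Rightarrow> nat) set"
  proof (rule quot_isoI[where E = represents])
    show "\<exists>F\<in>F_T_k k. represents L F" if "L \<in> S" for L using forest S that by blast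
    show "\<exists>L\<in>S. represents L F" if "F \<in> F_T_k k" for F using part[OF that] S by blast
    show "ca_le L L' \<longleftrightarrow> le_F F G" if "F \<in> F_T_k k" "G \<in> F_T_k k" "represents L F" "represents L' G" for L L' F G
      using that by (rule ca_le_iff_le_F)
  qed (rule ca_le_refl ca_le_trans le_F_refl le_F_trans; assumption)+
  have "quot_iso (R_k k :: ('x oword \<Rightarrow> nat) set) ca_le (A_k k :: ('x oword \<Rightarrow> nat) set) ca_le"
  \<comment> \<open>Regular and aperiodic partitions are matched through a common forest.\<close>
  proof (rule quot_isoI[where E = "\<lambda>L L'. \<exists>F\<in>F_T_k k. represents L F \<and> represents L' F"])
    show "\<exists>L'\<in>A_k k. \<exists>F\<in>F_T_k k. represents L F \<and> represents (L' :: 'x oword \<Rightarrow> nat) F"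
      if "L \<in> R_k k" for L :: "'x oword \<Rightarrow> nat"
      using forest[OF that] part by blast
    show "\<exists>L\<in>R_k k. \<exists>F\<in>F_T_k k. represents (L :: 'x oword \<Rightarrow> nat) F \<and> represents L' F"
      if "L' \<in> A_k k" for L' :: "'x oword \<Rightarrow> nat"
      using forest[OF AR[OF that]] AR[OF that] by blast
    fix L1 L2 M1 M2 :: "'x oword \<Rightarrow> nat"
    assume "\<exists>F\<in>F_T_k k. represents L1 F \<and> represents M1 F" "\<exists>F\<in>F_T_k k. represents L2 F \<and> represents M2 F"
    then obtain F G where "F \<in> F_T_k k" "represents L1 F" "represents M1 F" "G \<in> F_T_k k" "represents L2 G" "represents M2 G"
      by blast
    then show "ca_le L1 L2 \<longleftrightarrow> ca_le M1 M2" using ca_le_iff_le_F by metis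
  qed (rule ca_le_refl, (rule ca_le_trans; assumption), rule ca_le_refl, (rule ca_le_trans; assumption))
  then show ?thesis using iso[of "R_k k"] iso[of "A_k k"] A_k_subset_R_k by blast
qed

end
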